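(* Let $V\subseteq K^n$ be a differential variety over $k$ (not necessarily irreducible) given by differential polynomials of order at most $r$. Set $$s_0:=m\,C_{r,m}^n\binom{C_{r,m}^n+m-1}{C_{r,m}^n}-m.$$ Then, for all $s\in\mathbb N$ with $s\geq s_0$ and any irreducible component $W$ of $V$, we have $$\omega_W(s)=\operatorname{trdeg}_k k(\delta^{\xi}b_i:\operatorname{ord}\xi\leq s,\ i=1,\dots,n),$$ where $b=(b_1,\dots,b_n)$ is a generic point of $W$ over $k$.
   Context: Setting: $(K,\Delta)$ is a differentially closed field of characteristic zero with $m\ge 1$ commuting derivations $\Delta=\{\delta_1,\dots,\delta_m\}$, assumed to be a saturated (universal) model of $\mathrm{DCF}_{0,m}$; $k$ is a small differential subfield of $K$ (small: cardinality less than $|K|$). For $\xi=(u_1,\dots,u_m)\in\mathbb N^m$, $\operatorname{ord}\xi=u_1+\cdots+u_m$ and $\delta^\xi=\delta_1^{u_1}\cdots\delta_m^{u_m}$. The order of a differential polynomial is the largest $\operatorname{ord}\xi$ such that some $\delta^\xi x_i$ appears in it. A numerical polynomial is $p\in\mathbb Q[t]$ with $p(s)\in\mathbb Z$ for all integers $s$. Kolchin polynomial: for a tuple $b=(b_1,\dots,b_n)$ from $K$, $\omega_{b/k}$ is the (unique, existing by a theorem of Kolchin) numerical polynomial with $\omega_{b/k}(s)=\operatorname{trdeg}_k k(\delta^\xi b_i:\operatorname{ord}\xi\le s,\ 1\le i\le n)$ for all sufficiently large $s\in\mathbb N$. A differential variety $V\subseteq K^n$ over $k$ is the zero set in $K^n$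 of a collection of differential polynomials over $k$ in $n\ge 1$ differential indeterminates; irreducible components are taken over $k$ (they correspond to the minimal primes of the radical differential ideal of $V$ in $k\{x_1,\dots,x_n\}$). A generic point over $k$ of an irreducible $W$ is $b\in W$ such that the differential polynomials over $k$ vanishing at $b$ are exactly those vanishing on $W$; $\omega_W:=\omega_{b/k}$. The numbers $C_{r,m}^n$ ($r\ge 0$, $n,m\ge 1$) are defined by $$C_{0,m}^1=0,\qquad C_{r,m}^1=A(m-1,C_{r-1,m}^1)\ (r\ge1),\qquad C_{r,m}^n=C^1_{C_{r,m}^{n-1},m}\ (n\ge 2),$$ where $A:\mathbb N\times\mathbb N\to\mathbb N$ is the Ackermann function: $A(0,y)=y+1$, $A(x+1,0)=A(x,1)$, $A(x+1,y+1)=A(x,A(x+1,y))$. *)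

theory Defs
  imports
    "HOL-Library.Poly_Mapping"
    "HOL-Library.Cardinality"
    "HOL-Library.Equipollence"
    "HOL-Algebra.Generated_Fields"
    "HOL-Algebra.Algebraic_Closure_Type"
begin

text \<open>
  Conventions. The field \<open>K\<close> is the whole type \<open>'a\<close>; its derivations are indexed by a finite type
  \<open>'m\<close>, so that \<open>m = CARD('m)\<close> is at least 1, and the coordinates of \<open>K\<^sup>n\<close> by a finite type \<open>'n\<close>
  with \<open>n = CARD('n)\<close>. Where \<open>K\<close> has to be viewed as a structure with an explicit carrier, it is
  \<open>ring_of_type_algebra\<close>.
\<close>

section \<open>Differential fields\<close>

definition derivation :: "('b, 'c) ring_scheme \<Rightarrow> ('b \<Rightarrow> 'b) \<Rightarrow> bool" where
  "derivation R d \<longleftrightarrow>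
     (\<forall>x\<in>carrier R. d x \<in> carrier R) \<and>
     (\<forall>x\<in>carrier R. \<forall>y\<in>carrier R. d (x \<oplus>\<^bsub>R\<^esub> y) = d x \<oplus>\<^bsub>R\<^esub> d y) \<and>
     (\<forall>x\<in>carrier R. \<forall>y\<in>carrier R.
        d (x \<otimes>\<^bsub>R\<^esub> y) = (d x \<otimes>\<^bsub>R\<^esub> y) \<oplus>\<^bsub>R\<^esub> (x \<otimes>\<^bsub>R\<^esub> d y))"

definition differential_field :: "('b, 'c) ring_scheme \<Rightarrow> ('m \<Rightarrow> 'b \<Rightarrow> 'b) \<Rightarrow> bool" where
  "differential_field R \<delta> \<longleftrightarrow>
     Ring.field R \<and> (\<forall>j. derivation R (\<delta> j)) \<and>
     (\<forall>i j. \<forall>x\<in>carrier R. \<delta> i (\<delta> j x) = \<delta> j (\<delta> i x))"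

definition differential_subfield :: "('m \<Rightarrow> 'a::field \<Rightarrow> 'a) \<Rightarrow> 'a set \<Rightarrow> bool" where
  "differential_subfield \<delta> k \<longleftrightarrow>
     subfield k (ring_of_type_algebra :: 'a ring) \<and> (\<forall>j. \<forall>x\<in>k. \<delta> j x \<in> k)"

definition mord :: "('m::finite \<Rightarrow> nat) \<Rightarrow> nat" where
  "mord \<xi> = (\<Sum>j\<in>UNIV. \<xi> j)"

text \<open>The fold is well defined, i.e. independent of the order of composition, because the
  derivations commute.\<close>

definition dpow :: "('m::finite \<Rightarrow> 'a \<Rightarrow> 'a) \<Rightarrow> ('m \<Rightarrow> nat) \<Rightarrow> 'a \<Rightarrow> 'a" where
  "dpow \<delta> \<xi> x = Finite_Set.fold (\<lambda>j. \<delta> j ^^ \<xi> j) x UNIV"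


section \<open>First-order formulas in the language of differential rings\<close>

text \<open>Variables are named by natural numbers and parameters are elements of \<open>'c\<close>.\<close>

datatype ('m, tparams: 'c) dterm =
    Var nat
  | Param 'c
  | Zero
  | One
  | Add "('m, 'c) dterm" "('m, 'c) dterm"
  | Mult "('m, 'c) dterm" "('m, 'c) dterm"
  | Minus "('m, 'c) dterm"
  | Der 'm "('m, 'c) dterm"

datatype ('m, fparams: 'c) dform =
    FEq "('m, 'c) dterm" "('m, 'c) dterm"
  | FNot "('m, 'c) dform"
  | FAnd "('m, 'c) dform" "('m, 'c) dform"
  | FEx nat "('m, 'c) dform"

primrec tvars :: "('m, 'c) dterm \<Rightarrow> nat set" where
  "tvars (Var v) = {v}"
| "tvars (Param c) = {}"
| "tvars Zero = {}"
| "tvars One = {}"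
| "tvars (Add t u) = tvars t \<union> tvars u"
| "tvars (Mult t u) = tvars t \<union> tvars u"
| "tvars (Minus t) = tvars t"
| "tvars (Der j t) = tvars t"

primrec free_vars :: "('m, 'c) dform \<Rightarrow> nat set" where
  "free_vars (FEq t u) = tvars t \<union> tvars u"
| "free_vars (FNot \<phi>) = free_vars \<phi>"
| "free_vars (FAnd \<phi> \<psi>) = free_vars \<phi> \<union> free_vars \<psi>"
| "free_vars (FEx v \<phi>) = free_vars \<phi> - {v}"

primrec quantifier_free :: "('m, 'c) dform \<Rightarrow> bool" where
  "quantifier_free (FEq t u) \<longleftrightarrow> True"
| "quantifier_free (FNot \<phi>) \<longleftrightarrow> quantifier_free \<phi>"
| "quantifier_free (FAnd \<phi> \<psi>) \<longleftrightarrow> quantifier_free \<phi> \<and> quantifier_free \<psi>"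
| "quantifier_free (FEx v \<phi>) \<longleftrightarrow> False"

text \<open>Below, \<open>h\<close> interprets the parameters and \<open>e\<close> the variables in the structure \<open>(R, \<delta>)\<close>.\<close>

primrec tval ::
    "('b, 'd) ring_scheme \<Rightarrow> ('m \<Rightarrow> 'b \<Rightarrow> 'b) \<Rightarrow> ('c \<Rightarrow> 'b) \<Rightarrow> (nat \<Rightarrow> 'b) \<Rightarrow> ('m, 'c) dterm \<Rightarrow> 'b" where
  "tval R \<delta> h e (Var v) = e v"
| "tval R \<delta> h e (Param c) = h c"
| "tval R \<delta> h e Zero = \<zero>\<^bsub>R\<^esub>"
| "tval R \<delta> h e One = \<one>\<^bsub>R\<^esub>"
| "tval R \<delta> h e (Add t u) = tval R \<delta> h e t \<oplus>\<^bsub>R\<^esub> tval R \<delta> h e u"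
| "tval R \<delta> h e (Mult t u) = tval R \<delta> h e t \<otimes>\<^bsub>R\<^esub> tval R \<delta> h e u"
| "tval R \<delta> h e (Minus t) = \<ominus>\<^bsub>R\<^esub> tval R \<delta> h e t"
| "tval R \<delta> h e (Der j t) = \<delta> j (tval R \<delta> h e t)"

primrec sat ::
    "('b, 'd) ring_scheme \<Rightarrow> ('m \<Rightarrow> 'b \<Rightarrow> 'b) \<Rightarrow> ('c \<Rightarrow> 'b) \<Rightarrow> (nat \<Rightarrow> 'b) \<Rightarrow> ('m, 'c) dform \<Rightarrow> bool" where
  "sat R \<delta> h e (FEq t u) \<longleftrightarrow> tval R \<delta> h e t = tval R \<delta> h e u"
| "sat R \<delta> h e (FNot \<phi>) \<longleftrightarrow> \<not> sat R \<delta> h e \<phi>"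
| "sat R \<delta> h e (FAnd \<phi> \<psi>) \<longleftrightarrow> sat R \<delta> h e \<phi> \<and> sat R \<delta> h e \<psi>"
| "sat R \<delta> h e (FEx v \<phi>) \<longleftrightarrow> (\<exists>a\<in>carrier R. sat R \<delta> h (e(v := a)) \<phi>)"


section \<open>Differentially closed and saturated differential fields\<close>

definition differential_extension ::
    "('m \<Rightarrow> 'a::field \<Rightarrow> 'a) \<Rightarrow> 'b ring \<Rightarrow> ('m \<Rightarrow> 'b \<Rightarrow> 'b) \<Rightarrow> ('a \<Rightarrow> 'b) \<Rightarrow> bool" where
  "differential_extension \<delta> L \<delta>' h \<longleftrightarrow>
     differential_field L \<delta>' \<and> h \<in> ring_hom ring_of_type_algebra L \<and>
     (\<forall>j x. h (\<delta> j x) = \<delta>' j (h x))"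

text \<open>
  A differential field is differentially closed if every finite system of differential polynomial
  equations and inequations over it (equivalently, every quantifier-free formula) that has a
  solution in some differential field extension has a solution in the field itself. It is no
  restriction that the carrier of the extension \<open>L\<close> consists of elements of the type \<open>'a\<close>: the
  differential subfield generated by \<open>K\<close> and a solution has the cardinality of the infinite field
  \<open>K\<close>, so that a copy of it lives on \<open>'a\<close>.
\<close>

definition differentially_closed :: "('m \<Rightarrow> 'a::field_char_0 \<Rightarrow> 'a) \<Rightarrow> bool" where
  "differentially_closed \<delta> \<longleftrightarrow>
     differential_field (ring_of_type_algebra :: 'a ring) \<delta> \<and>
     (\<forall>(L :: 'a ring) \<delta>' h (\<phi> :: ('m, 'a) dform) e.
        differential_extension \<delta> L \<delta>' h \<longrightarrow> quantifier_free \<phi> \<longrightarrow>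
        range e \<subseteq> carrier L \<longrightarrow> sat L \<delta>' h e \<phi> \<longrightarrow>
        (\<exists>e'. sat ring_of_type_algebra \<delta> id e' \<phi>))"

text \<open>
  Every 1-type over a parameter set \<open>A\<close> with \<open>|A| < |K|\<close> (\<open>\<prec>\<close> is strict comparison of
  cardinalities) that is finitely satisfiable in \<open>K\<close> is realized in \<open>K\<close>. The free variable
  of the type is variable 0.
\<close>

definition saturated :: "('m \<Rightarrow> 'a::field \<Rightarrow> 'a) \<Rightarrow> bool" where
  "saturated \<delta> \<longleftrightarrow>
     (\<forall>(A :: 'a set) (\<Phi> :: ('m, 'a) dform set).
        A \<prec> (UNIV :: 'a set) \<longrightarrow>
        (\<forall>\<phi>\<in>\<Phi>. fparams \<phi> \<subseteq> A \<and> free_vars \<phi> \<subseteq> {0}) \<longrightarrow>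
        (\<forall>\<Phi>\<^sub>0\<subseteq>\<Phi>. finite \<Phi>\<^sub>0 \<longrightarrow>
           (\<exists>a. \<forall>\<phi>\<in>\<Phi>\<^sub>0. sat ring_of_type_algebra \<delta> id (\<lambda>_. a) \<phi>)) \<longrightarrow>
        (\<exists>a. \<forall>\<phi>\<in>\<Phi>. sat ring_of_type_algebra \<delta> id (\<lambda>_. a) \<phi>))"


section \<open>Polynomials and differential polynomials\<close>

text \<open>Polynomials in indeterminates from \<open>'v\<close>: finitely supported maps from monomials (finitely
  supported exponent functions) to coefficients.\<close>

type_synonym ('v, 'a) mpol = "('v \<Rightarrow>\<^sub>0 nat) \<Rightarrow>\<^sub>0 'a"

definition mp_vars :: "('v, 'a::zero) mpol \<Rightarrow> 'v set" where
  "mp_vars p = (\<Union>\<mu>\<in>Poly_Mapping.keys p. Poly_Mapping.keys \<mu>)"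

definition mp_over :: "'a set \<Rightarrow> ('v, 'a::zero) mpol \<Rightarrow> bool" where
  "mp_over k p \<longleftrightarrow> (\<forall>\<mu>\<in>Poly_Mapping.keys p. Poly_Mapping.lookup p \<mu> \<in> k)"

definition mp_eval :: "('v \<Rightarrow> 'a) \<Rightarrow> ('v, 'a::comm_semiring_1) mpol \<Rightarrow> 'a" where
  "mp_eval f p =
     (\<Sum>\<mu>\<in>Poly_Mapping.keys p. Poly_Mapping.lookup p \<mu> *
        (\<Prod>v\<in>Poly_Mapping.keys \<mu>. f v ^ Poly_Mapping.lookup \<mu> v))"

text \<open>A differential polynomial is a polynomial in the indeterminates \<open>\<delta>\<^sup>\<xi> x\<^sub>i\<close>, encoded as the
  pairs \<open>(i, \<xi>)\<close>.\<close>

type_synonym ('n, 'm, 'a) dpol = "('n \<times> ('m \<Rightarrow> nat), 'a) mpol"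

text \<open>A constant has order 0.\<close>

definition dp_order :: "('n, 'm::finite, 'a::zero) dpol \<Rightarrow> nat" where
  "dp_order p = Max (insert 0 ((\<lambda>(i, \<xi>). mord \<xi>) ` mp_vars p))"

definition dp_eval ::
    "('m::finite \<Rightarrow> 'a \<Rightarrow> 'a) \<Rightarrow> ('n \<Rightarrow> 'a) \<Rightarrow> ('n, 'm, 'a::comm_semiring_1) dpol \<Rightarrow> 'a" where
  "dp_eval \<delta> b p = mp_eval (\<lambda>(i, \<xi>). dpow \<delta> \<xi> (b i)) p"


section \<open>Differential varieties\<close>

definition zero_set ::
    "('m::finite \<Rightarrow> 'a::comm_semiring_1 \<Rightarrow> 'a) \<Rightarrow> ('n, 'm, 'a) dpol set \<Rightarrow> ('n \<Rightarrow> 'a) set" where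
  "zero_set \<delta> S = {b. \<forall>p\<in>S. dp_eval \<delta> b p = 0}"

definition diff_variety ::
    "('m::finite \<Rightarrow> 'a::comm_semiring_1 \<Rightarrow> 'a) \<Rightarrow> 'a set \<Rightarrow> ('n \<Rightarrow> 'a) set \<Rightarrow> bool" where
  "diff_variety \<delta> k V \<longleftrightarrow>
     (\<exists>S :: ('n, 'm, 'a) dpol set. (\<forall>p\<in>S. mp_over k p) \<and> V = zero_set \<delta> S)"

definition irreducible_variety ::
    "('m::finite \<Rightarrow> 'a::comm_semiring_1 \<Rightarrow> 'a) \<Rightarrow> 'a set \<Rightarrow> ('n \<Rightarrow> 'a) set \<Rightarrow> bool" where
  "irreducible_variety \<delta> k W \<longleftrightarrow>
     diff_variety \<delta> k W \<and> W \<noteq> {} \<and>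
     (\<forall>W\<^sub>1 W\<^sub>2. diff_variety \<delta> k W\<^sub>1 \<longrightarrow> diff_variety \<delta> k W\<^sub>2 \<longrightarrow>
        W = W\<^sub>1 \<union> W\<^sub>2 \<longrightarrow> W = W\<^sub>1 \<or> W = W\<^sub>2)"

definition irreducible_component ::
    "('m::finite \<Rightarrow> 'a::comm_semiring_1 \<Rightarrow> 'a) \<Rightarrow> 'a set \<Rightarrow> ('n \<Rightarrow> 'a) set \<Rightarrow> ('n \<Rightarrow> 'a) set \<Rightarrow> bool"
  where
  "irreducible_component \<delta> k V W \<longleftrightarrow>
     irreducible_variety \<delta> k W \<and> W \<subseteq> V \<and>
     (\<forall>W'. irreducible_variety \<delta> k W' \<longrightarrow> W \<subseteq> W' \<longrightarrow> W' \<subseteq> V \<longrightarrow> W' = W)"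

definition generic_point ::
    "('m::finite \<Rightarrow> 'a::comm_semiring_1 \<Rightarrow> 'a) \<Rightarrow> 'a set \<Rightarrow> ('n \<Rightarrow> 'a) set \<Rightarrow> ('n \<Rightarrow> 'a) \<Rightarrow> bool" where
  "generic_point \<delta> k W b \<longleftrightarrow>
     b \<in> W \<and>
     (\<forall>p :: ('n, 'm, 'a) dpol. mp_over k p \<longrightarrow>
        (dp_eval \<delta> b p = 0 \<longleftrightarrow> (\<forall>w\<in>W. dp_eval \<delta> w p = 0)))"


section \<open>Transcendence degree and the Kolchin polynomial\<close>

text \<open>The elements of \<open>B\<close> serve as their own indeterminates.\<close>

definition alg_independent :: "'a::field set \<Rightarrow> 'a set \<Rightarrow> bool" where
  "alg_independent k B \<longleftrightarrow>
     (\<forall>p :: ('a, 'a) mpol. mp_over k p \<longrightarrow> mp_vars p \<subseteq> B \<longrightarrow> mp_eval id p = 0 \<longrightarrow> p = 0)"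

definition transcendence_basis :: "'a::field set \<Rightarrow> 'a set \<Rightarrow> 'a set \<Rightarrow> bool" where
  "transcendence_basis k F B \<longleftrightarrow>
     B \<subseteq> F \<and> alg_independent k B \<and>
     (\<forall>B'. B \<subseteq> B' \<longrightarrow> B' \<subseteq> F \<longrightarrow> alg_independent k B' \<longrightarrow> B' = B)"

text \<open>Only meaningful when the transcendence degree is finite (as for finitely generated \<open>F\<close>).\<close>

definition trdeg :: "'a::field set \<Rightarrow> 'a set \<Rightarrow> nat" where
  "trdeg k F = card (SOME B. transcendence_basis k F B)"

text \<open>The field generated over \<open>k\<close> by all \<open>\<delta>\<^sup>\<xi> b\<^sub>i\<close> with \<open>\<xi>\<close> of order at most \<open>s\<close>.\<close>

definition jet_field :: "('m::finite \<Rightarrow> 'a::field \<Rightarrow> 'a) \<Rightarrow> 'a set \<Rightarrow> ('n \<Rightarrow> 'a) \<Rightarrow> nat \<Rightarrow> 'a set" where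
  "jet_field \<delta> k b s =
     generate_field ring_of_type_algebra (k \<union> {dpow \<delta> \<xi> (b i) | \<xi> i. mord \<xi> \<le> s})"

definition numerical_polynomial :: "rat poly \<Rightarrow> bool" where
  "numerical_polynomial p \<longleftrightarrow> (\<forall>s::int. poly p (of_int s) \<in> \<int>)"

definition kolchin_poly :: "('m::finite \<Rightarrow> 'a::field \<Rightarrow> 'a) \<Rightarrow> 'a set \<Rightarrow> ('n \<Rightarrow> 'a) \<Rightarrow> rat poly" where
  "kolchin_poly \<delta> k b =
     (THE p. numerical_polynomial p \<and>
        (\<forall>\<^sub>F s in sequentially. poly p (of_nat s) = of_nat (trdeg k (jet_field \<delta> k b s))))"

text \<open>The choice of the generic point is immaterial: any two have isomorphic differential fields
  over \<open>k\<close>.\<close>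

definition kolchin_poly_variety ::
    "('m::finite \<Rightarrow> 'a::field \<Rightarrow> 'a) \<Rightarrow> 'a set \<Rightarrow> ('n \<Rightarrow> 'a) set \<Rightarrow> rat poly" where
  "kolchin_poly_variety \<delta> k W = kolchin_poly \<delta> k (SOME b. generic_point \<delta> k W b)"


section \<open>The Ackermann function and the numbers \<open>C\<close>\<close>

fun ack :: "nat \<Rightarrow> nat \<Rightarrow> nat" where
  "ack 0 y = y + 1"
| "ack (Suc x) 0 = ack x 1"
| "ack (Suc x) (Suc y) = ack x (ack (Suc x) y)"

primrec C1 :: "nat \<Rightarrow> nat \<Rightarrow> nat" where
  "C1 m 0 = 0"
| "C1 m (Suc r) = ack (m - 1) (C1 m r)"

text \<open>\<open>Cnum m n r\<close> is \<open>C\<^sub>r\<^sub>,\<^sub>m\<^sup>n\<close>; the value at \<open>n = 0\<close> is a dummy.\<close>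

fun Cnum :: "nat \<Rightarrow> nat \<Rightarrow> nat \<Rightarrow> nat" where
  "Cnum m 0 r = 0"
| "Cnum m (Suc 0) r = C1 m r"
| "Cnum m (Suc (Suc n)) r = C1 m (Cnum m (Suc n) r)"

text \<open>Integer-valued, since it is \<open>-m\<close> when \<open>Cnum m n r = 0\<close>.\<close>

definition s_bound :: "nat \<Rightarrow> nat \<Rightarrow> nat \<Rightarrow> int" where
  "s_bound m n r =
     int m * int (Cnum m n r) * int ((Cnum m n r + m - 1) choose Cnum m n r) - int m"

end

theory Submission
  imports
    Defs
    "HOL-Library.Countable"
    "HOL-Algebra.Weak_Morphisms"
    "HOL-Computational_Algebra.Polynomial"
    "HOL-Computational_Algebra.Fraction_Field"
begin

text \<open>
  Order the derivatives \<open>\<delta>\<^sup>\<xi> b\<^sub>i\<close> of the generic point by an orderly ranking, and call one a leader if it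
  is algebraic over \<open>k\<close> and the lower ones. Leaders of the coordinate \<open>i\<close> form a monomial ideal \<open>E\<^sub>i\<close>,
  and the transcendence degree in question counts the exponents of order at most \<open>s\<close> outside these
  ideals. If all \<open>E\<^sub>i\<close> are generated in order at most \<open>C\<close>, that count is a polynomial in \<open>s\<close> as soon as
  \<open>s \<ge> m C - m\<close>; so everything reduces to bounding the order of the generators.

  Suppose that at some level \<open>d \<ge> r\<close> the generators of order at most \<open>d\<close> have no minimal syzygy above
  order \<open>d\<close>. Then the derivatives of order at most \<open>d\<close> can be prolonged freely to a formal jet \<open>c\<close>
  with commuting derivations, and \<open>c\<close> specializes to \<open>b\<close>. The Taylor series of \<open>c\<close> solve the same
  equations in a differential field extension of \<open>K\<close>, so by differential closedness and saturation
  some \<open>w \<in> K\<^sup>n\<close> satisfies exactly the equations of \<open>c\<close> over \<open>k\<close>. Its locus lies between \<open>W\<close> and \<open>V\<close>,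
  hence equals \<open>W\<close>, and there are no generators above order \<open>d\<close>. If on the other hand there is a
  syzygy above order \<open>d\<close>, then by the theorems of Macaulay and Gotzmann the Hilbert function falls
  strictly below maximal growth, which can happen only until the level \<open>C\<close> given by the Ackermann
  recursion.
\<close>

section \<open>Combinatorics: Hilbert functions of monomial ideals and the length of submaximal
  growth\<close>

section \<open>Macaulay's growth function\<close>

text \<open>A bound on the generators must use that the component is maximal, since an arbitrary
  monomial ideal can have generators of any order. The link is that derivations commute: two leaders
  below the same jet both force its value, and only a minimal syzygy allows them to disagree. A
  syzygy needs two elements, so a coordinate is counted only from the degree in which its ideal has
  two monomials. The decline of the full count minus 2 is what C^1 measures; each further coordinate
  that enters costs one more application, hence the n-fold iteration.

  Algebraic dependence is expressed by derivations of the field: in characteristic zero, an element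
  is algebraic over a set if every derivation killing the set kills it. Exchange and stability of
  leaders become computations with linear combinations and commutators.

  The derivations built for c agree with \<delta> on k and commute on the jets, but this is not
  guaranteed elsewhere, so they do not give a differential extension of K. Partial derivatives of
  power series always commute, and Taylor expansion embeds K with \<delta>; this is why the solution
  is moved there.\<close>

fun mnum :: "nat \<Rightarrow> nat \<Rightarrow> nat" where
  "mnum 0 d = (if d = 0 then 1 else 0)"
| "mnum (Suc m) 0 = 1"
| "mnum (Suc m) (Suc d) = mnum m (Suc d) + mnum (Suc m) d"

lemma mnum_0 [simp]: "mnum m 0 = 1"
  by (cases m) auto

lemma mnum_1 [simp]: "mnum m (Suc 0) = m"
  by (induction m) auto

lemma mnum_pos: "mnum (Suc m) d > 0"
  by (induction d) auto

text \<open>Macaulay's bound on the Hilbert function in degree \<open>d + 1\<close>;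
  \<open>mnum m d\<close> counts the monomials of degree \<open>d\<close> in \<open>m\<close>
  variables. The recursion splits \<open>H\<close> monomials by divisibility by one variable: the
  divisible part is taken as the least \<open>v\<close> whose own growth reaches \<open>H\<close>,
  so that the next degree has \<open>H\<close> multiples of the variable, while the rest grows in
  one variable fewer. \<open>H\<close> may exceed \<open>mnum m d\<close>, because Hilbert functions
  of several coordinates will be added.\<close>

fun grow :: "nat \<Rightarrow> nat \<Rightarrow> nat \<Rightarrow> nat" where
  "grow 0 d H = 0"
| "grow (Suc m) 0 H = Suc m * H"
| "grow (Suc m) (Suc d) H = H + grow m (Suc d) (H - (LEAST v. H \<le> grow (Suc m) d v))"

definition gmult :: "nat \<Rightarrow> nat \<Rightarrow> nat \<Rightarrow> nat" where
  "gmult m d H = (LEAST v. H \<le> grow m d v)"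

lemma grow_Suc: "grow (Suc m) (Suc d) H = H + grow m (Suc d) (H - gmult (Suc m) d H)"
  by (simp add: gmult_def)

declare grow.simps(3) [simp del]

lemma grow_ge: "H \<le> grow (Suc m) d H"
  by (cases d) (auto simp: grow_Suc)

lemma grow_1 [simp]: "grow (Suc 0) d H = H"
  by (cases d) (auto simp: grow_Suc)

lemma gmult_prop: "H \<le> grow (Suc m) d (gmult (Suc m) d H)"
  unfolding gmult_def by (rule LeastI[of _ H]) (rule grow_ge)

lemma gmult_le: "H \<le> grow m d v \<Longrightarrow> gmult m d H \<le> v"
  unfolding gmult_def by (rule Least_le)

lemma gmult_le_self: "gmult (Suc m) d H \<le> H"
  by (rule gmult_le) (rule grow_ge)


text \<open>The induction on \<open>d\<close> makes \<open>gmult\<close> subadditive, so what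
  remains after subtracting it is superadditive and the induction on \<open>m\<close> applies. This
  is what allows several coordinates to be bounded by one sum; monotonicity and strictness of
  \<open>grow\<close> rest on it as well.\<close>

lemma grow_superadd: "grow m d x + grow m d y \<le> grow m d (x + y)"
proof (induction m arbitrary: d x y)
  case (Suc m)
  note IHm = this
  show ?case
  proof (induction d arbitrary: x y)
    case (Suc d)
    let ?\<mu> = "gmult (Suc m) d"
    have sub: "?\<mu> (x + y) \<le> ?\<mu> x + ?\<mu> y"
      using gmult_prop[of x m d] gmult_prop[of y m d] Suc[of "?\<mu> x" "?\<mu> y"]
      by (intro gmult_le) linarith
    have "(x - ?\<mu> x) + (y - ?\<mu> y) \<le> x + y - ?\<mu> (x + y)"
      using sub gmult_le_self[of m d x] gmult_le_self[of m d y] by linarith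
    then obtain z where z: "x + y - ?\<mu> (x + y) = (x - ?\<mu> x) + (y - ?\<mu> y) + z"
      using le_Suc_ex by blast
    have "grow m (Suc d) (x - ?\<mu> x) + grow m (Suc d) (y - ?\<mu> y)
        \<le> grow m (Suc d) (x + y - ?\<mu> (x + y))"
      unfolding z
      using IHm[of "Suc d" "x - ?\<mu> x" "y - ?\<mu> y"] IHm[of "Suc d" "(x - ?\<mu> x) + (y - ?\<mu> y)" z]
      by linarith
    then show ?case by (simp add: grow_Suc)
  qed (simp add: algebra_simps)
qed simp

lemma grow_mono: "x \<le> y \<Longrightarrow> grow m d x \<le> grow m d y"
  using grow_superadd[of m d x "y - x"] by simp

lemma grow_strict: "x < y \<Longrightarrow> grow (Suc m) d x < grow (Suc m) d y"
  using grow_superadd[of "Suc m" d x "y - x"] grow_ge[of "y - x" m d] by simp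

lemma grow_zero [simp]: "grow m d 0 = 0"
  using grow_superadd[of m d 0 0] by simp

lemma grow_le_iff: "grow (Suc m) d x \<le> grow (Suc m) d y \<longleftrightarrow> x \<le> y"
  using grow_strict grow_mono by (meson linorder_not_le)

lemma gmult_eqI:
  assumes "H \<le> grow (Suc m) d v" and "\<And>w. H \<le> grow (Suc m) d w \<Longrightarrow> v \<le> w"
  shows "gmult (Suc m) d H = v"
  unfolding gmult_def by (rule Least_equality) (use assms in auto)

lemma gmult_grow [simp]: "gmult (Suc m) d (grow (Suc m) d v) = v"
  by (rule gmult_eqI) (auto simp: grow_le_iff)

lemma gmult_0 [simp]: "gmult (Suc m) d 0 = 0"
  using gmult_le_self[of m d 0] by simp

lemma gmult_diff_mono:
  assumes "x \<le> y"
  shows "x - gmult (Suc m) d x \<le> y - gmult (Suc m) d y"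
proof -
  have "gmult (Suc m) d y \<le> gmult (Suc m) d x + (y - x)"
    using gmult_prop[of x m d] grow_superadd[of "Suc m" d "gmult (Suc m) d x" "y - x"]
      grow_ge[of "y - x" m d] assms
    by (intro gmult_le) linarith
  then show ?thesis using assms gmult_le_self[of m d y] by linarith
qed

text \<open>A full polynomial ring splits off as a direct summand, because \<open>gmult\<close>
  splits off the full count one degree lower.\<close>

lemma grow_mnum_add: "grow m d (mnum m d + x) = mnum m (Suc d) + grow m d x"
proof (induction m arbitrary: d x)
  case (Suc m)
  note IHm = this
  show ?case
  proof (induction d arbitrary: x)
    case (Suc d)
    have \<mu>: "gmult (Suc m) d (mnum (Suc m) (Suc d) + x) = mnum (Suc m) d + gmult (Suc m) d x"
    proof (rule gmult_eqI)
      show "mnum (Suc m) (Suc d) + x \<le> grow (Suc m) d (mnum (Suc m) d + gmult (Suc m) d x)"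
        unfolding Suc using gmult_prop[of x m d] by simp
      fix w assume w: "mnum (Suc m) (Suc d) + x \<le> grow (Suc m) d w"
      have "grow (Suc m) d (mnum (Suc m) d) \<le> grow (Suc m) d w"
        using w Suc[of 0] by simp
      then have "mnum (Suc m) d \<le> w" by (simp add: grow_le_iff)
      then obtain w' where w': "w = mnum (Suc m) d + w'" using le_Suc_ex by blast
      have "x \<le> grow (Suc m) d w'" using w unfolding w' Suc by simp
      then show "mnum (Suc m) d + gmult (Suc m) d x \<le> w"
        unfolding w' using gmult_le by simp
    qed
    have "mnum (Suc m) (Suc d) + x - (mnum (Suc m) d + gmult (Suc m) d x)
       = mnum m (Suc d) + (x - gmult (Suc m) d x)"
      using gmult_le_self[of m d x] by simp
    then show ?case by (simp only: grow_Suc \<mu> IHm) simp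
  qed (simp add: algebra_simps)
qed simp

lemma grow_mnum [simp]: "grow m d (mnum m d) = mnum m (Suc d)"
  using grow_mnum_add[of m d 0] by simp

lemma gmult_mnum [simp]: "gmult (Suc m) d (mnum (Suc m) (Suc d)) = mnum (Suc m) d"
  using gmult_grow[of m d "mnum (Suc m) d"] by simp

text \<open>Macaulay's function in its classical form depends on degree and value alone; the number
  of variables only limits the values that occur. Degree 0 is left out since \<open>grow\<close> is
  linear there, with the number of variables as factor.\<close>

lemma grow_Suc_vars:
  "x \<le> mnum m (Suc d) \<Longrightarrow> grow (Suc m) (Suc d) x = grow m (Suc d) x"
proof (induction m arbitrary: d x)
  case (Suc m)
  note IHm = this
  show ?case using Suc.prems
  proof (induction d arbitrary: x)
    case 0
    have eq: "gmult (Suc (Suc m)) 0 x = gmult (Suc m) 0 x"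
    proof (cases "x = 0")
      case False
      have "gmult (Suc (Suc m)) 0 x = 1"
        by (rule gmult_eqI) (use 0 False in \<open>auto simp: Suc_le_eq intro!: Nat.gr0I\<close>)
      moreover have "gmult (Suc m) 0 x = 1"
        by (rule gmult_eqI) (use 0 False in \<open>auto simp: Suc_le_eq intro!: Nat.gr0I\<close>)
      ultimately show ?thesis by simp
    qed simp
    have "x - gmult (Suc m) 0 x \<le> mnum m (Suc 0)"
      using gmult_diff_mono[OF 0, of m 0] unfolding gmult_mnum by simp
    from IHm(1)[OF this] show ?case by (subst (1 2) grow_Suc) (simp only: eq)
  next
    case (Suc d)
    have eq: "gmult (Suc (Suc m)) (Suc d) x = gmult (Suc m) (Suc d) x"
    proof (rule gmult_eqI)
      have le: "gmult (Suc m) (Suc d) x \<le> mnum (Suc m) (Suc d)"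
        by (rule gmult_le) (use Suc.prems in \<open>simp only: grow_mnum\<close>)
      show "x \<le> grow (Suc (Suc m)) (Suc d) (gmult (Suc m) (Suc d) x)"
        unfolding Suc.IH[OF le] by (rule gmult_prop)
      fix w assume w: "x \<le> grow (Suc (Suc m)) (Suc d) w"
      show "gmult (Suc m) (Suc d) x \<le> w"
      proof (cases "w \<le> mnum (Suc m) (Suc d)")
        case True then show ?thesis using w unfolding Suc.IH[OF True] by (rule_tac gmult_le)
      qed (use le in simp)
    qed
    have "x - gmult (Suc m) (Suc d) x \<le> mnum m (Suc (Suc d))"
      using gmult_diff_mono[OF Suc.prems, of m "Suc d"] unfolding gmult_mnum by simp
    from IHm(1)[OF this] show ?case by (subst (1 2) grow_Suc) (simp only: eq)
  qed
qed simp

text \<open>Peels off the leading binomial coefficient of the Macaulay representation: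
  \<open>mnum m (Suc d)\<close> stands for the monomials free of the last variable, and the
  remainder \<open>y\<close> for multiples of it, measured one degree lower.\<close>

lemma grow_shift:
  "y \<le> mnum (Suc m) d \<Longrightarrow>
   grow (Suc m) (Suc d) (mnum m (Suc d) + y) = mnum m (Suc (Suc d)) + grow (Suc m) d y"
proof (induction m arbitrary: d y)
  case (Suc m)
  note IHm = this
  show ?case using Suc.prems
  proof (induction d arbitrary: y)
    case 0
    consider "y = 0" | "y = 1" using 0 by fastforce
    then show ?case
    proof cases
      case 1
      show ?thesis using grow_Suc_vars[of "mnum (Suc m) (Suc 0)" "Suc m" 0] 1
        by (simp only: grow_mnum add_0_right grow_zero le_refl)
    next
      case 2
      have "mnum (Suc m) (Suc 0) + y = mnum (Suc (Suc m)) (Suc 0)" using 2 by simp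
      then show ?thesis using 2 by (simp only: grow_mnum) simp
    qed
  next
    case (Suc d)
    note IHd = Suc.IH
    have \<mu>: "gmult (Suc (Suc m)) (Suc d) (mnum (Suc m) (Suc (Suc d)) + y)
        = mnum (Suc m) (Suc d) + gmult (Suc (Suc m)) d y"
    proof (rule gmult_eqI)
      have le: "gmult (Suc (Suc m)) d y \<le> mnum (Suc (Suc m)) d"
        by (rule gmult_le) (use Suc.prems in \<open>simp only: grow_mnum\<close>)
      show "mnum (Suc m) (Suc (Suc d)) + y
          \<le> grow (Suc (Suc m)) (Suc d) (mnum (Suc m) (Suc d) + gmult (Suc (Suc m)) d y)"
        unfolding IHd[OF le] using gmult_prop[of y "Suc m" d] by simp
      fix w assume w: "mnum (Suc m) (Suc (Suc d)) + y \<le> grow (Suc (Suc m)) (Suc d) w"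
      have "grow (Suc (Suc m)) (Suc d) (mnum (Suc m) (Suc d)) \<le> grow (Suc (Suc m)) (Suc d) w"
        using w IHd[of 0] by simp
      then have "mnum (Suc m) (Suc d) \<le> w" by (simp only: grow_le_iff)
      then obtain w' where w': "w = mnum (Suc m) (Suc d) + w'" using le_Suc_ex by blast
      have "gmult (Suc (Suc m)) d y \<le> w'"
      proof (cases "w' \<le> mnum (Suc (Suc m)) d")
        case True
        show ?thesis using w unfolding w' IHd[OF True] by (intro gmult_le) simp
      qed (use le in simp)
      then show "mnum (Suc m) (Suc d) + gmult (Suc (Suc m)) d y \<le> w" unfolding w' by simp
    qed
    define z where "z = y - gmult (Suc (Suc m)) d y"
    have z: "z \<le> mnum (Suc m) (Suc d)"
      using gmult_diff_mono[OF Suc.prems, of "Suc m" d] unfolding gmult_mnum z_def by simp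
    have e: "mnum (Suc m) (Suc (Suc d)) + y - (mnum (Suc m) (Suc d) + gmult (Suc (Suc m)) d y)
        = mnum m (Suc (Suc d)) + z"
      using gmult_le_self[of "Suc m" d y] unfolding z_def by simp
    have "grow (Suc (Suc m)) (Suc (Suc d)) (mnum (Suc m) (Suc (Suc d)) + y)
        = mnum (Suc m) (Suc (Suc d)) + y + (mnum m (Suc (Suc (Suc d))) + grow (Suc m) (Suc d) z)"
      by (simp only: grow_Suc[of "Suc m"] \<mu> e IHm(1)[OF z])
    also have "\<dots> = mnum (Suc m) (Suc (Suc (Suc d))) + grow (Suc (Suc m)) (Suc d) y"
      by (simp only: grow_Suc[of "Suc m"] z_def[symmetric]) simp
    finally show ?case .
  qed
qed simp

text \<open>The numerical core of Macaulay's theorem: among all ways to split \<open>h + v\<close>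
  monomials into \<open>v\<close> multiples of a variable and \<open>h\<close> others, the one built
  into \<open>grow\<close> allows the largest growth. The minimum records that multiples of the
  variable in the next degree come from the \<open>h + v\<close> given monomials.\<close>

lemma grow_slices:
  assumes "h \<le> mnum m (Suc d)" and "v \<le> mnum (Suc m) d"
  shows "grow m (Suc d) h + min (grow (Suc m) d v) (h + v) \<le> grow (Suc m) (Suc d) (h + v)"
  using assms
proof (induction m arbitrary: d h v)
  case 0
  then show ?case by simp
next
  case (Suc m)
  note IHm = Suc.IH
  have triv: "grow (Suc m) (Suc d) h + min (grow (Suc (Suc m)) d v) (h + v)
      \<le> grow (Suc (Suc m)) (Suc d) (h + v)" if "h + v \<le> grow (Suc (Suc m)) d v" for h v d
  proof -
    have "h \<le> h + v - gmult (Suc (Suc m)) d (h + v)"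
      using gmult_le[OF that] by simp
    then have "grow (Suc m) (Suc d) h \<le> grow (Suc m) (Suc d) (h + v - gmult (Suc (Suc m)) d (h + v))"
      by (rule grow_mono)
    then show ?thesis using that by (simp only: grow_Suc[of "Suc m"])
  qed
  have v0: "grow (Suc m) (Suc d) h + min (grow (Suc (Suc m)) d v) (h + v)
      \<le> grow (Suc (Suc m)) (Suc d) (h + v)" if "v = 0" and "h \<le> mnum (Suc m) (Suc d)" for h v d
    using that grow_Suc_vars[OF that(2)] by simp
  show ?case using Suc.prems
  proof (induction d arbitrary: h v)
    case 0
    then consider "v = 0" | "v = 1" by fastforce
    then show ?case
    proof cases
      case 2
      then show ?thesis using 0 by (intro triv) simp
    qed (use v0 0 in blast)
  next
    case (Suc d)
    note IHd = Suc.IH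
    note h = Suc.prems(1) and v = Suc.prems(2)
    let ?f = "mnum (Suc m) (Suc (Suc d))" and ?f1 = "mnum (Suc m) (Suc d)" and ?f2 = "mnum m (Suc (Suc d))"
    have f: "?f = ?f2 + ?f1" by simp
    \<comment> \<open>In (a) both leading parts are peeled off and \<open>d\<close> drops. In (b)
      the growth of \<open>v\<close> already exceeds \<open>h + v\<close>, so \<open>triv\<close>
      applies. In (c) everything fits into one variable fewer and \<open>m\<close> drops. In (d)
      only \<open>h\<close> contains its leading part, and superadditivity is enough.\<close>
    consider (a) "?f1 \<le> v" "?f2 \<le> h" | (b) "?f1 \<le> v" "h < ?f2" | (c) "v < ?f1" "h \<le> ?f2"
      | (d) "v < ?f1" "?f2 < h" by linarith
    then show ?case
    proof cases
      case a
      then obtain h' v' where h': "h = ?f2 + h'" and v': "v = ?f1 + v'" using le_Suc_ex by blast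
      have l1: "h' \<le> ?f1" and l2: "v' \<le> mnum (Suc (Suc m)) d" using h v h' v' by simp_all
      have e1: "grow (Suc m) (Suc (Suc d)) h = mnum m (Suc (Suc (Suc d))) + grow (Suc m) (Suc d) h'"
        unfolding h' by (rule grow_shift) (rule l1)
      have e2: "grow (Suc (Suc m)) (Suc d) v = ?f + grow (Suc (Suc m)) d v'"
        unfolding v' by (rule grow_shift) (rule l2)
      have hv: "h + v = ?f + (h' + v')" using h' v' by simp
      moreover have "h' + v' \<le> mnum (Suc (Suc m)) (Suc d)" using l1 l2 by simp
      ultimately have e3: "grow (Suc (Suc m)) (Suc (Suc d)) (h + v)
          = mnum (Suc m) (Suc (Suc (Suc d))) + grow (Suc (Suc m)) (Suc d) (h' + v')"
        using grow_shift[of "h' + v'" "Suc m" "Suc d"] by simp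
      show ?thesis
        using IHd[OF l1 l2] e1 e2 e3 hv mnum.simps(3)[of m "Suc (Suc d)"] by linarith
    next
      case b
      then obtain v' where v': "v = ?f1 + v'" using le_Suc_ex by blast
      have l2: "v' \<le> mnum (Suc (Suc m)) d" using v v' by simp
      have e2: "grow (Suc (Suc m)) (Suc d) v = ?f + grow (Suc (Suc m)) d v'"
        unfolding v' by (rule grow_shift) (rule l2)
      show ?thesis
        by (rule triv) (use b v' e2 grow_ge[of v' "Suc m" d] in simp)
    next
      case c
      have "v \<le> ?f1" using c by simp
      then show ?thesis
        using IHm[of h "Suc d" v] c grow_Suc_vars[of h m "Suc d"] grow_Suc_vars[of v "Suc m" d]
          grow_Suc_vars[of "h + v" "Suc m" "Suc d"] f by (simp del: mnum.simps)
    next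
      case d
      then obtain h' where h': "h = ?f2 + h'" using le_Suc_ex nat_less_le by blast
      have l1: "h' \<le> ?f1" using h h' by simp
      have e1: "grow (Suc m) (Suc (Suc d)) h = mnum m (Suc (Suc (Suc d))) + grow (Suc m) (Suc d) h'"
        unfolding h' by (rule grow_shift) (rule l1)
      have e2: "grow (Suc (Suc m)) (Suc d) v = grow (Suc m) (Suc d) v"
        using grow_Suc_vars[of v "Suc m" d] d by simp
      have sa: "grow (Suc m) (Suc d) h' + grow (Suc m) (Suc d) v \<le> grow (Suc m) (Suc d) (h' + v)"
        by (rule grow_superadd)
      show ?thesis
      proof (cases "h + v \<le> ?f")
        case True
        have "h' + v \<le> ?f1" using True h' by simp
        then have "grow (Suc m) (Suc (Suc d)) (h + v)
            = mnum m (Suc (Suc (Suc d))) + grow (Suc m) (Suc d) (h' + v)"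
          unfolding h' using grow_shift[of "h' + v" m "Suc d"] by (simp del: mnum.simps add: add.assoc)
        then show ?thesis using grow_Suc_vars[OF True] sa e1 e2 by linarith
      next
        case False
        then obtain x where x: "h' + v = ?f1 + x" using h' f
          by (metis add.assoc add_le_cancel_left le_Suc_ex linorder_linear)
        have hx: "h + v = ?f + x" using h' x f by simp
        have xf: "x \<le> ?f1" using x l1 d by linarith
        have "grow (Suc (Suc m)) (Suc (Suc d)) (h + v)
            = mnum (Suc m) (Suc (Suc (Suc d))) + grow (Suc (Suc m)) (Suc d) x"
          unfolding hx by (rule grow_shift) (use xf in simp)
        also have "\<dots> = mnum (Suc m) (Suc (Suc (Suc d))) + grow (Suc m) (Suc d) x"
          using grow_Suc_vars[OF xf] by simp
        also have "\<dots> = mnum m (Suc (Suc (Suc d))) + grow (Suc m) (Suc d) (h' + v)"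
          unfolding x grow_mnum_add by simp
        finally show ?thesis using sa e1 e2 by linarith
      qed
    qed
  qed
qed

section \<open>The theorems of Macaulay and Gotzmann for monomial ideals\<close>

definition inc :: "('m \<Rightarrow> nat) \<Rightarrow> 'm \<Rightarrow> 'm \<Rightarrow> nat" where
  "inc u j = u(j := Suc (u j))"

definition dec :: "('m \<Rightarrow> nat) \<Rightarrow> 'm \<Rightarrow> 'm \<Rightarrow> nat" where
  "dec u j = u(j := u j - 1)"

definition mons :: "'m set \<Rightarrow> nat \<Rightarrow> ('m::finite \<Rightarrow> nat) set" where
  "mons J d = {u. (\<forall>j. j \<notin> J \<longrightarrow> u j = 0) \<and> mord u = d}"

text \<open>The largest complement in degree \<open>d + 1\<close> available to a monomial ideal in
  the variables \<open>J\<close> whose complement in degree \<open>d\<close> is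
  \<open>U\<close>.\<close>

definition ups :: "'m set \<Rightarrow> nat \<Rightarrow> ('m::finite \<Rightarrow> nat) set \<Rightarrow> ('m \<Rightarrow> nat) set" where
  "ups J d U = {v \<in> mons J (Suc d). \<forall>j. v j > 0 \<longrightarrow> dec v j \<in> U}"

definition above :: "('m \<Rightarrow> nat) set \<Rightarrow> ('m \<Rightarrow> nat) set" where
  "above E = {u. \<exists>e\<in>E. e \<le> u}"

text \<open>The edges of the upper Koszul complex of \<open>I\<close> in multidegree
  \<open>u\<close>. Its vertices are the variables by which \<open>u\<close> can be divided within
  \<open>I\<close>; for an ideal the ends of an edge are vertices automatically. The components of
  this graph, less one, count the minimal first syzygies of multidegree \<open>u\<close>.\<close>

definition lnbr :: "('m \<Rightarrow> nat) set \<Rightarrow> ('m \<Rightarrow> nat) \<Rightarrow> ('m \<times> 'm) set" where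
  "lnbr I u = {(j, l). j \<noteq> l \<and> u j > 0 \<and> u l > 0 \<and> dec (dec u j) l \<in> I}"

text \<open>For a monomial ideal \<open>I\<close>, \<open>lconn I u\<close> says that \<open>I\<close> has no minimal syzygy in multidegree \<open>u\<close>.\<close>

definition lconn :: "('m \<Rightarrow> nat) set \<Rightarrow> ('m \<Rightarrow> nat) \<Rightarrow> bool" where
  "lconn I u \<longleftrightarrow>
     (\<forall>j l. u j > 0 \<longrightarrow> dec u j \<in> I \<longrightarrow> u l > 0 \<longrightarrow> dec u l \<in> I \<longrightarrow> (j, l) \<in> (lnbr I u)\<^sup>*)"

lemma mord_inc [simp]: "mord (inc u j) = Suc (mord u)"
  unfolding mord_def inc_def
  by (subst (1 2) sum.remove[of UNIV j]) (auto intro!: sum.cong)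

lemma inc_dec [simp]: "u j > 0 \<Longrightarrow> inc (dec u j) j = u"
  by (auto simp: inc_def dec_def)

lemma dec_inc [simp]: "dec (inc u j) j = u"
  by (auto simp: inc_def dec_def)

lemma dec_inc_other: "i \<noteq> j \<Longrightarrow> dec (inc u j) i = inc (dec u i) j"
  by (auto simp: inc_def dec_def)

lemma dec_commute: "dec (dec u i) j = dec (dec u j) i"
  by (auto simp: dec_def)

lemma mord_dec: "u j > 0 \<Longrightarrow> Suc (mord (dec u j)) = mord u"
  by (metis inc_dec mord_inc)

lemma inc_apply: "inc u j i = (if i = j then Suc (u j) else u i)"
  by (simp add: inc_def)

lemma dec_apply: "dec u j i = (if i = j then u j - 1 else u i)"
  by (simp add: dec_def)

lemma dec_le: "dec u j \<le> u"
  by (auto simp: dec_def le_fun_def)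

lemma le_inc: "u \<le> inc u j"
  by (auto simp: inc_def le_fun_def)

lemma le_dec: "e \<le> u \<Longrightarrow> e j < u j \<Longrightarrow> e \<le> dec u j"
  by (auto simp: dec_def le_fun_def)

lemma inc_inj: "inc u j = inc v j \<Longrightarrow> u = v"
  by (metis dec_inc)

lemma mord_mono: "u \<le> v \<Longrightarrow> mord u \<le> mord v"
  unfolding mord_def by (intro sum_mono) (auto simp: le_fun_def)

lemma mord_less_ex:
  assumes "u \<le> v" "mord u < mord v"
  shows "\<exists>i. u i < v i"
proof (rule ccontr)
  assume "\<not> ?thesis"
  then have "v \<le> u" by (auto simp: le_fun_def not_less)
  then show False using mord_mono[of v u] assms by simp
qed

lemma mord_0_iff: "mord u = 0 \<longleftrightarrow> u = (\<lambda>_. 0)"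
  by (auto simp: mord_def)

lemma le_mord: "u j \<le> mord u"
  unfolding mord_def by (rule member_le_sum) auto

lemma mons_0: "mons J 0 = {\<lambda>_. 0}"
  by (auto simp: mons_def mord_0_iff)

lemma mons_empty [simp]: "mons {} (Suc d) = {}"
  by (auto simp: mons_def) (metis mord_0_iff ext nat.distinct(1))

lemma inc_mons: "x \<in> J \<Longrightarrow> inc u x \<in> mons J (Suc d) \<longleftrightarrow> u \<in> mons J d"
  by (auto simp: mons_def inc_apply split: if_splits)

lemma mons_slice:
  assumes "x \<notin> J"
  shows "mons (insert x J) (Suc d) = mons J (Suc d) \<union> (\<lambda>u. inc u x) ` mons (insert x J) d"
proof safe
  fix u assume u: "u \<in> mons (insert x J) (Suc d)"
    and "u \<notin> (\<lambda>u. inc u x) ` mons (insert x J) d"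
  then have "u x = 0"
    by (metis image_eqI inc_dec inc_mons insertI1 not_gr_zero)
  then show "u \<in> mons J (Suc d)" using u by (auto simp: mons_def) metis
qed (auto simp: mons_def inc_apply assms)

lemma mons_slice_disjoint:
  "x \<notin> J \<Longrightarrow> mons J d \<inter> (\<lambda>u. inc u x) ` A = {}"
  by (auto simp: mons_def inc_apply)

lemma finite_mons: "finite (mons J d)" and card_mons: "card (mons J d) = mnum (card J) d"
proof -
  have "finite J" by simp
  then have "finite (mons J d) \<and> card (mons J d) = mnum (card J) d"
  proof (induction J arbitrary: d rule: finite_induct)
    case empty
    show ?case by (cases d) (auto simp: mons_0)
  next
    case (insert x J)
    note IHJ = this
    show ?case
    proof (induction d)
      case (Suc d)
      have "card ((\<lambda>u. inc u x) ` mons (insert x J) d) = card (mons (insert x J) d)"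
        by (rule card_image) (auto intro: inj_onI inc_inj)
      then show ?case
        using Suc IHJ
        by (simp add: mons_slice mons_slice_disjoint card_Un_disjoint)
    qed (simp add: mons_0)
  qed
  then show "finite (mons J d)" "card (mons J d) = mnum (card J) d" by auto
qed

lemma lconn_cong2:
  assumes "\<And>v. mord u \<le> mord v + 2 \<Longrightarrow> v \<in> I \<longleftrightarrow> v \<in> I'"
  shows "lconn I u \<longleftrightarrow> lconn I' u"
proof -
  have 0: "mord v \<le> Suc (mord (dec v j))" for v j
    using mord_dec[of v j] by (cases "v j > 0") (auto simp: dec_def fun_upd_idem)
  have 1: "dec u j \<in> I \<longleftrightarrow> dec u j \<in> I'" for j
    by (rule assms) (use 0[of u j] in simp)
  have 2: "dec (dec u j) l \<in> I \<longleftrightarrow> dec (dec u j) l \<in> I'" for j l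
    by (rule assms) (use 0[of u j] 0[of "dec u j" l] in simp)
  show ?thesis unfolding lconn_def lnbr_def 1 2 ..
qed

lemma lconn_cong:
  assumes "\<And>v. v \<le> u \<Longrightarrow> v \<in> I \<longleftrightarrow> v \<in> I'"
  shows "lconn I u \<longleftrightarrow> lconn I' u"
proof -
  have 1: "dec u j \<in> I \<longleftrightarrow> dec u j \<in> I'" for j by (rule assms) (rule dec_le)
  have 2: "dec (dec u j) l \<in> I \<longleftrightarrow> dec (dec u j) l \<in> I'" for j l
    by (rule assms) (meson dec_le order_trans)
  show ?thesis unfolding lconn_def lnbr_def 1 2 ..
qed

lemma lnbr_sym: "(j, l) \<in> lnbr I u \<Longrightarrow> (l, j) \<in> lnbr I u"
  by (auto simp: lnbr_def dec_commute)

lemma lnbr_rtrancl_sym: "(j, l) \<in> (lnbr I u)\<^sup>* \<Longrightarrow> (l, j) \<in> (lnbr I u)\<^sup>*"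
proof -
  have "sym (lnbr I u)" by (auto intro: symI lnbr_sym)
  then show "(j, l) \<in> (lnbr I u)\<^sup>* \<Longrightarrow> (l, j) \<in> (lnbr I u)\<^sup>*"
    by (meson sym_rtrancl symD)
qed

lemma lconn_via:
  assumes "\<And>j. u j > 0 \<Longrightarrow> dec u j \<in> I \<Longrightarrow> (j, x) \<in> (lnbr I u)\<^sup>*"
  shows "lconn I u"
  unfolding lconn_def by (meson assms lnbr_rtrancl_sym rtrancl_trans)

text \<open>Here a factor \<open>x\<close> of a generator may be exchanged for any other variable
  (\<open>shift\<close>). Hence every vertex is adjacent to \<open>x\<close> or equal to it: if a
  generator dividing \<open>dec u j\<close> uses up all factors \<open>x\<close> of
  \<open>u\<close>, one of them is exchanged for a variable with room left, which exists because the
  order of \<open>u\<close> is at least 2 above that of the generators.\<close>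

lemma lconn_stable:
  fixes U :: "('m::finite \<Rightarrow> nat) set"
  assumes V: "V = {u \<in> mons (insert x J) d. inc u x \<in> U}"
    and UV: "U \<subseteq> ups (insert x J) d V"
    and supp: "\<forall>j. j \<notin> insert x J \<longrightarrow> u j = 0" and ord: "mord u \<ge> Suc d + 2" and pos: "u x > 0"
  shows "lconn (above (mons (insert x J) (Suc d) - U)) u" (is "lconn (above ?E) u")
proof (rule lconn_via)
  have shift: "inc (dec e x) i \<in> ?E" if e: "e \<in> ?E" "e x > 0" and i: "i \<in> insert x J" for e i
  proof -
    have m: "dec e x \<in> mons (insert x J) d"
      using e inc_mons[of x "insert x J" "dec e x" d] by simp
    have "inc (dec e x) i \<notin> U"
    proof
      assume "inc (dec e x) i \<in> U"
      then have "inc (dec e x) i \<in> ups (insert x J) d V" using UV by blast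
      moreover have "inc (dec e x) i i > 0" by (simp add: inc_apply)
      ultimately have "dec (inc (dec e x) i) i \<in> V" unfolding ups_def by blast
      then show False using e by (simp add: V)
    qed
    then show ?thesis using m inc_mons[OF i] by auto
  qed
  fix j assume j: "u j > 0" and jI: "dec u j \<in> above ?E"
  show "(j, x) \<in> (lnbr (above ?E) u)\<^sup>*"
  proof (cases "j = x")
    case False
    obtain e where e: "e \<in> ?E" "e \<le> dec u j" using jI by (auto simp: above_def)
    have ex: "e x \<le> u x" using e(2) False by (auto simp: le_fun_def dec_apply) metis
    have "dec (dec u j) x \<in> above ?E"
    proof (cases "e x < u x")
      case True
      then have "e \<le> dec (dec u j) x" using e(2) False by (rule_tac le_dec) (auto simp: dec_apply)
      then show ?thesis using e(1) by (auto simp: above_def)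
    next
      case eq: False
      have "mord e < mord (dec u j)"
        using e(1) ord mord_dec[of u j] j by (auto simp: mons_def)
      then obtain i where i: "e i < dec u j i" using mord_less_ex e(2) by blast
      then have ix: "i \<noteq> x" using eq False ex by (auto simp: dec_apply split: if_splits)
      have "u i > 0" using i by (auto simp: dec_apply split: if_splits)
      then have "i \<in> insert x J" using supp by (metis less_irrefl)
      then have "inc (dec e x) i \<in> ?E" using shift e(1) eq ex pos by auto
      moreover have "inc (dec e x) i \<le> dec (dec u j) x"
      proof (rule le_funI)
        fix y
        define p where "p = dec u j"
        have "e y \<le> p y" "e i < p i" using e(2) i by (auto simp: p_def le_fun_def)
        then show "inc (dec e x) i y \<le> dec (dec u j) x y"
          unfolding p_def[symmetric] using ix
          by (cases "y = i"; cases "y = x") (simp_all add: inc_apply dec_apply)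
      qed
      ultimately show ?thesis by (auto simp: above_def)
    qed
    then have "(j, x) \<in> lnbr (above ?E) u" using False j pos by (auto simp: lnbr_def)
    then show ?thesis by auto
  qed simp
qed

text \<open>Here the ideal quotient of \<open>I\<close> by \<open>x\<close> is generated by
  \<open>?F\<close> in degree \<open>d\<close> (\<open>iff\<close>). The multidegree
  \<open>u\<close> is compared with \<open>v\<close>, which has one factor \<open>x\<close> less:
  edges at \<open>v\<close> are edges at \<open>u\<close>, and every vertex at \<open>u\<close>
  reaches a vertex at \<open>v\<close>, so connectedness is inherited.\<close>

lemma lconn_lift:
  fixes U :: "('m::finite \<Rightarrow> nat) set"
  assumes V: "V = {u \<in> mons (insert x J) d. inc u x \<in> U}"
    and VU: "ups (insert x J) d V \<subseteq> U"
    and IH: "\<And>u. \<forall>j. j \<notin> insert x J \<longrightarrow> u j = 0 \<Longrightarrow> mord u \<ge> d + 2 \<Longrightarrow>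
               lconn (above (mons (insert x J) d - V)) u"
    and supp: "\<forall>j. j \<notin> insert x J \<longrightarrow> u j = 0" and ord: "mord u \<ge> Suc d + 2" and pos: "u x > 0"
  shows "lconn (above (mons (insert x J) (Suc d) - U)) u" (is "lconn (above ?E) u")
proof -
  let ?I = "above ?E" and ?F = "mons (insert x J) d - V"
  let ?I' = "above ?F"
  define v where "v = dec u x"
  have iff: "w \<in> ?I \<longleftrightarrow> dec w x \<in> ?I'" if w: "w x > 0" for w
  proof
    assume "w \<in> ?I"
    then obtain e where e: "e \<in> ?E" "e \<le> w" by (auto simp: above_def)
    show "dec w x \<in> ?I'"
    proof (cases "e x > 0")
      case True
      then have "dec e x \<in> ?F"
        using e(1) inc_mons[of x "insert x J" "dec e x" d] by (auto simp: V)
      moreover have "dec e x \<le> dec w x" using e(2) by (auto simp: le_fun_def dec_apply diff_le_mono)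
      ultimately show ?thesis by (auto simp: above_def)
    next
      case False
      have "e \<notin> ups (insert x J) d V" using e(1) VU by auto
      then obtain j where j: "e j > 0" "dec e j \<notin> V" using e(1) by (auto simp: ups_def)
      have "j \<in> insert x J" using e(1) j(1) by (auto simp: mons_def)
      then have "dec e j \<in> ?F"
        using e(1) j inc_mons[of j "insert x J" "dec e j" d] by auto
      moreover have "dec e j \<le> dec w x"
        using e(2) False w dec_le[of e j] by (intro le_dec) (auto simp: dec_apply intro: order_trans)
      ultimately show ?thesis by (auto simp: above_def)
    qed
  next
    assume "dec w x \<in> ?I'"
    then obtain e where e: "e \<in> ?F" "e \<le> dec w x" by (auto simp: above_def)
    have "inc e x \<in> ?E" using e(1) inc_mons[of x "insert x J" e d] by (auto simp: V)
    moreover have "inc e x \<le> w" using e(2) w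
      by (auto simp: le_fun_def inc_apply dec_apply split: if_splits)
    ultimately show "w \<in> ?I" by (auto simp: above_def)
  qed
  have ordv: "mord v \<ge> d + 2" using ord mord_dec[of u x] pos unfolding v_def by simp
  have "lconn ?I' v" by (rule IH) (use supp ordv in \<open>auto simp: v_def dec_apply\<close>)
  have edges: "lnbr ?I' v \<subseteq> lnbr ?I u"
  proof clarify
    fix j l assume jl: "(j, l) \<in> lnbr ?I' v"
    have p: "dec (dec u j) l x > 0" using jl pos
      by (auto simp: lnbr_def v_def dec_apply split: if_splits)
    have "dec (dec (dec u j) l) x = dec (dec v j) l"
      unfolding v_def by (metis dec_commute)
    then have "dec (dec u j) l \<in> ?I" using jl iff[of "dec (dec u j) l"] p by (auto simp: lnbr_def)
    then show "(j, l) \<in> lnbr ?I u" using jl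
      by (auto simp: lnbr_def v_def dec_apply split: if_splits)
  qed
  have vert: "v j > 0 \<and> dec v j \<in> ?I'" if "u j > 0" "dec u j \<in> ?I" "j \<noteq> x" for j
    using that iff[of "dec u j"] pos unfolding v_def
    by (auto simp: dec_apply dec_commute[of u x j])
  have reach: "\<exists>i. (j, i) \<in> (lnbr ?I u)\<^sup>* \<and> v i > 0 \<and> dec v i \<in> ?I'"
    if j: "u j > 0" "dec u j \<in> ?I" for j
  proof (cases "j = x")
    case False
    then show ?thesis using vert[OF j] by blast
  next
    case [simp]: True
    show ?thesis
    proof (cases "v x > 0")
      case True
      then show ?thesis using iff[of v] j(2) v_def by auto
    next
      case False
      obtain e where e: "e \<in> ?E" "e \<le> v" using j(2) by (auto simp: above_def v_def)
      have "mord e < mord v" using e(1) ordv by (auto simp: mons_def)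
      then obtain i where i: "e i < v i" using mord_less_ex e(2) by blast
      have ix: "i \<noteq> x" using i False by auto
      have "e \<le> dec v i" using e(2) i by (intro le_dec)
      then have vi: "dec v i \<in> ?I" using e(1) by (auto simp: above_def)
      have ui: "u i > 0" using i ix by (auto simp: v_def dec_apply)
      have "(x, i) \<in> lnbr ?I u" using vi ix pos ui by (auto simp: lnbr_def v_def)
      moreover have "dec u i \<in> ?I"
        using vi dec_le[of "dec u i" x] unfolding v_def dec_commute[of u x]
        by (auto simp: above_def intro: order_trans)
      ultimately show ?thesis using vert[OF ui _ ix] by auto
    qed
  qed
  show ?thesis unfolding lconn_def
  proof (intro allI impI)
    fix j l assume j: "u j > 0" "dec u j \<in> ?I" and l: "u l > 0" "dec u l \<in> ?I"
    obtain j' where j': "(j, j') \<in> (lnbr ?I u)\<^sup>*" "v j' > 0" "dec v j' \<in> ?I'"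
      using reach[OF j] by blast
    obtain l' where l': "(l, l') \<in> (lnbr ?I u)\<^sup>*" "v l' > 0" "dec v l' \<in> ?I'"
      using reach[OF l] by blast
    have "(j', l') \<in> (lnbr ?I' v)\<^sup>*"
      using \<open>lconn ?I' v\<close> j' l' by (auto simp: lconn_def)
    then have "(j', l') \<in> (lnbr ?I u)\<^sup>*" using edges rtrancl_mono by blast
    then show "(j, l) \<in> (lnbr ?I u)\<^sup>*"
      using j'(1) lnbr_rtrancl_sym[OF l'(1)] by (meson rtrancl_trans)
  qed
qed

text \<open>Slicing along a variable \<open>x\<close>, \<open>U\<close> consists of
  \<open>U0\<close> without \<open>x\<close> and of \<open>x\<close> times \<open>V\<close>, and the
  next degree is bounded slice by slice; \<open>grow_slices\<close> adds up the two bounds. If the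
  total is attained, every estimate was sharp. In multidegrees without \<open>x\<close> only
  \<open>U0\<close> is visible; in the others the minimum decides between
  \<open>lconn_stable\<close> (value \<open>card U\<close>) and \<open>lconn_lift\<close> (growth of
  \<open>V\<close>).\<close>

lemma macaulay_gotzmann:
  fixes U :: "('m::finite \<Rightarrow> nat) set"
  assumes "U \<subseteq> mons J d"
  shows "card (ups J d U) \<le> grow (card J) d (card U)"
    and "card (ups J d U) = grow (card J) d (card U) \<Longrightarrow> \<forall>j. j \<notin> J \<longrightarrow> u j = 0 \<Longrightarrow>
           mord u \<ge> d + 2 \<Longrightarrow> lconn (above (mons J d - U)) u"
proof -
  have "finite J" by simp
  then have "U \<subseteq> mons J d \<Longrightarrow> card (ups J d U) \<le> grow (card J) d (card U) \<and>
     (card (ups J d U) = grow (card J) d (card U) \<longrightarrow>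
       (\<forall>u. (\<forall>j. j \<notin> J \<longrightarrow> u j = 0) \<longrightarrow> mord u \<ge> d + 2 \<longrightarrow> lconn (above (mons J d - U)) u))" for d U
  proof (induction J arbitrary: d U rule: finite_induct)
    case empty
    have "ups {} d U = {}" by (auto simp: ups_def)
    moreover have "mord u = 0" if "\<forall>j. u j = 0" for u :: "'m \<Rightarrow> nat"
      using that by (auto simp: mord_def)
    ultimately show ?case by auto
  next
    case (insert x J)
    note IHJ = insert.IH and x = insert.hyps(2) and finJ = insert.hyps(1)
    have cJ: "card (insert x J) = Suc (card J)" using x finJ by simp
    show ?case using insert.prems
    proof (induction d arbitrary: U)
      case 0
      then consider "U = {}" | "U = {\<lambda>_. 0}" by (auto simp: mons_0)
      then show ?case
      proof cases
        case 1
        have "v j = 0" if "v \<in> ups (insert x J) 0 U" for v j using that 1 by (auto simp: ups_def)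
        then have "mord v = 0" if "v \<in> ups (insert x J) 0 U" for v
          using that by (auto simp: mord_def)
        moreover have "mord v = Suc 0" if "v \<in> ups (insert x J) 0 U" for v
          using that by (simp add: ups_def mons_def)
        ultimately have "ups (insert x J) 0 U = {}" by fastforce
        moreover have "above (mons (insert x J) 0 - U) = UNIV"
          using 1 by (auto simp: mons_0 above_def le_fun_def)
        moreover have "lconn UNIV u" for u :: "'m \<Rightarrow> nat"
          by (auto simp: lconn_def lnbr_def)
        ultimately show ?thesis by simp
      next
        case 2
        have "card (ups (insert x J) 0 U) \<le> card (mons (insert x J) 1)"
          by (rule card_mono) (auto simp: ups_def finite_mons)
        also have "\<dots> = grow (card (insert x J)) 0 (card U)" using 2 cJ by (simp add: card_mons)
        finally show ?thesis using 2 by (auto simp: mons_0 above_def lconn_def)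
      qed
    next
      case (Suc d)
      define U0 where "U0 = U \<inter> mons J (Suc d)"
      define V where "V = {u \<in> mons (insert x J) d. inc u x \<in> U}"
      have finU: "finite U" using Suc.prems finite_mons finite_subset by blast
      have U_eq: "U = U0 \<union> (\<lambda>u. inc u x) ` V"
        using Suc.prems mons_slice[OF x, of d] by (auto simp: U0_def V_def)
      have Vm: "V \<subseteq> mons (insert x J) d" by (auto simp: V_def)
      have finV: "finite V" using Vm finite_mons finite_subset by blast
      have inj: "inj_on (\<lambda>u. inc u x) A" for A by (auto intro: inj_onI inc_inj)
      have dis: "U0 \<inter> (\<lambda>u. inc u x) ` V = {}"
        using mons_slice_disjoint[OF x] by (auto simp: U0_def)
      have finU0: "finite U0" using finU by (auto simp: U0_def)
      have "card (U0 \<union> (\<lambda>u. inc u x) ` V) = card U0 + card V"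
        using finV finU0 dis by (simp add: card_Un_disjoint card_image[OF inj])
      then have cU: "card U = card U0 + card V" using U_eq by metis
      let ?P = "ups (insert x J) (Suc d) U"
      define A where "A = ?P \<inter> mons J (Suc (Suc d))"
      define B where "B = {w \<in> mons (insert x J) (Suc d). inc w x \<in> ?P}"
      have P_eq: "?P = A \<union> (\<lambda>u. inc u x) ` B"
        using mons_slice[OF x, of "Suc d"] by (auto simp: A_def B_def ups_def)
      have finB: "finite B" unfolding B_def by (rule finite_subset[OF _ finite_mons]) auto
      have finA: "finite A" unfolding A_def by (rule finite_subset[OF _ finite_mons]) auto
      have "A \<inter> (\<lambda>u. inc u x) ` B = {}"
        using mons_slice_disjoint[OF x, of "Suc (Suc d)" B] by (auto simp: A_def)
      then have cP: "card ?P = card A + card B"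
        unfolding P_eq using finA finB by (simp add: card_Un_disjoint card_image[OF inj])
      have decm: "dec v j \<in> mons J (Suc d)" if "v \<in> mons J (Suc (Suc d))" "v j > 0" for v j
      proof -
        have "j \<in> J" using that by (auto simp: mons_def)
        then show ?thesis using that inc_mons[of j J "dec v j" "Suc d"] by simp
      qed
      have AU: "A \<subseteq> ups J (Suc d) U0"
        using decm by (auto simp: A_def ups_def U0_def)
      have BV: "B \<subseteq> ups (insert x J) d V \<inter> U"
      proof
        fix w assume w: "w \<in> B"
        then have wm: "w \<in> mons (insert x J) (Suc d)" and wP: "\<And>j. inc w x j > 0 \<Longrightarrow> dec (inc w x) j \<in> U"
          by (auto simp: B_def ups_def)
        have wU: "w \<in> U" using wP[of x] by (simp add: inc_apply)
        have "dec w j \<in> V" if j: "w j > 0" for j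
        proof -
          have "j \<in> insert x J" using wm j by (auto simp: mons_def)
          then have m: "dec w j \<in> mons (insert x J) d" using wm j inc_mons[of j "insert x J" "dec w j" d] by simp
          have "inc (dec w j) x \<in> U"
          proof (cases "j = x")
            case True then show ?thesis using wU j by simp
          next
            case False
            then show ?thesis using wP[of j] j dec_inc_other[OF False, of w] by (simp add: inc_apply)
          qed
          then show ?thesis using m by (simp add: V_def)
        qed
        then show "w \<in> ups (insert x J) d V \<inter> U" using wm wU by (auto simp: ups_def)
      qed
      have finups: "finite (ups K e W)" for K e and W :: "('m \<Rightarrow> nat) set"
        unfolding ups_def by (rule finite_subset[OF _ finite_mons]) auto
      have IA: "card (ups J (Suc d) U0) \<le> grow (card J) (Suc d) (card U0)"
        using IHJ[of U0 "Suc d"] by (auto simp: U0_def)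
      have IB: "card (ups (insert x J) d V) \<le> grow (Suc (card J)) d (card V)"
        using Suc.IH[OF Vm] cJ by simp
      have cA: "card A \<le> card (ups J (Suc d) U0)" by (intro card_mono AU finups)
      have cB: "card B \<le> card (ups (insert x J) d V \<inter> U)" using finU by (intro card_mono BV) auto
      have c1: "card (ups (insert x J) d V \<inter> U) \<le> card (ups (insert x J) d V)"
        using finups by (intro card_mono) auto
      have c2: "card (ups (insert x J) d V \<inter> U) \<le> card U"
        using finU by (intro card_mono) auto
      have "card U0 \<le> mnum (card J) (Suc d)"
        using card_mono[OF finite_mons, of U0 J "Suc d"] by (auto simp: U0_def card_mons)
      moreover have "card V \<le> mnum (Suc (card J)) d"
        using card_mono[OF finite_mons Vm] cJ by (simp add: card_mons)
      ultimately have sl: "grow (card J) (Suc d) (card U0) + min (grow (Suc (card J)) d (card V)) (card U)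
           \<le> grow (Suc (card J)) (Suc d) (card U)"
        unfolding cU by (rule grow_slices)
      have main: "card ?P \<le> grow (card (insert x J)) (Suc d) (card U)"
        using sl cP cA cB c1 c2 IA IB cJ by simp
      moreover have "lconn (above (mons (insert x J) (Suc d) - U)) u"
        if eq: "card ?P = grow (card (insert x J)) (Suc d) (card U)"
          and supp: "\<forall>j. j \<notin> insert x J \<longrightarrow> u j = 0" and ord: "mord u \<ge> Suc d + 2" for u
      proof (cases "u x = 0")
        case True
        have e1: "card (ups J (Suc d) U0) = grow (card J) (Suc d) (card U0)"
          using eq[unfolded cJ] sl cP cA cB c1 c2 IA IB by linarith
        have "lconn (above (mons J (Suc d) - U0)) u"
        proof -
          have "\<forall>j. j \<notin> J \<longrightarrow> u j = 0" using supp True by (metis insertE)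
          moreover have "U0 \<subseteq> mons J (Suc d)" by (simp add: U0_def)
          ultimately show ?thesis using IHJ[of U0 "Suc d"] e1 ord by blast
        qed
        moreover have "v \<in> above (mons (insert x J) (Suc d) - U) \<longleftrightarrow> v \<in> above (mons J (Suc d) - U0)"
          if "v \<le> u" for v
        proof -
          have "e \<in> mons (insert x J) (Suc d) - U \<longleftrightarrow> e \<in> mons J (Suc d) - U0" if "e \<le> v" for e
          proof -
            have "e x = 0" using that \<open>v \<le> u\<close> True by (auto simp: le_fun_def) (metis le_zero_eq)
            then show ?thesis by (auto simp: mons_def U0_def) metis
          qed
          then show ?thesis by (auto simp: above_def)
        qed
        ultimately show ?thesis using lconn_cong by blast
      next
        case False
        have e2: "card (ups (insert x J) d V \<inter> U) = min (grow (Suc (card J)) d (card V)) (card U)"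
          using eq[unfolded cJ] sl cP cA cB c1 c2 IA IB by linarith
        show ?thesis
        proof (cases "card U \<le> grow (Suc (card J)) d (card V)")
          case True
          then have "ups (insert x J) d V \<inter> U = U" using e2 finU by (intro card_subset_eq) auto
          then show ?thesis using False supp ord by (intro lconn_stable[OF V_def]) auto
        next
          case le: False
          have e3: "card (ups (insert x J) d V) = grow (Suc (card J)) d (card V)"
            using e2 le c1 IB by simp
          then have "ups (insert x J) d V \<inter> U = ups (insert x J) d V"
            using e2 le finups by (intro card_subset_eq) auto
          then have sub: "ups (insert x J) d V \<subseteq> U" by blast
          have IHd: "\<And>u. \<forall>j. j \<notin> insert x J \<longrightarrow> u j = 0 \<Longrightarrow> mord u \<ge> d + 2 \<Longrightarrow>
               lconn (above (mons (insert x J) d - V)) u"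
            using Suc.IH[OF Vm] e3 cJ by simp
          show ?thesis by (rule lconn_lift[OF V_def sub IHd supp ord]) (use False in simp_all)
        qed
      qed
      ultimately show ?case by blast
    qed
  qed
  from this[OF assms] show "card (ups J d U) \<le> grow (card J) d (card U)"
    and "card (ups J d U) = grow (card J) d (card U) \<Longrightarrow> \<forall>j. j \<notin> J \<longrightarrow> u j = 0 \<Longrightarrow>
           mord u \<ge> d + 2 \<Longrightarrow> lconn (above (mons J d - U)) u"
    by blast+
qed

section \<open>Ackermann bounds\<close>

text \<open>The slowest possible decrease of a Hilbert function that stays strictly below maximal growth:
  starting from the value \<open>H\<close> in degree \<open>t\<close>, it reaches 0 in degree \<open>T\<close>.\<close>

inductive dies :: "nat \<Rightarrow> nat \<Rightarrow> nat \<Rightarrow> nat \<Rightarrow> bool" for m where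
  dies_0: "dies m t 0 t"
| dies_Suc: "H > 0 \<Longrightarrow> dies m (Suc t) (grow m t H - 1) T \<Longrightarrow> dies m t H T"

lemma dies_le: "dies m t H T \<Longrightarrow> t \<le> T"
  by (induction rule: dies.induct) auto

lemma dies_det: "dies m t H T \<Longrightarrow> dies m t H T' \<Longrightarrow> T = T'"
proof (induction arbitrary: T' rule: dies.induct)
  case (dies_0 t)
  then show ?case by (cases rule: dies.cases) auto
next
  case (dies_Suc H t T)
  from dies_Suc.prems have "dies m (Suc t) (grow m t H - 1) T'"
    by (cases rule: dies.cases) (use dies_Suc.hyps(1) in auto)
  then show ?case by (rule dies_Suc.IH)
qed

lemma dies_0_iff [simp]: "dies m t 0 T \<longleftrightarrow> T = t"
  using dies_0 dies_det by blast

lemma dies_mono: "dies m t H' T' \<Longrightarrow> H \<le> H' \<Longrightarrow> \<exists>T\<le>T'. dies m t H T"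
proof (induction arbitrary: H rule: dies.induct)
  case (dies_Suc H' t T')
  show ?case
  proof (cases "H = 0")
    case True
    then show ?thesis using dies_le[OF dies_Suc.hyps(2)] by auto
  next
    case False
    have "grow m t H - 1 \<le> grow m t H' - 1" using grow_mono[OF dies_Suc.prems, of m t] by simp
    then obtain T where "T \<le> T'" "dies m (Suc t) (grow m t H - 1) T" using dies_Suc.IH by blast
    then show ?thesis using False dies.dies_Suc by blast
  qed
qed auto

lemma dies_strict: "dies (Suc m) t H' T' \<Longrightarrow> H < H' \<Longrightarrow> \<exists>T<T'. dies (Suc m) t H T"
proof (induction arbitrary: H rule: dies.induct)
  case (dies_Suc H' t T')
  show ?case
  proof (cases "H = 0")
    case True
    then show ?thesis using dies_le[OF dies_Suc.hyps(2)] by (auto intro!: exI[of _ t])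
  next
    case False
    have "grow (Suc m) t H - 1 < grow (Suc m) t H' - 1"
      using grow_strict[OF dies_Suc.prems, of m t] grow_ge[of H m t] False by simp
    then obtain T where "T < T'" "dies (Suc m) (Suc t) (grow (Suc m) t H - 1) T"
      using dies_Suc.IH by blast
    then show ?thesis using False dies.dies_Suc by blast
  qed
qed auto

lemma grow_pos:
  assumes "x > 0" "x \<le> mnum e u" "u > 0"
  shows "grow e u x > 0"
proof (cases e)
  case (Suc e')
  then show ?thesis using grow_ge[of x e' u] assms by simp
qed (use assms in auto)

text \<open>The summand \<open>B\<close> reproduces itself, so the loss of 1 per step can be charged
  to \<open>x\<close> alone, which runs as it would in \<open>e\<close> variables and in a degree
  lower by \<open>j\<close>. When \<open>x\<close> is used up in degree \<open>T\<close>, the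
  decline of \<open>B\<close> begins in degree \<open>j + T\<close>.\<close>

lemma dies_base:
  assumes "dies e u x T" and "x \<le> mnum e u" and "u > 0"
    and "\<And>u x. u > 0 \<Longrightarrow> x \<le> mnum e u \<Longrightarrow> grow m (j + u) (B (j + u) + x) = B (Suc (j + u)) + grow e u x"
    and "dies m (j + T) (B (j + T)) T'"
  shows "dies m (j + u) (B (j + u) + x) T'"
  using assms
proof (induction rule: dies.induct)
  case (dies_Suc x u T)
  have g: "grow e u x \<le> mnum e (Suc u)"
    using grow_mono[OF dies_Suc.prems(1), of e u] by simp
  have "dies m (j + Suc u) (B (j + Suc u) + (grow e u x - 1)) T'"
    by (rule dies_Suc.IH) (use dies_Suc.prems g in auto)
  moreover have "grow m (j + u) (B (j + u) + x) - 1 = B (j + Suc u) + (grow e u x - 1)"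
    using dies_Suc.prems(3)[OF dies_Suc.prems(2,1)] grow_pos[OF dies_Suc.hyps(1) dies_Suc.prems(1,2)]
    by simp
  ultimately show ?case using dies_Suc.hyps(1) by - (rule dies.dies_Suc, auto)
qed simp

text \<open>For \<open>p \<le> t + 1\<close> this is the Hilbert function in degree \<open>t\<close>
  of the polynomial ring in \<open>e + 1\<close> variables modulo the \<open>p\<close>-th power of
  one of them: one ring in \<open>e\<close> variables, shifted by \<open>i\<close>, for each
  \<open>i < p\<close>.\<close>

definition cones :: "nat \<Rightarrow> nat \<Rightarrow> nat \<Rightarrow> nat" where
  "cones e p t = (\<Sum>i<p. mnum e (t - i))"

lemma cones_Suc: "cones e (Suc p) t = cones e p t + mnum e (t - p)"
  by (simp add: cones_def)

lemma cones_shift: "cones e (Suc p) (Suc t) = mnum e (Suc t) + cones e p t"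
  unfolding cones_def by (subst sum.lessThan_Suc_shift) simp

lemma cones_full: "cones e (Suc t) t = mnum (Suc e) t"
proof (induction t)
  case (Suc t)
  then show ?case by (subst cones_shift) simp
qed (simp add: cones_def)

lemma cones_mono: "p \<le> q \<Longrightarrow> cones e p t \<le> cones e q t"
  unfolding cones_def by (rule sum_mono2) auto

lemma grow_cones:
  "p < t \<Longrightarrow> x \<le> mnum e (t - p) \<Longrightarrow>
   grow (Suc e) t (cones e p t + x) = cones e p (Suc t) + grow e (t - p) x"
proof (induction p arbitrary: t)
  case 0
  then obtain t' where "t = Suc t'" by (cases t) auto
  then show ?case using 0 grow_Suc_vars[of x e t'] by (simp add: cones_def)
next
  case (Suc p)
  then obtain t' where t: "t = Suc t'" by (cases t) auto
  have "cones e p t' + x \<le> cones e (Suc p) t'" using Suc.prems t by (simp add: cones_Suc)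
  also have "\<dots> \<le> cones e (Suc t') t'" using Suc.prems t by (intro cones_mono) simp
  finally have le: "cones e p t' + x \<le> mnum (Suc e) t'" by (simp add: cones_full)
  have "grow (Suc e) t (cones e (Suc p) t + x) = mnum e (Suc (Suc t')) + grow (Suc e) t' (cones e p t' + x)"
    using grow_shift[OF le] by (simp add: t cones_shift add.assoc)
  also have "\<dots> = cones e (Suc p) (Suc t) + grow e (t - Suc p) x"
    using Suc.IH[of t'] Suc.prems t by (simp add: cones_shift)
  finally show ?case .
qed

lemma grow_cones_add:
  "u > 0 \<Longrightarrow> x \<le> mnum e u \<Longrightarrow>
   grow (Suc e) (p + u) (cones e p (p + u) + x) = cones e p (Suc (p + u)) + grow e u x"
  using grow_cones[of p "p + u" x e] by simp

lemma ack_gt: "y < ack x y"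
  by (induction x y rule: ack.induct) auto

lemma ack_Suc_mono: "ack x y < ack x (Suc y)"
  by (cases x) (auto simp: ack_gt)

lemma ack_mono: "y \<le> y' \<Longrightarrow> ack x y \<le> ack x y'"
  by (rule lift_Suc_mono_le[of "ack x"]) (use ack_Suc_mono less_imp_le in auto)

lemma ack_pow: "ack (Suc x) y = (ack x ^^ Suc y) 1"
  by (induction y) auto

lemma ack_pow_mono: "y \<le> y' \<Longrightarrow> (ack x ^^ n) y \<le> (ack x ^^ n) y'"
  by (induction n) (auto intro: ack_mono)

lemma ack_pow_Suc_gt: "(ack x ^^ n) y < (ack x ^^ Suc n) y"
  by (simp add: ack_gt)

lemma ack_pow_le: "n \<le> n' \<Longrightarrow> (ack x ^^ n) y \<le> (ack x ^^ n') y"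
  by (rule lift_Suc_mono_le[of "\<lambda>n. (ack x ^^ n) y"]) (use ack_pow_Suc_gt less_imp_le in blast)

text \<open>The last cone has its own degree \<open>Suc t - p\<close> and is the first to go, at
  \<open>ack e (Suc t - p) - 1\<close> in that degree. The next cone then starts one degree higher
  by its own count, which cancels the \<open>- 1\<close>; so each cone contributes one application
  of \<open>ack e\<close>.\<close>

lemma dies_cones:
  assumes "\<And>y. y > 0 \<Longrightarrow> dies e y (mnum e y) (ack e y - 1)" and "p \<le> t"
  shows "dies (Suc e) t (cones e p t) ((ack e ^^ p) (Suc t - p) - 1)"
  using assms(2)
proof (induction p arbitrary: t)
  case 0
  then show ?case by (simp add: cones_def)
next
  case (Suc p)
  define u where "u = t - p"
  have u: "u > 0" "t = p + u" using Suc.prems by (auto simp: u_def)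
  define t2 where "t2 = p + (ack e u - 1)"
  have a: "ack e u > 0" using ack_gt[of u e] by simp
  have "dies (Suc e) t2 (cones e p t2) ((ack e ^^ p) (Suc t2 - p) - 1)"
    by (rule Suc.IH) (simp add: t2_def)
  moreover have "Suc t2 - p = ack e u" using a by (simp add: t2_def)
  ultimately have d: "dies (Suc e) t2 (cones e p t2) ((ack e ^^ Suc p) u - 1)"
    by (simp add: funpow_swap1)
  have "dies (Suc e) (p + u) (cones e p (p + u) + mnum e u) ((ack e ^^ Suc p) u - 1)"
    by (rule dies_base[OF assms(1)[OF u(1)] order_refl u(1) grow_cones_add d[unfolded t2_def]])
  then show ?case using u by (simp add: cones_Suc)
qed

text \<open>The first step loses one monomial and leaves exactly \<open>Suc y\<close> cones in
  degree \<open>Suc y\<close>, the last of them in its own degree 1. Iterating \<open>ack e\<close>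
  from 1 that many times is the recursion of \<open>ack (Suc e)\<close>.\<close>

lemma dies_mnum_Suc:
  assumes "\<And>y. y > 0 \<Longrightarrow> dies e y (mnum e y) (ack e y - 1)"
  shows "dies (Suc e) y (mnum (Suc e) y) (ack (Suc e) y - 1)"
proof (rule dies.dies_Suc)
  have "cones e (Suc y) (Suc y) = mnum (Suc e) (Suc y) - 1"
    using cones_full[of e "Suc y"] by (simp add: cones_Suc[of e "Suc y"])
  then show "dies (Suc e) (Suc y) (grow (Suc e) y (mnum (Suc e) y) - 1) (ack (Suc e) y - 1)"
    using dies_cones[OF assms, of "Suc y" "Suc y"] by (simp add: ack_pow del: funpow.simps)
qed (rule mnum_pos)

lemma dies_mnum: "y > 0 \<Longrightarrow> dies e y (mnum e y) (ack e y - 1)"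
proof (induction e arbitrary: y)
  case 0
  then show ?case by simp
qed (rule dies_mnum_Suc)

lemma dies_mnum': "dies (Suc e) y (mnum (Suc e) y) (ack (Suc e) y - 1)"
  by (rule dies_mnum_Suc) (rule dies_mnum)

lemma dies_mnum_add:
  "dies (Suc m) t x T \<Longrightarrow> dies (Suc m) t (mnum (Suc m) t + x) (ack (Suc m) T - 1)"
proof (induction rule: dies.induct)
  case (dies_0 t)
  then show ?case using dies_mnum' by simp
next
  case (dies_Suc x t T)
  have "grow (Suc m) t (mnum (Suc m) t + x) - 1 = mnum (Suc m) (Suc t) + (grow (Suc m) t x - 1)"
    using grow_ge[of x m t] dies_Suc.hyps(1) by (simp add: grow_mnum_add)
  then show ?case using dies_Suc by - (rule dies.dies_Suc, auto)
qed

lemma dies_total: "\<exists>T. dies (Suc m) t H T"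
proof -
  have "\<exists>T. dies (Suc m) t (q * mnum (Suc m) t) T" for q
    by (induction q) (auto dest: dies_mnum_add)
  then obtain T where T: "dies (Suc m) t (H * mnum (Suc m) t) T" by blast
  have "H \<le> H * mnum (Suc m) t" using mnum_pos[of m t] by simp
  then show ?thesis using dies_mono[OF T] by blast
qed

lemma C1_pow: "C1 m r = (ack (m - 1) ^^ r) 0"
  by (induction r) auto

lemma C1_mono: "r \<le> r' \<Longrightarrow> C1 m r \<le> C1 m r'"
  unfolding C1_pow by (rule ack_pow_le)

lemma C1_ge: "r \<le> C1 m r"
  by (induction r) (auto intro: le_trans[OF _ ack_gt[THEN Suc_leI]])

lemma Cnum_pow: "n > 0 \<Longrightarrow> Cnum m n r = (C1 m ^^ n) r"
  by (induction m n r rule: Cnum.induct) auto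

lemma C1_pow_mono: "r \<le> r' \<Longrightarrow> (C1 m ^^ n) r \<le> (C1 m ^^ n) r'"
  by (induction n) (auto intro: C1_mono)

lemma C1_pow_ge: "r \<le> (C1 m ^^ n) r"
  by (induction n) (auto intro: le_trans[OF _ C1_ge])

text \<open>The origin of \<open>C1\<close>. With \<open>m = e + 2\<close> and
  \<open>r = q + 1\<close>, the full count minus 2 consists of \<open>q\<close> cones of dimension
  \<open>e + 1\<close> and of \<open>e\<close> elements in degree 1. The latter decline as all
  linear forms in \<open>e\<close> variables do, until
  \<open>ack e 1 - 1 = ack (Suc e) 0 - 1\<close>; the cones then apply \<open>ack (Suc e)\<close>
  another \<open>q\<close> times.\<close>

lemma dies_C1:
  assumes "m \<ge> 2" "r > 0"
  shows "dies m r (mnum m r - 2) (C1 m r - 1)"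
proof -
  obtain e where m: "m = Suc (Suc e)" using assms by (metis add_2_eq_Suc le_Suc_ex)
  obtain q where r: "r = Suc q" using assms by (cases r) auto
  have "cones (Suc e) (Suc r) r = cones (Suc e) q r + mnum (Suc e) 1 + 1"
    by (simp add: cones_Suc r)
  then have eq: "mnum m r - 2 = cones (Suc e) q r + e"
    using cones_full[of "Suc e" r] by (simp add: m)
  have "dies (Suc e) (0 + 1) (0 + mnum e 1) (ack e 1 - 1)"
  proof (rule dies_base[OF dies_mnum, where B = "\<lambda>_. 0"])
    fix u x assume "u > (0::nat)" "x \<le> mnum e u"
    then show "grow (Suc e) (0 + u) (0 + x) = 0 + grow e u x"
      using grow_Suc_vars[of x e "u - 1"] by simp
  qed auto
  then have loc: "dies (Suc e) 1 e (ack (Suc e) 0 - 1)" by simp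
  define t2 where "t2 = q + (ack (Suc e) 0 - 1)"
  have a: "ack (Suc e) 0 > 0" using ack_gt[of 0 "Suc e"] by simp
  have "dies m t2 (cones (Suc e) q t2) ((ack (Suc e) ^^ q) (Suc t2 - q) - 1)"
    unfolding m by (rule dies_cones[OF dies_mnum]) (simp_all add: t2_def)
  moreover have "Suc t2 - q = ack (Suc e) 0" using a by (simp add: t2_def)
  ultimately have d: "dies m t2 (cones (Suc e) q t2) (C1 m r - 1)"
    by (simp add: C1_pow m r funpow_swap1)
  have "dies m (q + 1) (cones (Suc e) q (q + 1) + e) (C1 m r - 1)"
    unfolding m
    by (rule dies_base[OF loc _ _ grow_cones_add d[unfolded t2_def m]]) simp_all
  then show ?thesis unfolding eq by (simp add: r)
qed

text \<open>The price of one new coordinate, which brings a full count minus 2. For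
  \<open>Y \<ge> 2\<close> that deficit is charged to the old part: \<open>Y - 2\<close> is used up
  strictly before \<open>D\<close>, and only then does the full count start to decline. The value
  \<open>Y = 1\<close> leaves \<open>t\<close> cones, and \<open>Y = 0\<close> is the case of a
  single coordinate.\<close>

lemma dies_C1_add:
  assumes m: "m \<ge> 2" and t: "t > 0"
    and D: "dies m t (Y - 1) D" and T: "dies m t (Y + (mnum m t - 2)) T"
  shows "Suc T \<le> C1 m (if Y = 0 then t else Suc D)"
proof -
  obtain e where me: "m = Suc (Suc e)" using m by (metis add_2_eq_Suc le_Suc_ex)
  have C: "C1 m x > 0" if "x > 0" for x using C1_ge[of x m] that by simp
  obtain q where q: "t = Suc q" using t by (cases t) auto
  have "mnum m t = mnum (Suc e) (Suc q) + mnum m q" by (simp add: me q)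
  then have F2: "mnum m t \<ge> 2"
    using mnum_pos[of e "Suc q"] mnum_pos[of "Suc e" q] unfolding me by linarith
  consider "Y = 0" | "Y = 1" | "Y \<ge> 2" by linarith
  then show ?thesis
  proof cases
    case 1
    then show ?thesis using dies_det[OF T] dies_C1[OF m t] C[OF t] by simp
  next
    case 2
    have "cones (Suc e) t t = mnum m t - 1"
      using cones_full[of "Suc e" t] by (simp add: cones_Suc me)
    then have "Y + (mnum m t - 2) = cones (Suc e) t t" using 2 F2 by simp
    then have "dies m t (Y + (mnum m t - 2)) ((ack (Suc e) ^^ t) 1 - 1)"
      using dies_cones[OF dies_mnum, of t t "Suc e"] by (simp add: me)
    then have "T = (ack (Suc e) ^^ t) 1 - 1" using dies_det[OF T] by blast
    moreover have "(ack (Suc e) ^^ t) 1 \<le> (ack (Suc e) ^^ t) (ack (Suc e) 0)"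
      by (rule ack_pow_mono) (use ack_gt[of 0 "Suc e"] in simp)
    moreover have "(ack (Suc e) ^^ t) (ack (Suc e) 0) = C1 m (Suc t)"
      by (simp add: C1_pow me funpow_swap1)
    ultimately show ?thesis using 2 D C[of "Suc t"] by simp
  next
    case 3
    have lt: "Y - 2 < Y - 1" using 3 by linarith
    obtain D2 where D2: "D2 < D" "dies m t (Y - 2) D2"
      using dies_strict[OF D[unfolded me] lt] unfolding me by blast
    have "Y + (mnum m t - 2) = mnum m t + (Y - 2)" using F2 3 by simp
    then have "T = ack m D2 - 1" using dies_det[OF T] dies_mnum_add D2(2) by (metis me)
    \<comment> \<open>An iteration started at 1 is compared with \<open>C1\<close>, which starts at
      0. The difference is one more application of \<open>ack (Suc e)\<close>, and
      \<open>D2 < D\<close> pays for it.\<close>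
    moreover have "ack m D2 = (ack (Suc e) ^^ Suc D2) 1" by (simp only: me ack_pow)
    moreover have "(ack (Suc e) ^^ Suc D2) 1 \<le> (ack (Suc e) ^^ Suc D2) (ack (Suc e) 0)"
      by (rule ack_pow_mono) (use ack_gt[of 0 "Suc e"] in simp)
    moreover have "(ack (Suc e) ^^ Suc D2) (ack (Suc e) 0) = C1 m (Suc (Suc D2))"
      by (simp add: C1_pow me funpow_swap1)
    moreover have "C1 m (Suc (Suc D2)) \<le> C1 m (Suc D)" using D2(1) by (intro C1_mono) simp
    ultimately have "Suc T \<le> C1 m (Suc D)" using C[of "Suc D"] by linarith
    then show ?thesis using 3 by simp
  qed
qed

lemma dies_C1_pow:
  assumes m: "m \<ge> 2" and t: "t > 0" and w: "w > 0"
    and start: "\<And>T. dies m t (Y + (mnum m t - 2)) T \<Longrightarrow> Suc T \<le> C1 m c"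
  shows "dies m t (Y + w * (mnum m t - 2)) T \<Longrightarrow> Suc T \<le> (C1 m ^^ w) c"
  using w
proof (induction w arbitrary: T)
  case (Suc w)
  show ?case
  proof (cases "w = 0")
    case True
    then show ?thesis using start Suc.prems by simp
  next
    case False
    let ?X = "Y + w * (mnum m t - 2)"
    obtain m' where m': "m = Suc m'" using m by (cases m) auto
    obtain D where D: "dies m t (?X - 1) D" using dies_total m' by blast
    obtain D' where D': "dies m t ?X D'" using dies_total m' by blast
    have "D \<le> D'" using dies_mono[OF D', of "?X - 1"] dies_det[OF D] by auto
    have "dies m t (?X + (mnum m t - 2)) T" using Suc.prems by (simp add: add.assoc add.commute add.left_commute)
    from dies_C1_add[OF m t D this]
    have "Suc T \<le> C1 m (if ?X = 0 then t else Suc D)" .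
    also have "\<dots> \<le> C1 m (Suc D')" using \<open>D \<le> D'\<close> dies_le[OF D'] by (intro C1_mono) auto
    also have "\<dots> \<le> C1 m ((C1 m ^^ w) c)" using Suc.IH[OF D'] False by (intro C1_mono) simp
    finally show ?thesis by simp
  qed
qed simp

section \<open>The order of the generators of a coherent family of monomial ideals\<close>

lemma upset_le:
  fixes u v :: "'m::finite \<Rightarrow> nat"
  assumes "\<And>u j. u \<in> E \<Longrightarrow> inc u j \<in> E" and "u \<in> E" and "u \<le> v"
  shows "v \<in> E"
  using assms(2,3)
proof (induction "mord v - mord u" arbitrary: u)
  case 0
  then have "\<not> mord u < mord v" by simp
  have "u = v"
  proof (rule ccontr)
    assume "u \<noteq> v"
    then obtain i where "u i \<noteq> v i" by auto
    then have "u i < v i" using 0 by (auto simp: le_fun_def nat_less_le)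
    then have "inc u i \<le> v" using 0 by (auto simp: le_fun_def inc_apply)
    then show False using mord_mono[of "inc u i" v] \<open>\<not> mord u < mord v\<close> by simp
  qed
  then show ?case using 0 by simp
next
  case (Suc n)
  then have "mord u < mord v" by linarith
  then obtain i where i: "u i < v i" using mord_less_ex[of u v] Suc.prems by blast
  then have "inc u i \<le> v" using Suc.prems by (auto simp: le_fun_def inc_apply)
  then show ?case using Suc by (intro Suc.hyps(1)[of "inc u i"]) (auto intro: assms(1))
qed

lemma mord_between:
  fixes u v :: "'m::finite \<Rightarrow> nat"
  assumes "u \<le> v" "mord u \<le> d" "d \<le> mord v"
  shows "\<exists>w. u \<le> w \<and> w \<le> v \<and> mord w = d"
  using assms
proof (induction "d - mord u" arbitrary: u)
  case 0
  then show ?case by auto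
next
  case (Suc n)
  then have "mord u < mord v" by linarith
  then obtain i where i: "u i < v i" using mord_less_ex[of u v] Suc.prems by blast
  then have le: "inc u i \<le> v" using Suc.prems by (auto simp: le_fun_def inc_apply)
  have "\<exists>w. inc u i \<le> w \<and> w \<le> v \<and> mord w = d"
    by (rule Suc.hyps(1)) (use Suc le in auto)
  then obtain w where w: "inc u i \<le> w" "w \<le> v" "mord w = d" by blast
  then show ?case using order_trans[OF le_inc w(1)] by blast
qed

definition below :: "nat \<Rightarrow> ('m::finite \<Rightarrow> nat) set \<Rightarrow> ('m \<Rightarrow> nat) set" where
  "below d E = above {e \<in> E. mord e \<le> d}"

locale upset =
  fixes E :: "('m::finite \<Rightarrow> nat) set"
  assumes inc_E: "u \<in> E \<Longrightarrow> inc u j \<in> E"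
begin

lemma E_le: "u \<in> E \<Longrightarrow> u \<le> v \<Longrightarrow> v \<in> E"
  using upset_le[of E u v] inc_E by blast

lemma below_iff: "d \<le> mord u \<Longrightarrow> u \<in> below d E \<longleftrightarrow> (\<exists>e\<in>E. e \<le> u \<and> mord e = d)"
  unfolding below_def above_def using mord_between[of _ u d] E_le by fastforce

lemma above_mons_iff: "u \<in> above (mons UNIV d \<inter> E) \<longleftrightarrow> (\<exists>e\<in>E. e \<le> u \<and> mord e = d)"
  by (auto simp: above_def mons_def)

definition hilb :: "nat \<Rightarrow> nat" where
  "hilb d = card (mons UNIV d - E)"

lemma ups_E: "mons UNIV (Suc d) - E \<subseteq> ups UNIV d (mons UNIV d - E)"
proof
  fix v assume v: "v \<in> mons UNIV (Suc d) - E"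
  have "dec v j \<in> mons UNIV d - E" if "v j > 0" for j
    using v that inc_E[of "dec v j" j] inc_mons[of j UNIV "dec v j" d] by auto
  then show "v \<in> ups UNIV d (mons UNIV d - E)" using v by (auto simp: ups_def)
qed

lemma finite_ups: "finite (ups J d U)"
  unfolding ups_def by (rule finite_subset[OF _ finite_mons]) auto

lemma hilb_grow: "hilb (Suc d) \<le> grow CARD('m) d (hilb d)"
proof -
  have "hilb (Suc d) \<le> card (ups UNIV d (mons UNIV d - E))"
    unfolding hilb_def by (intro card_mono ups_E finite_ups)
  also have "\<dots> \<le> grow CARD('m) d (hilb d)"
    unfolding hilb_def by (rule macaulay_gotzmann) auto
  finally show ?thesis .
qed

text \<open>Maximal growth forces the complement in degree \<open>d + 1\<close> to be all of
  \<open>ups\<close>, so no generator has order \<open>d + 1\<close>; by the Gotzmann part the ideal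
  generated up to order \<open>d\<close> has at most linear syzygies beyond
  \<open>d\<close>.\<close>

lemma hilb_max:
  assumes "hilb (Suc d) = grow CARD('m) d (hilb d)"
  shows "mord u \<ge> d + 2 \<Longrightarrow> lconn (below d E) u"
    and "mord u \<ge> d \<Longrightarrow> u \<in> below (Suc d) E \<longleftrightarrow> u \<in> below d E"
proof -
  let ?U = "mons UNIV d - E"
  have le: "hilb (Suc d) \<le> card (ups UNIV d ?U)"
    unfolding hilb_def by (intro card_mono ups_E finite_ups)
  have eq: "card (ups UNIV d ?U) = grow CARD('m) d (card ?U)"
    using macaulay_gotzmann(1)[of ?U UNIV d] le assms by (auto simp: hilb_def)
  have "mons UNIV (Suc d) - E = ups UNIV d ?U"
    by (rule card_subset_eq[OF finite_ups ups_E]) (use eq assms in \<open>simp add: hilb_def\<close>)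
  then have gen: "\<exists>j. v j > 0 \<and> dec v j \<in> E \<and> mord (dec v j) = d" if v: "v \<in> E" "mord v = Suc d" for v
  proof -
    have "v \<notin> ups UNIV d ?U" using \<open>_ = ups UNIV d ?U\<close> v by blast
    then obtain j where j: "v j > 0" "dec v j \<notin> ?U" using v by (auto simp: ups_def mons_def)
    then have "mord (dec v j) = d" using v mord_dec[of v j] by simp
    then show ?thesis using j by (auto simp: mons_def)
  qed
  show 2: "u \<in> below (Suc d) E \<longleftrightarrow> u \<in> below d E" if u: "mord u \<ge> d" for u
  proof
    assume "u \<in> below (Suc d) E"
    then obtain e where e: "e \<in> E" "mord e \<le> Suc d" "e \<le> u" by (auto simp: below_def above_def)
    show "u \<in> below d E"
    proof (cases "mord e = Suc d")
      case True
      then obtain j where "dec e j \<in> E" "mord (dec e j) = d" using gen e by blast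
      then show ?thesis using e(3) dec_le[of e j] by (auto simp: below_def above_def intro: order_trans)
    qed (use e in \<open>auto simp: below_def above_def\<close>)
  qed (auto simp: below_def above_def)
  assume u: "mord u \<ge> d + 2"
  have "lconn (above (mons UNIV d - ?U)) u"
    using macaulay_gotzmann(2)[OF _ eq _ u] by simp
  moreover have "v \<in> above (mons UNIV d - ?U) \<longleftrightarrow> v \<in> below d E" if "mord u \<le> mord v + 2" for v
  proof -
    have "mons UNIV d - ?U = mons UNIV d \<inter> E" by blast
    then show ?thesis using above_mons_iff below_iff[of d v] u that by simp
  qed
  ultimately show "lconn (below d E) u" using lconn_cong2 by blast
qed

text \<open>Two vertices in different components lie above elements of \<open>E\<close> of order
  \<open>d\<close>. A common one would give an edge between them, so \<open>E\<close> has two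
  distinct elements of that order.\<close>

lemma not_lconn_card:
  assumes u: "mord u \<ge> Suc d" and nc: "\<not> lconn (below d E) u"
  shows "hilb d + 2 \<le> mnum CARD('m) d"
proof -
  obtain j l where j: "u j > 0" "dec u j \<in> below d E" and l: "u l > 0" "dec u l \<in> below d E"
    and jl: "(j, l) \<notin> (lnbr (below d E) u)\<^sup>*"
    using nc by (auto simp: lconn_def)
  have ne: "j \<noteq> l" using jl by auto
  obtain p where p: "p \<in> E" "p \<le> dec u j" "mord p = d"
    using below_iff[of d "dec u j"] j u mord_dec[of u j] by auto
  obtain q where q: "q \<in> E" "q \<le> dec u l" "mord q = d"
    using below_iff[of d "dec u l"] l u mord_dec[of u l] by auto
  have "p \<noteq> q"
  proof
    assume "p = q"
    have "p y \<le> dec (dec u j) l y" for y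
      using le_funD[OF p(2), of y] le_funD[OF q(2), of y] ne \<open>p = q\<close>
      by (cases "y = l") (simp_all add: dec_apply)
    then have "p \<le> dec (dec u j) l" by (simp add: le_fun_def)
    then have "dec (dec u j) l \<in> below d E" using p by (auto simp: below_def above_def)
    then have "(j, l) \<in> lnbr (below d E) u" using ne j l by (auto simp: lnbr_def)
    then show False using jl by auto
  qed
  then have "card (mons UNIV d - E) + card {p, q} = card ((mons UNIV d - E) \<union> {p, q})"
    using p q finite_mons by (subst card_Un_disjoint) auto
  also have "\<dots> \<le> card (mons UNIV d :: ('m \<Rightarrow> nat) set)"
    using p q by (intro card_mono finite_mons) (auto simp: mons_def)
  finally show ?thesis using \<open>p \<noteq> q\<close> by (simp add: hilb_def card_mons)
qed

lemma active_Suc: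
  assumes "hilb d + 2 \<le> mnum CARD('m) d"
  shows "hilb (Suc d) + 2 \<le> mnum CARD('m) (Suc d)"
proof -
  have *: "hilb d + card (mons UNIV d \<inter> E) = mnum CARD('m) d" for d
  proof -
    have "card (mons UNIV d - E) + card (mons UNIV d \<inter> E) = card (mons UNIV d :: ('m \<Rightarrow> nat) set)"
      using finite_mons by (subst card_Un_disjoint[symmetric]) (auto intro: arg_cong[where f = card])
    then show ?thesis by (simp add: hilb_def card_mons)
  qed
  have "card (mons UNIV d \<inter> E) \<le> card (mons UNIV (Suc d) \<inter> E)"
  proof (rule card_inj_on_le)
    show "inj_on (\<lambda>u. inc u undefined) (mons UNIV d \<inter> E)" by (auto intro: inj_onI inc_inj)
    show "(\<lambda>u. inc u undefined) ` (mons UNIV d \<inter> E) \<subseteq> mons UNIV (Suc d) \<inter> E"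
      by (auto simp: inc_mons inc_E)
  qed (use finite_mons in auto)
  then show ?thesis using assms *[of d] *[of "Suc d"] by linarith
qed

end

text \<open>A coordinate is active in degree \<open>d\<close> if its ideal contains two monomials of
  that degree. \<open>D d\<close> predicts where the total Hilbert function \<open>Z\<close> of the
  active coordinates would be used up, and the potential \<open>P d\<close> applies
  \<open>C1\<close> to \<open>Suc (D d)\<close> once for every coordinate not yet active. Up to the
  least order \<open>f\<close> of an offending generator, \<open>P\<close> does not increase; it
  starts at most at the bound and always exceeds \<open>d\<close>, which is contradictory at
  \<open>d = f - 1\<close>.\<close>

theorem generators_bound:
  fixes E :: "'n::finite \<Rightarrow> ('m::finite \<Rightarrow> nat) set"
  assumes inc_E: "\<And>i u j. u \<in> E i \<Longrightarrow> inc u j \<in> E i"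
    and key: "\<And>d. r \<le> d \<Longrightarrow> \<forall>i u. Suc d \<le> mord u \<longrightarrow> lconn (below d (E i)) u \<Longrightarrow>
                \<forall>i. E i = below d (E i)"
  shows "E i = below (Cnum CARD('m) CARD('n) r) (E i)"
proof (rule ccontr)
  interpret U: upset "E i" for i by unfold_locales (rule inc_E)
  let ?m = "CARD('m)" and ?C = "Cnum CARD('m) CARD('n) r"
  let ?H = "\<lambda>i. upset.hilb (E i)"
  assume "E i \<noteq> below ?C (E i)"
  moreover have "below ?C (E i) \<subseteq> E i" by (auto simp: below_def above_def intro: U.E_le)
  ultimately have "\<exists>e. e \<in> E i \<and> e \<notin> below ?C (E i)" by blast
  then obtain e where e: "e \<in> E i" "e \<notin> below ?C (E i)"
    and emin: "\<And>e'. e' \<in> E i \<Longrightarrow> e' \<notin> below ?C (E i) \<Longrightarrow> mord e \<le> mord e'"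
    using arg_min_natI[of "\<lambda>e. e \<in> E i \<and> e \<notin> below ?C (E i)" _ mord]
      arg_min_nat_le[of "\<lambda>e. e \<in> E i \<and> e \<notin> below ?C (E i)" _ mord] by blast
  define f where "f = mord e"
  have fC: "?C < f" using e by (auto simp: below_def above_def f_def not_le)
  have ne: "e \<notin> below d (E i)" if "d < f" for d
  proof
    assume "e \<in> below d (E i)"
    then obtain e' where e': "e' \<in> E i" "mord e' \<le> d" "e' \<le> e" by (auto simp: below_def above_def)
    have "e' \<in> below ?C (E i)" using emin[of e'] e' that by (auto simp: f_def)
    then have "e \<in> below ?C (E i)" using e'(3) by (auto simp: below_def above_def intro: order_trans)
    then show False using e by simp
  qed
  have nconn: "\<exists>i u. Suc d \<le> mord u \<and> \<not> lconn (below d (E i)) u" if "r \<le> d" "d < f" for d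
    using key[OF that(1)] ne[OF that(2)] e(1) by blast
  define Act where "Act d = {i. ?H i d + 2 \<le> mnum ?m d}" for d
  have Act_mono: "Act d \<subseteq> Act (Suc d)" for d
    using U.active_Suc by (auto simp: Act_def)
  have Act_nonempty: "Act d \<noteq> {}" if "r \<le> d" "d < f" for d
    using nconn[OF that] U.not_lconn_card by (fastforce simp: Act_def)
  \<comment> \<open>Otherwise all active coordinates grow maximally from \<open>d\<close> to
    \<open>d + 1\<close> and nothing becomes active, so there would be no syzygy above order
    \<open>d + 1\<close>, against \<open>nconn\<close> at \<open>Suc d\<close>.\<close>
  have drop: "(\<exists>i\<in>Act d. ?H i (Suc d) < grow ?m d (?H i d)) \<or> \<not> Act (Suc d) \<subseteq> Act d"
    if d: "r \<le> d" "Suc d < f" for d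
  proof (rule ccontr)
    assume "\<not> ?thesis"
    then have eq: "\<And>i. i \<in> Act d \<Longrightarrow> ?H i (Suc d) = grow ?m d (?H i d)"
      and sub: "Act (Suc d) \<subseteq> Act d"
      using U.hilb_grow by (auto simp: not_less le_antisym)
    obtain i u where u: "Suc (Suc d) \<le> mord u" and nc: "\<not> lconn (below (Suc d) (E i)) u"
      using nconn[of "Suc d"] d by auto
    have "i \<in> Act (Suc d)" using U.not_lconn_card[OF u nc] by (simp add: Act_def)
    then have H: "?H i (Suc d) = grow ?m d (?H i d)" using eq sub by blast
    have "lconn (below d (E i)) u" using U.hilb_max(1)[OF H] u by simp
    moreover have "v \<in> below (Suc d) (E i) \<longleftrightarrow> v \<in> below d (E i)" if "mord u \<le> mord v + 2" for v
      by (rule U.hilb_max(2)[OF H]) (use u that in simp)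
    ultimately show False using nc lconn_cong2 by blast
  qed
  have rC: "r \<le> ?C" using C1_pow_ge by (simp add: Cnum_pow)
  have m0: "?m > 0" by simp
  \<comment> \<open>One variable has one monomial per degree, so nothing could become active;
    likewise in degree 0, which gives \<open>r > 0\<close> below.\<close>
  have m2: "?m \<ge> 2"
  proof (rule ccontr)
    assume "\<not> ?m \<ge> 2"
    then have "?m = Suc 0" using m0 by linarith
    moreover have "mnum (Suc 0) r = 1" by (induction r) auto
    ultimately show False using Act_nonempty[of r] rC fC by (auto simp: Act_def)
  qed
  have r0: "r > 0"
  proof (rule ccontr)
    assume "\<not> r > 0"
    then show False using Act_nonempty[of r] rC fC by (auto simp: Act_def)
  qed
  obtain m' where m': "?m = Suc m'" using m0 gr0_conv_Suc by blast
  define Z where "Z d = (\<Sum>i\<in>Act d. ?H i d)" for d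
  define D where "D d = (THE T. dies ?m d (Z d) T)" for d
  have D: "dies ?m d (Z d) (D d)" for d
  proof -
    have "\<exists>!T. dies ?m d (Z d) T" using dies_total dies_det unfolding m' by blast
    then show ?thesis unfolding D_def by (rule theI')
  qed
  define P where "P d = (C1 ?m ^^ card (- Act d)) (Suc (D d))" for d
  have new: "(\<Sum>i\<in>N. ?H i d) \<le> card N * (mnum ?m d - 2)" if "N \<subseteq> Act d" for N d
  proof -
    have "(\<Sum>i\<in>N. ?H i d) \<le> of_nat (card N) * (mnum ?m d - 2)"
      by (rule sum_bounded_above) (use that in \<open>auto simp: Act_def\<close>)
    then show ?thesis by simp
  qed
  have step: "P (Suc d) \<le> P d" if d: "r \<le> d" "Suc d < f" for d
  proof -
    define N where "N = Act (Suc d) - Act d"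
    define w where "w = card N"
    define Y where "Y = grow ?m d (Z d)"
    have u: "card (- Act d) = w + card (- Act (Suc d))"
    proof -
      have "- Act d = N \<union> - Act (Suc d)" using Act_mono[of d] by (auto simp: N_def)
      then have "card (- Act d) = card (N \<union> - Act (Suc d))" by simp
      also have "\<dots> = card N + card (- Act (Suc d))"
        by (rule card_Un_disjoint) (auto simp: N_def)
      finally show ?thesis by (simp add: w_def)
    qed
    have old: "(\<Sum>i\<in>A. ?H i (Suc d)) \<le> grow ?m d (\<Sum>i\<in>A. ?H i d)" for A
    proof (induction A rule: infinite_finite_induct)
      case (insert i A)
      then show ?case
        using U.hilb_grow[of i d] grow_superadd[of ?m d "?H i d" "\<Sum>i\<in>A. ?H i d"] by simp
    qed auto
    have Zs: "Z (Suc d) = (\<Sum>i\<in>Act d. ?H i (Suc d)) + (\<Sum>i\<in>N. ?H i (Suc d))"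
      unfolding Z_def N_def using sum.subset_diff[OF Act_mono[of d], of "\<lambda>i. ?H i (Suc d)"]
      by (simp add: add.commute)
    have YZ: "Z d \<le> Y" unfolding Y_def m' by (rule grow_ge)
    have run: "dies ?m (Suc d) (Y - 1) (D d)" if "Z d > 0"
      using D[of d] that unfolding Y_def by (cases rule: dies.cases) auto
    \<comment> \<open>If nothing becomes active, some active coordinate stays below maximal growth
      by at least 1, and that is one step of \<open>dies\<close>. If \<open>w\<close> coordinates
      become active, \<open>w\<close> of the outer applications of \<open>C1\<close> are spent on
      them.\<close>
    show ?thesis
    proof (cases "w = 0")
      case True
      then have N: "N = {}" by (simp add: w_def)
      then obtain i where i: "i \<in> Act d" "?H i (Suc d) < grow ?m d (?H i d)"
        using drop[OF d] by (auto simp: N_def)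
      have "(\<Sum>i\<in>Act d. ?H i (Suc d)) < Y"
      proof -
        have "(\<Sum>i\<in>Act d. ?H i (Suc d)) = ?H i (Suc d) + (\<Sum>i\<in>Act d - {i}. ?H i (Suc d))"
          using i(1) by (simp add: sum.remove)
        also have "\<dots> < grow ?m d (?H i d) + grow ?m d (\<Sum>i\<in>Act d - {i}. ?H i d)"
          using i(2) old[of "Act d - {i}"] by linarith
        also have "\<dots> \<le> grow ?m d (?H i d + (\<Sum>i\<in>Act d - {i}. ?H i d))" by (rule grow_superadd)
        also have "\<dots> = Y" using i(1) unfolding Y_def Z_def by (simp add: sum.remove)
        finally show ?thesis .
      qed
      then have lt: "Z (Suc d) \<le> Y - 1" and "Y > 0" using Zs N by auto
      have "Z d > 0"
      proof (rule ccontr)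
        assume "\<not> Z d > 0"
        then show False using \<open>Y > 0\<close> by (simp add: Y_def)
      qed
      then have "D (Suc d) \<le> D d"
        using dies_mono[OF run lt] dies_det[OF D[of "Suc d"]] by blast
      then show ?thesis unfolding P_def u using True by (simp add: C1_pow_mono)
    next
      case False
      have Zle: "Z (Suc d) \<le> Y + w * (mnum ?m (Suc d) - 2)"
        using Zs old[of "Act d"] new[of N "Suc d"] by (simp add: Y_def Z_def w_def N_def)
      obtain T where T: "dies ?m (Suc d) (Y + w * (mnum ?m (Suc d) - 2)) T"
        using dies_total unfolding m' by blast
      have "Suc T \<le> (C1 ?m ^^ w) (Suc (D d))"
      proof (rule dies_C1_pow[OF m2 _ _ _ T])
        fix T' assume T': "dies ?m (Suc d) (Y + (mnum ?m (Suc d) - 2)) T'"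
        show "Suc T' \<le> C1 ?m (Suc (D d))"
        proof (cases "Z d = 0")
          case True
          then have "Y = 0" "D d = d" using D[of d] by (auto simp: Y_def)
          then show ?thesis using dies_C1_add[OF m2 _ _ T', of "Suc d"] by simp
        next
          case False
          then show ?thesis using dies_C1_add[OF m2 _ run T'] YZ by simp
        qed
      qed (use False in auto)
      moreover have "D (Suc d) \<le> T" using dies_mono[OF T Zle] dies_det[OF D[of "Suc d"]] by blast
      ultimately have "Suc (D (Suc d)) \<le> (C1 ?m ^^ w) (Suc (D d))" by simp
      then have "P (Suc d) \<le> (C1 ?m ^^ card (- Act (Suc d))) ((C1 ?m ^^ w) (Suc (D d)))"
        unfolding P_def by (rule C1_pow_mono)
      also have "\<dots> = (C1 ?m ^^ (card (- Act (Suc d)) + w)) (Suc (D d))" by (simp add: funpow_add)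
      finally show ?thesis by (simp add: P_def[of d] u add.commute)
    qed
  qed
  have "P r \<le> ?C"
  proof -
    define w where "w = card (Act r)"
    have w: "w > 0" using Act_nonempty[of r] rC fC by (simp add: w_def card_gt_0_iff)
    have Zle: "Z r \<le> 0 + w * (mnum ?m r - 2)" using new[of "Act r" r] by (simp add: Z_def w_def)
    obtain T where T: "dies ?m r (0 + w * (mnum ?m r - 2)) T"
      using dies_total unfolding m' by blast
    have "Suc T \<le> (C1 ?m ^^ w) r"
    proof (rule dies_C1_pow[OF m2 r0 w _ T])
      fix T' assume T': "dies ?m r (0 + (mnum ?m r - 2)) T'"
      show "Suc T' \<le> C1 ?m r" using dies_C1_add[OF m2 r0 _ T', of r] by simp
    qed
    moreover have "D r \<le> T" using dies_mono[OF T Zle] dies_det[OF D[of r]] by blast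
    ultimately have "Suc (D r) \<le> (C1 ?m ^^ w) r" by simp
    then have "P r \<le> (C1 ?m ^^ card (- Act r)) ((C1 ?m ^^ w) r)"
      unfolding P_def by (rule C1_pow_mono)
    also have "\<dots> = (C1 ?m ^^ (card (- Act r) + w)) r" by (simp add: funpow_add)
    also have "card (- Act r) + w = CARD('n)"
      unfolding w_def by (simp add: card_Un_disjoint[symmetric] Compl_partition2)
    finally show ?thesis by (simp add: Cnum_pow)
  qed
  moreover have "P d \<le> P r" if "r \<le> d" "d < f" for d
    using that
  proof (induction d rule: dec_induct)
    case (step d)
    then show ?case using \<open>\<And>d. r \<le> d \<Longrightarrow> Suc d < f \<Longrightarrow> P (Suc d) \<le> P d\<close>[of d] by simp
  qed simp
  moreover have "Suc d \<le> P d" for d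
    using C1_pow_ge[of "Suc (D d)" "card (- Act d)" ?m] dies_le[OF D[of d]] by (simp add: P_def)
  moreover have "r \<le> f - 1" "f - 1 < f" using rC fC by linarith+
  ultimately have "Suc (f - 1) \<le> ?C" using order_trans by metis
  then show False using fC by simp
qed

section \<open>Algebra: algebraic dependence and transcendence degree by means of
  derivations\<close>

section \<open>Derivations of a field of characteristic zero\<close>

definition is_der :: "('a::field \<Rightarrow> 'a) \<Rightarrow> bool" where
  "is_der d \<longleftrightarrow> (\<forall>x y. d (x + y) = d x + d y) \<and> (\<forall>x y. d (x * y) = d x * y + x * d y)"

lemma der_add: "is_der d \<Longrightarrow> d (x + y) = d x + d y"
  and der_mult: "is_der d \<Longrightarrow> d (x * y) = d x * y + x * d y"
  by (auto simp: is_der_def)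

lemma der_0: "is_der d \<Longrightarrow> d 0 = 0"
  using der_add[of d 0 0] by (metis add_0 add_cancel_right_right)

lemma der_1: "is_der d \<Longrightarrow> d 1 = 0"
  using der_mult[of d 1 1] by (metis add_cancel_right_right mult.right_neutral mult_1)

lemma der_minus: "is_der d \<Longrightarrow> d (- x) = - d x"
  using der_add[of d x "- x"] der_0[of d] by (simp add: eq_neg_iff_add_eq_0 add.commute)

lemma der_sum: "is_der d \<Longrightarrow> d (sum f A) = (\<Sum>x\<in>A. d (f x))"
  by (induction A rule: infinite_finite_induct) (auto simp: der_0 der_add)

lemma der_inverse: "is_der d \<Longrightarrow> x \<noteq> 0 \<Longrightarrow> d (inverse x) = - d x * inverse x * inverse x"
  using der_mult[of d x "inverse x"] der_1[of d]
  by (simp add: field_simps eq_neg_iff_add_eq_0)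

lemma der_power: "is_der d \<Longrightarrow> d (x ^ n) = of_nat n * x ^ (n - 1) * d x"
proof (induction n)
  case (Suc n)
  then show ?case by (cases n) (auto simp: der_mult algebra_simps)
qed (simp add: der_1)

lemma der_comb: "is_der d \<Longrightarrow> is_der e \<Longrightarrow> is_der (\<lambda>x. d x + c * e x)"
  by (auto simp: is_der_def algebra_simps)

lemma der_scale: "is_der e \<Longrightarrow> is_der (\<lambda>x. c * e x)"
  by (auto simp: is_der_def algebra_simps)

lemma der_commutator:
  assumes d: "is_der d" and e: "is_der e"
  shows "is_der (\<lambda>x. d (e x) - e (d x))"
  unfolding is_der_def
  by (simp add: der_add[OF d] der_add[OF e] der_mult[OF d] der_mult[OF e] algebra_simps)

definition sring :: "'a::field set \<Rightarrow> bool" where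
  "sring A \<longleftrightarrow> 0 \<in> A \<and> 1 \<in> A \<and> (\<forall>x\<in>A. \<forall>y\<in>A. x + y \<in> A \<and> x * y \<in> A) \<and> (\<forall>x\<in>A. - x \<in> A)"

lemma sring_of_nat: "sring A \<Longrightarrow> of_nat n \<in> A"
  by (induction n) (auto simp: sring_def)

lemma sring_sum: "sring A \<Longrightarrow> (\<And>x. x \<in> I \<Longrightarrow> f x \<in> A) \<Longrightarrow> sum f I \<in> A"
  by (induction I rule: infinite_finite_induct) (auto simp: sring_def)

text \<open>Graphs of derivations: subrings of the ring of dual numbers.\<close>

definition dring :: "('a::field \<times> 'a) set \<Rightarrow> bool" where
  "dring G \<longleftrightarrow> (0, 0) \<in> G \<and> (1, 0) \<in> G \<and>
     (\<forall>x y x' y'. (x, y) \<in> G \<longrightarrow> (x', y') \<in> G \<longrightarrow>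
        (x + x', y + y') \<in> G \<and> (x * x', y * x' + x * y') \<in> G) \<and>
     (\<forall>x y. (x, y) \<in> G \<longrightarrow> (- x, - y) \<in> G)"

lemma dring_add: "dring G \<Longrightarrow> (x, y) \<in> G \<Longrightarrow> (x', y') \<in> G \<Longrightarrow> (x + x', y + y') \<in> G"
  and dring_mult: "dring G \<Longrightarrow> (x, y) \<in> G \<Longrightarrow> (x', y') \<in> G \<Longrightarrow> (x * x', y * x' + x * y') \<in> G"
  and dring_minus: "dring G \<Longrightarrow> (x, y) \<in> G \<Longrightarrow> (- x, - y) \<in> G"
  unfolding dring_def by blast+

definition dsv :: "('a::field \<times> 'a) set \<Rightarrow> bool" where
  "dsv G \<longleftrightarrow> (\<forall>y. (0, y) \<in> G \<longrightarrow> y = 0)"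

definition dpolys :: "('a::field \<times> 'a) set \<Rightarrow> ('a poly \<times> 'a poly) set" where
  "dpolys G = {(p, q). \<forall>n. (coeff p n, coeff q n) \<in> G}"

text \<open>The derivative of the value of \<open>p\<close> at \<open>z\<close> dictated by the
  Leibniz rule, when \<open>z\<close> has derivative \<open>y\<close> and \<open>q\<close> collects
  the derivatives of the coefficients of \<open>p\<close>.\<close>

definition dval :: "'a::field \<Rightarrow> 'a \<Rightarrow> 'a poly \<Rightarrow> 'a poly \<Rightarrow> 'a" where
  "dval z y p q = poly q z + poly (pderiv p) z * y"

definition dext :: "('a::field \<times> 'a) set \<Rightarrow> 'a \<Rightarrow> 'a \<Rightarrow> ('a \<times> 'a) set" where
  "dext G z y = {(poly p z, dval z y p q) |p q. (p, q) \<in> dpolys G}"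

lemma dval_add: "dval z y (p + p') (q + q') = dval z y p q + dval z y p' q'"
  by (simp add: dval_def pderiv_add algebra_simps)

lemma dval_minus: "dval z y (- p) (- q) = - dval z y p q"
  by (simp add: dval_def pderiv_minus)

lemma dval_mult:
  "dval z y (p * p') (q * p' + p * q') = dval z y p q * poly p' z + poly p z * dval z y p' q'"
  by (simp add: dval_def pderiv_mult algebra_simps)

lemma dring_sum:
  assumes "dring G" and "\<And>i. i \<in> I \<Longrightarrow> (f i, g i) \<in> G"
  shows "(sum f I, sum g I) \<in> G"
  using assms(2) by (induction I rule: infinite_finite_induct) (use assms(1) in \<open>auto simp: dring_def\<close>)

lemma dring_of_nat: "dring G \<Longrightarrow> (of_nat n, 0) \<in> G"
  by (induction n) (auto simp: dring_def, metis add.right_neutral)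

lemma dpolys_add:
  "dring G \<Longrightarrow> (p, q) \<in> dpolys G \<Longrightarrow> (p', q') \<in> dpolys G \<Longrightarrow> (p + p', q + q') \<in> dpolys G"
  by (auto simp: dpolys_def dring_def)

lemma dpolys_minus: "dring G \<Longrightarrow> (p, q) \<in> dpolys G \<Longrightarrow> (- p, - q) \<in> dpolys G"
  by (auto simp: dpolys_def dring_def)

lemma dpolys_mult:
  assumes "dring G" "(p, q) \<in> dpolys G" "(p', q') \<in> dpolys G"
  shows "(p * p', q * p' + p * q') \<in> dpolys G"
proof -
  have "(coeff (p * p') n, coeff (q * p' + p * q') n) \<in> G" for n
    unfolding coeff_mult coeff_add sum.distrib[symmetric]
    by (rule dring_sum[OF assms(1)]) (use assms in \<open>auto simp: dring_def dpolys_def\<close>)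
  then show ?thesis by (simp add: dpolys_def)
qed

lemma dpolys_const: "dring G \<Longrightarrow> (x, y) \<in> G \<Longrightarrow> ([:x:], [:y:]) \<in> dpolys G"
  by (auto simp: dpolys_def dring_def coeff_pCons split: nat.split)

lemma dpolys_monom: "dring G \<Longrightarrow> (x, y) \<in> G \<Longrightarrow> (monom x n, monom y n) \<in> dpolys G"
  by (auto simp: dpolys_def dring_def)

lemma dpolys_pderiv:
  assumes "dring G" "(p, q) \<in> dpolys G"
  shows "(pderiv p, pderiv q) \<in> dpolys G"
proof -
  have "(of_nat (Suc n) * coeff p (Suc n), 0 * coeff p (Suc n) + of_nat (Suc n) * coeff q (Suc n)) \<in> G" for n
  proof -
    have "(coeff p (Suc n), coeff q (Suc n)) \<in> G" using assms(2) by (simp add: dpolys_def)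
    with dring_of_nat[OF assms(1), of "Suc n"] show ?thesis
      using assms(1) unfolding dring_def by blast
  qed
  then show ?thesis by (simp add: dpolys_def coeff_pderiv)
qed

lemma dext_dring:
  assumes G: "dring G"
  shows "dring (dext G z y)"
proof -
  have "(0, 0) \<in> dext G z y" using dpolys_const[OF G, of 0 0] G
    by (force simp: dext_def dring_def dval_def)
  moreover have "(1, 0) \<in> dext G z y" using dpolys_const[OF G, of 1 0] G
    by (force simp: dext_def dring_def dval_def)
  moreover have "(x + x', w + w') \<in> dext G z y" if "(x, w) \<in> dext G z y" "(x', w') \<in> dext G z y" for x w x' w'
    using that dpolys_add[OF G] by (fastforce simp: dext_def dval_add[symmetric] simp flip: poly_add)
  moreover have "(x * x', w * x' + x * w') \<in> dext G z y"
    if "(x, w) \<in> dext G z y" "(x', w') \<in> dext G z y" for x w x' w'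
    using that dpolys_mult[OF G] by (fastforce simp: dext_def dval_mult[symmetric] simp flip: poly_mult)
  moreover have "(- x, - w) \<in> dext G z y" if "(x, w) \<in> dext G z y" for x w
    using that dpolys_minus[OF G] by (fastforce simp: dext_def dval_minus[symmetric] simp flip: poly_minus)
  ultimately show ?thesis unfolding dring_def by blast
qed

lemma dext_sub: "dring G \<Longrightarrow> G \<subseteq> dext G z y"
  using dpolys_const by (force simp: dext_def dval_def)

lemma dext_elem: 
  assumes "dring G"
  shows "(z, y) \<in> dext G z y"
proof -
  have "(monom 1 1, monom 0 1) \<in> dpolys G" using dpolys_monom[OF assms, of 0 1 1] dpolys_monom[OF assms, of 1 0 1] assms by (simp add: dring_def)
  moreover have "poly (monom 1 1) z = z" "dval z y (monom 1 1) (monom 0 1) = y"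
    by (auto simp: dval_def poly_monom pderiv_monom)
  ultimately show ?thesis unfolding dext_def by force
qed

lemma dext_dsv_trans:
  assumes G: "dring G" "dsv G"
    and tr: "\<And>p q. (p, q) \<in> dpolys G \<Longrightarrow> poly p z = 0 \<Longrightarrow> p = 0"
  shows "dsv (dext G z y)"
proof -
  have "dval z y p q = 0" if "(p, q) \<in> dpolys G" "poly p z = 0" for p q
  proof -
    have "p = 0" using tr that by blast
    then have "coeff q n = 0" for n using that(1) G(2) by (auto simp: dpolys_def dsv_def)
    then have "q = 0" by (simp add: poly_eq_iff)
    then show ?thesis using \<open>p = 0\<close> by (simp add: dval_def)
  qed
  then show ?thesis by (auto simp: dsv_def dext_def)
qed

lemma pderiv_ne_0:
  fixes f :: "'a::field_char_0 poly"
  assumes "f \<noteq> 0" "poly f z = 0"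
  shows "pderiv f \<noteq> 0" and "degree (pderiv f) < degree f"
proof -
  have "degree f \<noteq> 0"
  proof
    assume "degree f = 0"
    then obtain a where "f = [:a:]" by (rule degree_eq_zeroE)
    then show False using assms by simp
  qed
  then show "pderiv f \<noteq> 0" "degree (pderiv f) < degree f"
    by (simp_all add: pderiv_eq_0_iff degree_pderiv)
qed

text \<open>The derivative of \<open>z\<close> is dictated by a nonzero polynomial \<open>f\<close>
  of least degree with root \<open>z\<close>; in characteristic zero its derivative does not vanish
  at \<open>z\<close>, by minimality. Any other polynomial with root \<open>z\<close> is brought
  below the degree of \<open>f\<close>, hence to zero, by division steps.\<close>

lemma dext_dsv_alg:
  fixes G :: "('a::field_char_0 \<times> 'a) set"
  assumes G: "dring G" "dsv G"
    and alg: "(p0, q0) \<in> dpolys G" "poly p0 z = 0" "p0 \<noteq> 0"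
  shows "\<exists>y. dsv (dext G z y)"
proof -
  let ?P = "\<lambda>(p, q). (p, q) \<in> dpolys G \<and> poly p z = 0 \<and> p \<noteq> 0"
  define fg where "fg = arg_min (\<lambda>(p, q). degree p) ?P"
  obtain f g where fg': "fg = (f, g)" by (cases fg)
  have "?P (p0, q0)" using alg by simp
  from arg_min_natI[of ?P, OF this, of "\<lambda>(p, q). degree p"]
  have fg: "(f, g) \<in> dpolys G" "poly f z = 0" "f \<noteq> 0" using fg' by (auto simp: fg_def)
  have min: "degree f \<le> degree p" if "(p, q) \<in> dpolys G" "poly p z = 0" "p \<noteq> 0" for p q
    using arg_min_nat_le[of ?P "(p, q)" "\<lambda>(p, q). degree p"] that fg' by (auto simp: fg_def)
  have sep: "poly (pderiv f) z \<noteq> 0"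
    using min[OF dpolys_pderiv[OF G(1) fg(1)]] pderiv_ne_0[OF fg(3,2)] by auto
  define y where "y = - poly g z / poly (pderiv f) z"
  have f0: "dval z y f g = 0" using sep by (simp add: dval_def y_def)
  have "dval z y p q = 0" if "(p, q) \<in> dpolys G" "poly p z = 0" for p q
    using that
  proof (induction "degree p" arbitrary: p q rule: less_induct)
    case less
    show ?case
    proof (cases "p = 0")
      case True
      then have "coeff q n = 0" for n using less.prems(1) G(2) by (auto simp: dpolys_def dsv_def)
      then have "q = 0" by (simp add: poly_eq_iff)
      then show ?thesis using True by (simp add: dval_def)
    next
      case False
      let ?n = "degree p" and ?k = "degree f"
      have le: "?k \<le> ?n" using min[OF less.prems False] .
      define c c' where "c = coeff f ?k" and "c' = coeff g ?k"
      define m m' where "m = monom (coeff p ?n) (?n - ?k)" and "m' = monom (coeff q ?n) (?n - ?k)"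
      \<comment> \<open>One step of pseudo-division by \<open>f\<close>, since leading coefficients
        need not be invertible in the ring. It is carried out for pairs, so that \<open>q1\<close>
        records the derivatives of the coefficients of \<open>p1\<close>.\<close>
      define p1 q1 where "p1 = [:c:] * p + - (m * f)"
        and "q1 = ([:c':] * p + [:c:] * q) + - (m' * f + m * g)"
      have c: "([:c:], [:c':]) \<in> dpolys G"
        using fg(1) unfolding c_def c'_def by (intro dpolys_const[OF G(1)]) (auto simp: dpolys_def)
      have m: "(m, m') \<in> dpolys G"
        using less.prems(1) unfolding m_def m'_def by (intro dpolys_monom[OF G(1)]) (auto simp: dpolys_def)
      have mem: "(p1, q1) \<in> dpolys G" unfolding p1_def q1_def
        by (intro dpolys_add dpolys_minus dpolys_mult G c m fg less.prems)
      have root: "poly p1 z = 0" using less.prems fg by (simp add: p1_def)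
      have c0: "c \<noteq> 0" using fg by (simp add: c_def)
      have "dval z y p1 q1 = 0"
      proof (cases "p1 = 0")
        case True
        then have "coeff q1 n = 0" for n using mem G(2) by (auto simp: dpolys_def dsv_def)
        then have "q1 = 0" by (simp add: poly_eq_iff)
        then show ?thesis using True by (simp add: dval_def)
      next
        case p1: False
        have dm: "degree m \<le> ?n - ?k" unfolding m_def by (rule degree_monom_le)
        have "degree (m * f) \<le> ?n" using degree_mult_le[of m f] dm le by linarith
        then have "degree p1 \<le> ?n" unfolding p1_def by (intro degree_add_le) auto
        moreover have "coeff p1 ?n = 0"
        proof -
          have "coeff (m * f) ?n = coeff p ?n * coeff f ?k"
            unfolding m_def using le coeff_monom_mult[of "coeff p ?n" "?n - ?k" f ?n] by simp
          then show ?thesis by (simp add: p1_def c_def)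
        qed
        ultimately have "degree p1 < degree p" using p1 eq_zero_or_degree_less by blast
        then show ?thesis using less.hyps mem root by blast
      qed
      moreover have "dval z y p1 q1 = c * dval z y p q"
        unfolding p1_def q1_def dval_add dval_minus dval_mult
        using less.prems(2) fg(2) f0 by (simp add: dval_def[of z y "[:c:]"])
      ultimately show ?thesis using c0 by simp
    qed
  qed
  then show ?thesis by (auto simp: dsv_def dext_def)
qed

text \<open>Zorn's lemma for graphs: by the two extension lemmas a further element, transcendental
  or algebraic over the domain, can always be adjoined, so a maximal single-valued graph is
  total.\<close>

theorem derivation_extension:
  fixes G0 :: "('a::field_char_0 \<times> 'a) set"
  assumes G0: "dring G0" "dsv G0"
  shows "\<exists>d. is_der d \<and> (\<forall>(x, y)\<in>G0. d x = y)"
proof -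
  let ?S = "{G. dring G \<and> dsv G \<and> G0 \<subseteq> G}"
  have "\<exists>M\<in>?S. \<forall>Y\<in>?S. M \<subseteq> Y \<longrightarrow> Y = M"
  proof (rule subset_Zorn_nonempty)
    show "?S \<noteq> {}" using G0 by auto
    fix C assume C: "C \<noteq> {}" "subset.chain ?S C"
    have two: "\<exists>G\<in>C. a \<in> G \<and> b \<in> G" if ab: "a \<in> \<Union>C" "b \<in> \<Union>C" for a b
    proof -
      obtain G1 G2 where G12: "G1 \<in> C" "a \<in> G1" "G2 \<in> C" "b \<in> G2" using ab by blast
      then have "G1 \<subseteq> G2 \<or> G2 \<subseteq> G1" using C(2) unfolding subset_chain_def by blast
      then show ?thesis using G12 by blast
    qed
    have CD: "dring G" "dsv G" "G0 \<subseteq> G" if "G \<in> C" for G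
      using that C(2) by (auto simp: subset_chain_def)
    have "dring (\<Union>C)"
      unfolding dring_def
    proof (intro conjI allI impI)
      show "(0, 0) \<in> \<Union>C" "(1, 0) \<in> \<Union>C" using C(1) CD(1) by (auto simp: dring_def)
      fix x y x' y' assume "(x, y) \<in> \<Union>C" "(x', y') \<in> \<Union>C"
      then obtain G where "G \<in> C" "(x, y) \<in> G" "(x', y') \<in> G" using two by blast
      then show "(x + x', y + y') \<in> \<Union>C" "(x * x', y * x' + x * y') \<in> \<Union>C"
        using CD(1)[of G] dring_add dring_mult by blast+
    next
      fix x y assume "(x, y) \<in> \<Union>C"
      then show "(- x, - y) \<in> \<Union>C" using CD(1) dring_minus by blast
    qed
    moreover have "dsv (\<Union>C)" using CD(2) by (auto simp: dsv_def)
    moreover have "G0 \<subseteq> \<Union>C" using C(1) CD(3) by blast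
    ultimately show "\<Union>C \<in> ?S" by simp
  qed
  then obtain G where "G \<in> ?S" and max': "\<forall>Y\<in>?S. G \<subseteq> Y \<longrightarrow> Y = G" by (rule bexE)
  then have G: "dring G" "dsv G" "G0 \<subseteq> G" by auto
  have max: "Y = G" if "dring Y" "dsv Y" "G \<subseteq> Y" for Y
    using max'[rule_format, of Y] G(3) that by simp
  have total: "\<exists>y. (z, y) \<in> G" for z
  proof -
    obtain y where "dsv (dext G z y)"
    proof (cases "\<exists>p q. (p, q) \<in> dpolys G \<and> poly p z = 0 \<and> p \<noteq> 0")
      case True
      then show ?thesis using dext_dsv_alg[OF G(1,2)] that by blast
    next
      case False
      then show ?thesis using dext_dsv_trans[OF G(1,2), of z 0] that by blast
    qed
    then have "dext G z y = G" using max dext_dring[OF G(1)] dext_sub[OF G(1)] by blast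
    then show ?thesis using dext_elem[OF G(1), of z y] by auto
  qed
  define d where "d z = (SOME y. (z, y) \<in> G)" for z
  have dG: "(z, d z) \<in> G" for z unfolding d_def by (rule someI_ex) (rule total)
  have uniq: "y = y'" if "(z, y) \<in> G" "(z, y') \<in> G" for z y y'
  proof -
    have "(z + - z, y + - y') \<in> G" using dring_add dring_minus G(1) that by blast
    then have "y - y' = 0" using G(2) unfolding dsv_def
      by (simp only: right_minus diff_conv_add_uminus[symmetric])
    then show ?thesis by simp
  qed
  have "is_der d" unfolding is_der_def
  proof (intro conjI allI)
    fix x y
    show "d (x + y) = d x + d y" by (rule uniq[OF dG dring_add[OF G(1) dG dG]])
    show "d (x * y) = d x * y + x * d y" by (rule uniq[OF dG dring_mult[OF G(1) dG dG]])
  qed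
  moreover have "\<forall>(x, y)\<in>G0. d x = y" using uniq dG G(3) by blast
  ultimately show ?thesis by blast
qed

definition algebraic_over :: "'a::field set \<Rightarrow> 'a \<Rightarrow> bool" where
  "algebraic_over A z \<longleftrightarrow> (\<exists>p. p \<noteq> 0 \<and> (\<forall>n. coeff p n \<in> A) \<and> poly p z = 0)"

lemma not_algebraic_derivation:
  fixes z :: "'a::field_char_0"
  assumes A: "sring A" and z: "\<not> algebraic_over A z"
  shows "\<exists>d. is_der d \<and> (\<forall>a\<in>A. d a = 0) \<and> d z = 1"
proof -
  let ?G = "(\<lambda>a. (a, 0)) ` A"
  have G: "dring ?G" "dsv ?G" using A by (auto simp: dring_def sring_def dsv_def image_iff)
  have "dsv (dext ?G z 1)"
    by (rule dext_dsv_trans[OF G]) (use z in \<open>force simp: dpolys_def algebraic_over_def\<close>)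
  from derivation_extension[OF dext_dring[OF G(1)] this]
  obtain d where d: "is_der d" "\<And>x y. (x, y) \<in> dext ?G z 1 \<Longrightarrow> d x = y" by force
  have "d z = 1" using d(2) dext_elem[OF G(1)] by blast
  moreover have "d a = 0" if "a \<in> A" for a using d(2) dext_sub[OF G(1)] that by blast
  ultimately show ?thesis using d(1) by blast
qed

lemma algebraic_separable:
  fixes z :: "'a::field_char_0"
  assumes A: "sring A" and z: "algebraic_over A z"
  shows "\<exists>p. (\<forall>n. coeff p n \<in> A) \<and> poly p z = 0 \<and> poly (pderiv p) z \<noteq> 0"
proof -
  let ?P = "\<lambda>p. p \<noteq> 0 \<and> (\<forall>n. coeff p n \<in> A) \<and> poly p z = 0"
  define p where "p = arg_min degree ?P"
  obtain p0 where "?P p0" using z by (auto simp: algebraic_over_def)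
  from arg_min_natI[of ?P, OF this, of degree]
  have p: "p \<noteq> 0" "\<And>n. coeff p n \<in> A" "poly p z = 0" by (auto simp: p_def)
  have min: "degree p \<le> degree q" if "?P q" for q
    unfolding p_def by (rule arg_min_nat_le) (use that in auto)
  have "coeff (pderiv p) n \<in> A" for n
    using A p(2) sring_of_nat[OF A, of "Suc n"] unfolding coeff_pderiv by (auto simp: sring_def)
  then have "poly (pderiv p) z \<noteq> 0"
    using min[of "pderiv p"] pderiv_ne_0[OF p(1,3)] by auto
  then show ?thesis using p by blast
qed

lemma der_poly: "is_der d \<Longrightarrow> d (poly p z) = poly (map_poly d p) z + poly (pderiv p) z * d z"
  by (induction p) (auto simp: der_0 der_add der_mult map_poly_pCons pderiv_pCons algebra_simps)

lemma algebraic_derivation: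
  fixes z :: "'a::field_char_0"
  assumes A: "sring A" and z: "algebraic_over A z" and d: "is_der d" "\<And>a. a \<in> A \<Longrightarrow> d a = 0"
  shows "d z = 0"
proof -
  obtain p where p: "\<And>n. coeff p n \<in> A" "poly p z = 0" "poly (pderiv p) z \<noteq> 0"
    using algebraic_separable[OF A z] by blast
  have "map_poly d p = 0" by (simp add: poly_eq_iff coeff_map_poly der_0 d p(1))
  then show ?thesis using der_poly[OF d(1), of p z] p by (simp add: der_0 d)
qed

subsection \<open>Closure and dimension\<close>

text \<open>In characteristic zero this is the relative algebraic closure of the field generated by
  \<open>A\<close> (\<open>dcl_algebraic\<close>); it is not the definable closure of model
  theory.\<close>

definition dcl :: "'a::field set \<Rightarrow> 'a set" where
  "dcl A = {x. \<forall>d. is_der d \<longrightarrow> (\<forall>a\<in>A. d a = 0) \<longrightarrow> d x = 0}"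

lemma dcl_superset: "A \<subseteq> dcl A"
  by (auto simp: dcl_def)

lemma dcl_mono: "A \<subseteq> B \<Longrightarrow> dcl A \<subseteq> dcl B"
  by (auto simp: dcl_def)

lemma dcl_minimal:
  assumes "A \<subseteq> dcl B"
  shows "dcl A \<subseteq> dcl B"
proof
  fix x assume x: "x \<in> dcl A"
  have "d x = 0" if d: "is_der d" "\<forall>b\<in>B. d b = 0" for d
  proof -
    have "\<forall>a\<in>A. d a = 0" using assms d by (auto simp: dcl_def)
    then show ?thesis using x d by (auto simp: dcl_def)
  qed
  then show "x \<in> dcl B" by (auto simp: dcl_def)
qed

lemma not_dclD:
  assumes "x \<notin> dcl A"
  shows "\<exists>d. is_der d \<and> (\<forall>a\<in>A. d a = 0) \<and> d x = 1"
proof -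
  obtain d where d: "is_der d" "\<forall>a\<in>A. d a = 0" "d x \<noteq> 0" using assms by (auto simp: dcl_def)
  show ?thesis
    by (rule exI[of _ "\<lambda>y. inverse (d x) * d y"]) (use d der_scale[of d "inverse (d x)"] in auto)
qed

text \<open>A derivation \<open>e\<close> with \<open>e x = 1\<close> that kills \<open>A\<close>
  cannot kill \<open>y\<close>. If \<open>d\<close> kills \<open>x\<close> and \<open>A\<close>,
  then \<open>d\<close> minus a multiple of \<open>e\<close> kills \<open>y\<close> and
  \<open>A\<close>, hence \<open>x\<close>; so the multiple is zero and
  \<open>d y = 0\<close>.\<close>

lemma dcl_exchange:
  assumes "x \<in> dcl (insert y A)" "x \<notin> dcl A"
  shows "y \<in> dcl (insert x A)"
proof -
  obtain e where e: "is_der e" "\<forall>a\<in>A. e a = 0" "e x = 1" using not_dclD[OF assms(2)] by blast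
  have ey: "e y \<noteq> 0"
  proof
    assume "e y = 0"
    then have "e x = 0" using e assms(1) by (auto simp: dcl_def)
    then show False using e by simp
  qed
  have "d y = 0" if d: "is_der d" "\<forall>a\<in>insert x A. d a = 0" for d
  proof -
    let ?d = "\<lambda>z. d z + (- (d y / e y)) * e z"
    have "is_der ?d" by (rule der_comb[OF d(1) e(1)])
    moreover have "\<forall>a\<in>insert y A. ?d a = 0" using d e ey by auto
    ultimately have "?d x = 0" using assms(1) unfolding dcl_def by blast
    then show ?thesis using d e ey by simp
  qed
  then show ?thesis by (auto simp: dcl_def)
qed

definition dindep :: "'a::field set \<Rightarrow> 'a set \<Rightarrow> bool" where
  "dindep k B \<longleftrightarrow> (\<forall>b\<in>B. b \<notin> dcl (k \<union> (B - {b})))"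

lemma dindep_subset: "dindep k B \<Longrightarrow> A \<subseteq> B \<Longrightarrow> dindep k A"
  unfolding dindep_def by (meson Diff_mono Un_mono dcl_mono order_refl subsetD)

lemma dindep_insert:
  assumes "dindep k B" "x \<notin> dcl (k \<union> B)"
  shows "dindep k (insert x B)"
  unfolding dindep_def
proof
  fix b assume b: "b \<in> insert x B"
  have x: "x \<notin> B" using assms(2) dcl_superset by blast
  show "b \<notin> dcl (k \<union> (insert x B - {b}))"
  proof (cases "b = x")
    case True
    then show ?thesis using assms(2) x by simp
  next
    case False
    then have bB: "b \<in> B" using b by simp
    have eq: "k \<union> (insert x B - {b}) = insert x (k \<union> (B - {b}))" using False by auto
    show ?thesis
    proof
      assume "b \<in> dcl (k \<union> (insert x B - {b}))"
      then have "b \<in> dcl (insert x (k \<union> (B - {b})))" unfolding eq .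
      moreover have "b \<notin> dcl (k \<union> (B - {b}))" using assms(1) bB unfolding dindep_def by blast
      ultimately have "x \<in> dcl (insert b (k \<union> (B - {b})))" by (rule dcl_exchange)
      also have "insert b (k \<union> (B - {b})) = k \<union> B" using bB by auto
      finally show False using assms(2) by simp
    qed
  qed
qed

text \<open>Steinitz exchange: an element of \<open>B\<close> outside \<open>N\<close> is replaced
  by an element of \<open>N\<close> not spanned by the rest of \<open>B\<close>, which brings
  \<open>B\<close> closer to \<open>N\<close> without changing its size.\<close>

lemma dindep_card_le_finite:
  assumes "finite N" "finite B" "dindep k B" "B \<subseteq> dcl (k \<union> N)"
  shows "card B \<le> card N"
  using assms(2-4)
proof (induction "card (B - N)" arbitrary: B)
  case 0
  then have "B \<subseteq> N" by simp
  then show ?case using assms(1) card_mono by blast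
next
  case (Suc n)
  have "B - N \<noteq> {}" using Suc.hyps(2) by (metis card.empty nat.distinct(1))
  then obtain b where b: "b \<in> B" "b \<notin> N" by blast
  have "\<not> N \<subseteq> dcl (k \<union> (B - {b}))"
  proof
    assume "N \<subseteq> dcl (k \<union> (B - {b}))"
    moreover have "k \<subseteq> dcl (k \<union> (B - {b}))"
      by (rule order_trans[OF Un_upper1 dcl_superset])
    ultimately have "k \<union> N \<subseteq> dcl (k \<union> (B - {b}))" by simp
    from dcl_minimal[OF this] have "b \<in> dcl (k \<union> (B - {b}))" using b Suc.prems(3) by blast
    then show False using Suc.prems(2) b unfolding dindep_def by blast
  qed
  then obtain x where x: "x \<in> N" "x \<notin> dcl (k \<union> (B - {b}))" by blast
  let ?B = "insert x (B - {b})"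
  have xB: "x \<notin> B - {b}" using x(2) dcl_superset[of "k \<union> (B - {b})"] by blast
  have "?B - N = (B - N) - {b}" using x by auto
  then have "n = card (?B - N)" using Suc.hyps(2) Suc.prems(1) b by simp
  moreover have "dindep k ?B"
    by (rule dindep_insert[OF dindep_subset[OF Suc.prems(2)] x(2)]) auto
  moreover have "?B \<subseteq> dcl (k \<union> N)" using x(1) Suc.prems(3) dcl_superset[of "k \<union> N"] by blast
  ultimately have "card ?B \<le> card N" using Suc.hyps(1)[of ?B] Suc.prems(1) by simp
  moreover have "card ?B = card B" 
    using card_Suc_Diff1[OF Suc.prems(1) b(1)] card_insert_disjoint[OF _ xB] Suc.prems(1) by simp
  ultimately show ?case by simp
qed

lemma dindep_card_le:
  assumes "finite N" "dindep k B" "B \<subseteq> dcl (k \<union> N)"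
  shows "finite B" "card B \<le> card N"
proof -
  show "finite B"
  proof (rule ccontr)
    assume "infinite B"
    then obtain C where C: "C \<subseteq> B" "finite C" "card C = Suc (card N)"
      using infinite_arbitrarily_large by blast
    have "card C \<le> card N"
      by (rule dindep_card_le_finite[OF assms(1) C(2) dindep_subset[OF assms(2) C(1)]])
        (use C(1) assms(3) in blast)
    then show False using C by simp
  qed
  then show "card B \<le> card N" using dindep_card_le_finite[OF assms(1) _ assms(2,3)] by blast
qed

section \<open>Generated subrings and evaluation of polynomials\<close>

text \<open>A subring of a product, read as a relation. Generated by the constants and by pairs
  \<open>(f v, g v)\<close>, it consists of the simultaneous values of polynomials at
  \<open>f\<close> and \<open>g\<close>; that \<open>g\<close> is a specialization of
  \<open>f\<close> means that 0 is related to 0 alone.\<close>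

inductive_set pgen :: "('b::comm_ring_1 \<times> 'c::comm_ring_1) set \<Rightarrow> ('b \<times> 'c) set" for S where
  pgen_base: "x \<in> S \<Longrightarrow> x \<in> pgen S"
| pgen_one: "(1, 1) \<in> pgen S"
| pgen_add: "(x, y) \<in> pgen S \<Longrightarrow> (x', y') \<in> pgen S \<Longrightarrow> (x + x', y + y') \<in> pgen S"
| pgen_mult: "(x, y) \<in> pgen S \<Longrightarrow> (x', y') \<in> pgen S \<Longrightarrow> (x * x', y * y') \<in> pgen S"
| pgen_minus: "(x, y) \<in> pgen S \<Longrightarrow> (- x, - y) \<in> pgen S"

lemma pgen_zero: "(0, 0) \<in> pgen S"
  using pgen_add[OF pgen_one pgen_minus[OF pgen_one], of S] by simp

lemma pgen_diff: "(x, y) \<in> pgen S \<Longrightarrow> (x', y') \<in> pgen S \<Longrightarrow> (x - x', y - y') \<in> pgen S"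
  using pgen_add[OF _ pgen_minus, of x y S x' y'] by simp

lemma pgen_power: "(x, y) \<in> pgen S \<Longrightarrow> (x ^ n, y ^ n) \<in> pgen S"
  by (induction n) (auto intro: pgen_one pgen_mult)

lemma pgen_sum: "(\<And>i. i \<in> I \<Longrightarrow> (f i, g i) \<in> pgen S) \<Longrightarrow> (sum f I, sum g I) \<in> pgen S"
  by (induction I rule: infinite_finite_induct) (auto intro: pgen_zero pgen_add)

lemma pgen_prod: "(\<And>i. i \<in> I \<Longrightarrow> (f i, g i) \<in> pgen S) \<Longrightarrow> (prod f I, prod g I) \<in> pgen S"
  by (induction I rule: infinite_finite_induct) (auto intro: pgen_one pgen_mult)

lemma pgen_mono: "S \<subseteq> T \<Longrightarrow> pgen S \<subseteq> pgen T"
proof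
  fix x assume "S \<subseteq> T" "x \<in> pgen S"
  from this(2,1) show "x \<in> pgen T" by induction (auto intro: pgen.intros)
qed

definition monv :: "('v \<Rightarrow> 'a) \<Rightarrow> ('v \<Rightarrow>\<^sub>0 nat) \<Rightarrow> 'a::comm_semiring_1" where
  "monv f \<mu> = (\<Prod>v\<in>Poly_Mapping.keys \<mu>. f v ^ Poly_Mapping.lookup \<mu> v)"

lemma monv_superset:
  "finite S \<Longrightarrow> Poly_Mapping.keys \<mu> \<subseteq> S \<Longrightarrow> monv f \<mu> = (\<Prod>v\<in>S. f v ^ Poly_Mapping.lookup \<mu> v)"
  unfolding monv_def by (rule prod.mono_neutral_left) (auto simp: in_keys_iff)

lemma monv_0 [simp]: "monv f 0 = 1"
  by (simp add: monv_def)

lemma monv_single [simp]: "monv f (Poly_Mapping.single v n) = f v ^ n"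
  by (simp add: monv_def)

lemma monv_add: "monv f (\<mu> + \<nu>) = monv f \<mu> * monv f \<nu>"
proof -
  let ?S = "Poly_Mapping.keys \<mu> \<union> Poly_Mapping.keys \<nu>"
  have "monv f (\<mu> + \<nu>) = (\<Prod>v\<in>?S. f v ^ Poly_Mapping.lookup (\<mu> + \<nu>) v)"
    by (rule monv_superset) (use keys_add[of \<mu> \<nu>] in auto)
  also have "\<dots> = (\<Prod>v\<in>?S. f v ^ Poly_Mapping.lookup \<mu> v) * (\<Prod>v\<in>?S. f v ^ Poly_Mapping.lookup \<nu> v)"
    by (simp add: lookup_add power_add prod.distrib)
  also have "\<dots> = monv f \<mu> * monv f \<nu>"
    by (simp add: monv_superset[of ?S])
  finally show ?thesis .
qed

lemma mp_eval_monv: "mp_eval f p = (\<Sum>\<mu>\<in>Poly_Mapping.keys p. Poly_Mapping.lookup p \<mu> * monv f \<mu>)"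
  by (simp add: mp_eval_def monv_def)

lemma mp_eval_superset:
  "finite S \<Longrightarrow> Poly_Mapping.keys p \<subseteq> S \<Longrightarrow> mp_eval f p = (\<Sum>\<mu>\<in>S. Poly_Mapping.lookup p \<mu> * monv f \<mu>)"
  unfolding mp_eval_monv by (rule sum.mono_neutral_left) (auto simp: in_keys_iff)

lemma mp_eval_single [simp]: "mp_eval f (Poly_Mapping.single \<mu> c) = c * monv f \<mu>"
  by (simp add: mp_eval_monv)

lemma mp_eval_0 [simp]: "mp_eval f 0 = 0"
  by (simp add: mp_eval_monv)

lemma mp_eval_add: "mp_eval f (p + q) = mp_eval f p + mp_eval f q"
proof -
  let ?S = "Poly_Mapping.keys p \<union> Poly_Mapping.keys q"
  have "mp_eval f (p + q) = (\<Sum>\<mu>\<in>?S. Poly_Mapping.lookup (p + q) \<mu> * monv f \<mu>)"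
    by (rule mp_eval_superset) (use keys_add[of p q] in auto)
  also have "\<dots> = (\<Sum>\<mu>\<in>?S. Poly_Mapping.lookup p \<mu> * monv f \<mu>) + (\<Sum>\<mu>\<in>?S. Poly_Mapping.lookup q \<mu> * monv f \<mu>)"
    by (simp add: lookup_add algebra_simps sum.distrib)
  also have "\<dots> = mp_eval f p + mp_eval f q"
    by (simp add: mp_eval_superset[of ?S])
  finally show ?thesis .
qed

lemma mp_eval_sum: "mp_eval f (sum g I) = (\<Sum>i\<in>I. mp_eval f (g i))"
  by (induction I rule: infinite_finite_induct) (auto simp: mp_eval_add)

lemma mp_decomp: "p = (\<Sum>\<mu>\<in>Poly_Mapping.keys p. Poly_Mapping.single \<mu> (Poly_Mapping.lookup p \<mu>))"
proof (rule poly_mapping_eqI)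
  fix \<nu>
  have "(\<Sum>\<mu>\<in>Poly_Mapping.keys p. Poly_Mapping.lookup (Poly_Mapping.single \<mu> (Poly_Mapping.lookup p \<mu>)) \<nu>)
      = (\<Sum>\<mu>\<in>Poly_Mapping.keys p. if \<mu> = \<nu> then Poly_Mapping.lookup p \<nu> else 0)"
    by (rule sum.cong) (auto simp: lookup_single)
  then show "Poly_Mapping.lookup p \<nu> =
      Poly_Mapping.lookup (\<Sum>\<mu>\<in>Poly_Mapping.keys p. Poly_Mapping.single \<mu> (Poly_Mapping.lookup p \<mu>)) \<nu>"
    by (simp add: lookup_sum in_keys_iff)
qed

lemma mp_mult_decomp:
  "p * q = (\<Sum>\<mu>\<in>Poly_Mapping.keys p. \<Sum>\<nu>\<in>Poly_Mapping.keys q.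
     Poly_Mapping.single (\<mu> + \<nu>) (Poly_Mapping.lookup p \<mu> * Poly_Mapping.lookup q \<nu>))"
  by (rule trans[OF arg_cong2[where f = "(*)", OF mp_decomp mp_decomp]])
    (simp only: sum_product mult_single)

lemma mp_eval_mult: "mp_eval f (p * q) = mp_eval f p * mp_eval f q"
proof -
  have "mp_eval f (p * q) = (\<Sum>\<mu>\<in>Poly_Mapping.keys p. \<Sum>\<nu>\<in>Poly_Mapping.keys q.
     (Poly_Mapping.lookup p \<mu> * Poly_Mapping.lookup q \<nu>) * (monv f \<mu> * monv f \<nu>))"
    by (subst mp_mult_decomp) (simp only: mp_eval_sum mp_eval_single monv_add)
  also have "\<dots> = mp_eval f p * mp_eval f q"
    unfolding mp_eval_monv sum_product by (intro sum.cong refl) (simp add: mult_ac)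
  finally show ?thesis .
qed

definition mp_ring :: "'a::field set \<Rightarrow> 'v set \<Rightarrow> ('v, 'a) mpol set" where
  "mp_ring k A = {p. mp_over k p \<and> mp_vars p \<subseteq> A}"

lemma mp_ring_iff:
  "p \<in> mp_ring k A \<longleftrightarrow> (\<forall>\<mu>\<in>Poly_Mapping.keys p. Poly_Mapping.lookup p \<mu> \<in> k \<and> Poly_Mapping.keys \<mu> \<subseteq> A)"
  by (auto simp: mp_ring_def mp_over_def mp_vars_def)

lemma mp_ring_single: "c \<in> k \<Longrightarrow> Poly_Mapping.keys \<mu> \<subseteq> A \<Longrightarrow> Poly_Mapping.single \<mu> c \<in> mp_ring k A"
  by (auto simp: mp_ring_iff)

lemma mp_ring_add:
  assumes "sring k" "p \<in> mp_ring k A" "q \<in> mp_ring k A"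
  shows "p + q \<in> mp_ring k A"
proof -
  have l: "Poly_Mapping.lookup r \<mu> \<in> k" if "r \<in> mp_ring k A" for r \<mu>
    using that assms(1) by (cases "\<mu> \<in> Poly_Mapping.keys r") (auto simp: mp_ring_iff in_keys_iff sring_def)
  show ?thesis unfolding mp_ring_iff
  proof
    fix \<mu> assume "\<mu> \<in> Poly_Mapping.keys (p + q)"
    then have "\<mu> \<in> Poly_Mapping.keys p \<union> Poly_Mapping.keys q" using keys_add[of p q] by blast
    then have "Poly_Mapping.keys \<mu> \<subseteq> A" using assms(2,3) by (auto simp: mp_ring_iff)
    moreover have "Poly_Mapping.lookup (p + q) \<mu> \<in> k"
      using l[OF assms(2), of \<mu>] l[OF assms(3), of \<mu>] assms(1) by (simp add: lookup_add sring_def)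
    ultimately show "Poly_Mapping.lookup (p + q) \<mu> \<in> k \<and> Poly_Mapping.keys \<mu> \<subseteq> A" by simp
  qed
qed

lemma mp_ring_0: "0 \<in> mp_ring k A"
  by (simp add: mp_ring_iff)

lemma mp_ring_sum: "sring k \<Longrightarrow> (\<And>i. i \<in> I \<Longrightarrow> g i \<in> mp_ring k A) \<Longrightarrow> sum g I \<in> mp_ring k A"
  by (induction I rule: infinite_finite_induct) (simp_all add: mp_ring_0 mp_ring_add)

lemma mp_ring_mult:
  assumes "sring k" "p \<in> mp_ring k A" "q \<in> mp_ring k A"
  shows "p * q \<in> mp_ring k A"
  unfolding mp_mult_decomp
proof (intro mp_ring_sum mp_ring_single assms(1))
  fix \<mu> \<nu> assume *: "\<mu> \<in> Poly_Mapping.keys p" "\<nu> \<in> Poly_Mapping.keys q"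
  show "Poly_Mapping.lookup p \<mu> * Poly_Mapping.lookup q \<nu> \<in> k"
    using * assms by (auto simp: mp_ring_iff sring_def)
  show "Poly_Mapping.keys (\<mu> + \<nu>) \<subseteq> A"
  proof (rule order_trans[OF keys_add])
    show "Poly_Mapping.keys \<mu> \<union> Poly_Mapping.keys \<nu> \<subseteq> A"
      using * assms(2,3) by (auto simp: mp_ring_iff)
  qed
qed

theorem pgen_mp_eval:
  assumes k: "sring k"
  shows "(x, y) \<in> pgen ((\<lambda>a. (a, a)) ` k \<union> (\<lambda>v. (f v, g v)) ` A) \<longleftrightarrow>
    (\<exists>p\<in>mp_ring k A. x = mp_eval f p \<and> y = mp_eval g p)" (is "_ \<in> pgen ?S \<longleftrightarrow> _")
proof
  assume "(x, y) \<in> pgen ?S"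
  then show "\<exists>p\<in>mp_ring k A. x = mp_eval f p \<and> y = mp_eval g p"
  proof (induction "(x, y)" arbitrary: x y rule: pgen.induct)
    case pgen_base
    then consider a where "a \<in> k" "x = a" "y = a" | v where "v \<in> A" "x = f v" "y = g v" by blast
    then show ?case
    proof cases
      case 1
      then show ?thesis by (intro bexI[of _ "Poly_Mapping.single 0 a"]) (auto intro: mp_ring_single)
    next
      case 2
      then show ?thesis using k
        by (intro bexI[of _ "Poly_Mapping.single (Poly_Mapping.single v 1) 1"])
          (auto intro!: mp_ring_single simp: sring_def)
    qed
  next
    case pgen_one
    then show ?case using k
      by (intro bexI[of _ "Poly_Mapping.single 0 1"]) (auto intro!: mp_ring_single simp: sring_def simp del: single_one)
  next
    case (pgen_add x y x' y')
    then obtain p q where "p \<in> mp_ring k A" "x = mp_eval f p" "y = mp_eval g p"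
      "q \<in> mp_ring k A" "x' = mp_eval f q" "y' = mp_eval g q" by blast
    then show ?case
      by (intro bexI[of _ "p + q"]) (simp_all add: mp_eval_add mp_ring_add[OF k])
  next
    case (pgen_mult x y x' y')
    then obtain p q where "p \<in> mp_ring k A" "x = mp_eval f p" "y = mp_eval g p"
      "q \<in> mp_ring k A" "x' = mp_eval f q" "y' = mp_eval g q" by blast
    then show ?case
      by (intro bexI[of _ "p * q"]) (simp_all add: mp_eval_mult mp_ring_mult[OF k])
  next
    case (pgen_minus x y)
    then obtain p where p: "p \<in> mp_ring k A" "x = mp_eval f p" "y = mp_eval g p" by blast
    have "Poly_Mapping.single 0 (- 1) \<in> mp_ring k A"
      using k by (intro mp_ring_single) (auto simp: sring_def)
    from mp_ring_mult[OF k this p(1)] show ?case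
      by (rule bexI[rotated]) (use p in \<open>simp only: mp_eval_mult mp_eval_single, simp\<close>)
  qed
next
  assume "\<exists>p\<in>mp_ring k A. x = mp_eval f p \<and> y = mp_eval g p"
  then obtain p where p: "p \<in> mp_ring k A" and xy: "x = mp_eval f p" "y = mp_eval g p" by blast
  show "(x, y) \<in> pgen ?S"
    unfolding xy mp_eval_monv monv_def
    by (intro pgen_sum pgen_mult pgen_prod pgen_power) (use p in \<open>auto simp: mp_ring_iff intro!: pgen_base\<close>)
qed

inductive_set sgen :: "'a::field set \<Rightarrow> 'a set" for S where
  sgen_base: "x \<in> S \<Longrightarrow> x \<in> sgen S"
| sgen_one: "1 \<in> sgen S"
| sgen_add: "x \<in> sgen S \<Longrightarrow> x' \<in> sgen S \<Longrightarrow> x + x' \<in> sgen S"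
| sgen_mult: "x \<in> sgen S \<Longrightarrow> x' \<in> sgen S \<Longrightarrow> x * x' \<in> sgen S"
| sgen_minus: "x \<in> sgen S \<Longrightarrow> - x \<in> sgen S"

lemma sring_sgen: "sring (sgen S)"
proof -
  have "1 + - 1 \<in> sgen S" by (intro sgen_add sgen_minus sgen_one)
  then have "0 \<in> sgen S" by simp
  then show ?thesis by (auto simp: sring_def intro: sgen.intros)
qed

lemma sgen_mono: "S \<subseteq> T \<Longrightarrow> sgen S \<subseteq> sgen T"
proof
  fix x assume "S \<subseteq> T" "x \<in> sgen S"
  from this(2,1) show "x \<in> sgen T" by induction (auto intro: sgen.intros)
qed

lemma der_sgen:
  assumes d: "is_der d" "\<And>a. a \<in> S \<Longrightarrow> d a = 0" and x: "x \<in> sgen S"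
  shows "d x = 0"
  using x by induction (auto simp: d der_1 der_add der_mult der_minus)

lemma sgen_pgen: "x \<in> sgen S \<longleftrightarrow> (x, x) \<in> pgen ((\<lambda>a. (a, a)) ` S)"
proof
  show "x \<in> sgen S \<Longrightarrow> (x, x) \<in> pgen ((\<lambda>a. (a, a)) ` S)"
    by (induction rule: sgen.induct) (auto intro: pgen.intros)
  assume "(x, x) \<in> pgen ((\<lambda>a. (a, a)) ` S)"
  then have "fst (x, x) \<in> sgen S"
    by (induction rule: pgen.induct) (auto intro: sgen.intros)
  then show "x \<in> sgen S" by simp
qed

lemma sgen_mp_eval:
  assumes "sring k"
  shows "x \<in> sgen (k \<union> f ` A) \<longleftrightarrow> (\<exists>p\<in>mp_ring k A. x = mp_eval f p)"
  unfolding sgen_pgen using pgen_mp_eval[OF assms, of x x f f A] by (simp add: image_Un image_image)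

lemma dcl_algebraic:
  fixes x :: "'a::field_char_0"
  shows "x \<in> dcl S \<longleftrightarrow> algebraic_over (sgen S) x"
proof
  assume x: "x \<in> dcl S"
  show "algebraic_over (sgen S) x"
  proof (rule ccontr)
    assume "\<not> ?thesis"
    then obtain d where "is_der d" "\<forall>a\<in>sgen S. d a = 0" "d x = 1"
      using not_algebraic_derivation[OF sring_sgen] by blast
    then show False using x by (auto simp: dcl_def sgen_base)
  qed
next
  assume "algebraic_over (sgen S) x"
  then show "x \<in> dcl S"
    unfolding dcl_def using algebraic_derivation[OF sring_sgen] der_sgen by blast
qed

subsection \<open>Algebraic independence\<close>

lemma der_monv:
  assumes d: "is_der d" and "\<And>a. a \<in> B \<Longrightarrow> a \<noteq> b \<Longrightarrow> d a = 0" and b: "d b = 1"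
    and "Poly_Mapping.keys \<mu> \<subseteq> B"
  shows "d (monv id \<mu>) = of_nat (Poly_Mapping.lookup \<mu> b) * monv id (\<mu> - Poly_Mapping.single b 1)"
proof -
  have prod0: "d (\<Prod>v\<in>S. v ^ n v) = 0" if "finite S" "\<And>a. a \<in> S \<Longrightarrow> d a = 0" for S n
    using that by (induction S rule: finite_induct) (auto simp: der_1[OF d] der_mult[OF d] der_power[OF d])
  show ?thesis
  proof (cases "b \<in> Poly_Mapping.keys \<mu>")
    case False
    then have "d (\<Prod>v\<in>Poly_Mapping.keys \<mu>. v ^ Poly_Mapping.lookup \<mu> v) = 0"
      using assms(2,4) by (intro prod0) auto
    then show ?thesis using False by (simp add: monv_def in_keys_iff)
  next
    case True
    let ?S = "Poly_Mapping.keys \<mu> - {b}" and ?n = "Poly_Mapping.lookup \<mu>"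
    have S: "finite ?S" by simp
    have ins: "insert b ?S = Poly_Mapping.keys \<mu>" using True by auto
    have n: "?n b > 0" using True by (simp add: in_keys_iff)
    have e1: "monv id \<mu> = b ^ ?n b * (\<Prod>v\<in>?S. v ^ ?n v)"
      unfolding monv_def using True by (simp add: prod.remove)
    have "monv id (\<mu> - Poly_Mapping.single b 1)
        = (\<Prod>v\<in>insert b ?S. id v ^ Poly_Mapping.lookup (\<mu> - Poly_Mapping.single b 1) v)"
      by (rule monv_superset) (auto simp: in_keys_iff lookup_minus)
    also have "\<dots> = b ^ (?n b - 1) * (\<Prod>v\<in>?S. v ^ ?n v)"
      by (subst prod.insert) (auto simp: lookup_minus lookup_single intro!: prod.cong)
    finally have e2: "monv id (\<mu> - Poly_Mapping.single b 1) = b ^ (?n b - 1) * (\<Prod>v\<in>?S. v ^ ?n v)" .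
    have "d (\<Prod>v\<in>?S. v ^ ?n v) = 0" by (rule prod0) (use assms(2,4) in auto)
    then show ?thesis unfolding e1 e2 by (simp add: der_mult[OF d] der_power[OF d] b)
  qed
qed

definition mdeg :: "('v \<Rightarrow>\<^sub>0 nat) \<Rightarrow> nat" where
  "mdeg \<mu> = (\<Sum>v\<in>Poly_Mapping.keys \<mu>. Poly_Mapping.lookup \<mu> v)"

lemma mdeg_single_add: "mdeg (\<mu> + Poly_Mapping.single b 1) = Suc (mdeg \<mu>)"
proof -
  let ?S = "insert b (Poly_Mapping.keys \<mu>)"
  have *: "mdeg \<nu> = (\<Sum>v\<in>?S. Poly_Mapping.lookup \<nu> v)" if "Poly_Mapping.keys \<nu> \<subseteq> ?S" for \<nu>
    unfolding mdeg_def by (rule sum.mono_neutral_left) (use that in \<open>auto simp: in_keys_iff\<close>)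
  have "mdeg (\<mu> + Poly_Mapping.single b 1)
      = (\<Sum>v\<in>?S. Poly_Mapping.lookup \<mu> v + (if v = b then 1 else 0))"
    by (subst *) (use keys_add[of \<mu> "Poly_Mapping.single b 1"] in
        \<open>auto simp: lookup_add lookup_single when_def intro!: sum.cong\<close>)
  also have "\<dots> = Suc (mdeg \<mu>)"
    by (subst *[of \<mu>]) (auto simp: sum.distrib)
  finally show ?thesis .
qed

text \<open>Independence of \<open>B\<close> yields, for each \<open>b\<close>, a derivation that is
  1 at \<open>b\<close> and kills \<open>k\<close> and the rest of \<open>B\<close>. It acts on the
  relation as partial differentiation, which lowers the degree bound \<open>N\<close>;
  characteristic zero allows the exponents to be cancelled.\<close>

lemma dindep_monomials:
  fixes k B :: "'a::field_char_0 set"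
  assumes k: "sring k" and B: "dindep k B"
  shows "finite M \<Longrightarrow> (\<And>\<mu>. \<mu> \<in> M \<Longrightarrow> Poly_Mapping.keys \<mu> \<subseteq> B \<and> mdeg \<mu> \<le> N \<and> c \<mu> \<in> k) \<Longrightarrow>
    (\<Sum>\<mu>\<in>M. c \<mu> * monv id \<mu>) = 0 \<Longrightarrow> \<mu> \<in> M \<Longrightarrow> c \<mu> = 0"
proof (induction N arbitrary: M c \<mu>)
  case 0
  have z: "\<nu> = 0" if "\<nu> \<in> M" for \<nu>
    using 0(2)[OF that] by (auto simp: mdeg_def in_keys_iff poly_mapping_eq_iff fun_eq_iff)
  then have "M = {0}" using 0(4) by auto
  then show ?case using 0(3,4) by simp
next
  case (Suc N)
  have pos: "c \<nu> = 0" if \<nu>: "\<nu> \<in> M" and b: "b \<in> Poly_Mapping.keys \<nu>" for \<nu> b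
  proof -
    have bB: "b \<in> B" using Suc.prems(2)[OF \<nu>] b by blast
    obtain d where d: "is_der d" "\<And>a. a \<in> k \<union> (B - {b}) \<Longrightarrow> d a = 0" "d b = 1"
      using not_dclD B bB unfolding dindep_def by blast
    define s where "s = Poly_Mapping.single b (1::nat)"
    define M' where "M' = {\<mu> \<in> M. b \<in> Poly_Mapping.keys \<mu>}"
    define c' where "c' \<mu> = c (\<mu> + s) * of_nat (Poly_Mapping.lookup (\<mu> + s) b)" for \<mu>
    have bk: "\<mu> - s + s = \<mu>" if "b \<in> Poly_Mapping.keys \<mu>" for \<mu>
      using that by (auto simp: s_def poly_mapping_eq_iff fun_eq_iff lookup_add lookup_minus lookup_single in_keys_iff when_def)
    have inj: "inj_on (\<lambda>\<mu>. \<mu> - s) M'"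
      by (rule inj_onI) (metis (mono_tags, lifting) M'_def bk mem_Collect_eq)
    have "0 = d (\<Sum>\<mu>\<in>M. c \<mu> * monv id \<mu>)" by (simp only: Suc.prems(3) der_0[OF d(1)])
    also have "\<dots> = (\<Sum>\<mu>\<in>M. c \<mu> * (of_nat (Poly_Mapping.lookup \<mu> b) * monv id (\<mu> - s)))"
    proof (subst der_sum[OF d(1)], rule sum.cong)
      fix \<mu> assume "\<mu> \<in> M"
      then have "d (c \<mu>) = 0" "Poly_Mapping.keys \<mu> \<subseteq> B" using Suc.prems(2) d(2) by blast+
      then show "d (c \<mu> * monv id \<mu>) = c \<mu> * (of_nat (Poly_Mapping.lookup \<mu> b) * monv id (\<mu> - s))"
        using der_monv[OF d(1) _ d(3), of B \<mu>] d(2) unfolding s_def by (simp add: der_mult[OF d(1)])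
    qed simp
    also have "\<dots> = (\<Sum>\<mu>\<in>M'. c \<mu> * (of_nat (Poly_Mapping.lookup \<mu> b) * monv id (\<mu> - s)))"
      by (rule sum.mono_neutral_right) (use Suc.prems(1) in \<open>auto simp: M'_def in_keys_iff\<close>)
    also have "\<dots> = (\<Sum>\<mu>\<in>M'. c' (\<mu> - s) * monv id (\<mu> - s))"
      by (rule sum.cong) (auto simp: c'_def M'_def bk)
    also have "\<dots> = (\<Sum>\<mu>\<in>(\<lambda>\<mu>. \<mu> - s) ` M'. c' \<mu> * monv id \<mu>)"
      by (simp add: sum.reindex[OF inj])
    finally have sum0: "(\<Sum>\<mu>\<in>(\<lambda>\<mu>. \<mu> - s) ` M'. c' \<mu> * monv id \<mu>) = 0" by simp
    have "c' (\<nu> - s) = 0"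
    proof (rule Suc.IH[OF _ _ sum0])
      show "finite ((\<lambda>\<mu>. \<mu> - s) ` M')" using Suc.prems(1) by (simp add: M'_def)
      show "\<nu> - s \<in> (\<lambda>\<mu>. \<mu> - s) ` M'" using \<nu> b by (auto simp: M'_def)
      fix \<mu>' assume "\<mu>' \<in> (\<lambda>\<mu>. \<mu> - s) ` M'"
      then obtain \<mu> where \<mu>: "\<mu> \<in> M" "b \<in> Poly_Mapping.keys \<mu>" "\<mu>' = \<mu> - s" by (auto simp: M'_def)
      have "Poly_Mapping.keys \<mu>' \<subseteq> Poly_Mapping.keys \<mu>" unfolding \<mu>(3) by (auto simp: s_def in_keys_iff lookup_minus)
      moreover have "Suc (mdeg \<mu>') = mdeg \<mu>" using mdeg_single_add[of \<mu>' b, folded s_def] bk[OF \<mu>(2)] \<mu>(3) by simp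
      moreover have "c' \<mu>' \<in> k"
        using Suc.prems(2)[OF \<mu>(1)] bk[OF \<mu>(2)] \<mu>(3) sring_of_nat[OF k] k by (auto simp: c'_def sring_def)
      ultimately show "Poly_Mapping.keys \<mu>' \<subseteq> B \<and> mdeg \<mu>' \<le> N \<and> c' \<mu>' \<in> k"
        using Suc.prems(2)[OF \<mu>(1)] by auto
    qed
    then show ?thesis using bk[OF b] b by (simp add: c'_def in_keys_iff)
  qed
  show ?case
  proof (cases "\<mu> = 0")
    case False
    then have "Poly_Mapping.keys \<mu> \<noteq> {}" by (metis keys_eq_empty)
    then show ?thesis using pos Suc.prems(4) by blast
  next
    case True
    have "(\<Sum>\<mu>\<in>M. c \<mu> * monv id \<mu>) = (\<Sum>\<mu>\<in>{0}. c \<mu> * monv id \<mu>)"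
    proof (rule sum.mono_neutral_right)
      show "\<forall>i\<in>M - {0}. c i * monv id i = 0"
      proof
        fix i assume i: "i \<in> M - {0}"
        then have "Poly_Mapping.keys i \<noteq> {}" by (metis keys_eq_empty DiffD2 singletonI)
        then obtain b where "b \<in> Poly_Mapping.keys i" by blast
        then have "c i = 0" using pos i by blast
        then show "c i * monv id i = 0" by simp
      qed
    qed (use Suc.prems True in auto)
    then show ?thesis using Suc.prems(3) True by simp
  qed
qed

lemma dindep_imp_alg_independent:
  fixes k B :: "'a::field_char_0 set"
  assumes k: "sring k" and B: "dindep k B"
  shows "alg_independent k B"
  unfolding alg_independent_def
proof (intro allI impI)
  fix p :: "('a, 'a) mpol"
  assume p: "mp_over k p" "mp_vars p \<subseteq> B" "mp_eval id p = 0"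
  define N where "N = Max (insert 0 (mdeg ` Poly_Mapping.keys p))"
  have "Poly_Mapping.lookup p \<mu> = 0" if \<mu>: "\<mu> \<in> Poly_Mapping.keys p" for \<mu>
  proof (rule dindep_monomials[OF k B])
    show "(\<Sum>\<mu>\<in>Poly_Mapping.keys p. Poly_Mapping.lookup p \<mu> * monv id \<mu>) = 0"
      using p(3) by (simp add: mp_eval_monv)
    show "Poly_Mapping.keys \<nu> \<subseteq> B \<and> mdeg \<nu> \<le> N \<and> Poly_Mapping.lookup p \<nu> \<in> k"
      if "\<nu> \<in> Poly_Mapping.keys p" for \<nu>
      using that p(1,2) by (auto simp: N_def mp_over_def mp_vars_def)
  qed (use \<mu> in auto)
  then have "Poly_Mapping.keys p = {}" by (meson all_not_in_conv in_keys_iff)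
  then show "p = 0" by simp
qed

text \<open>An algebraic equation for \<open>b\<close> over the ring generated by \<open>k\<close>
  and the rest of \<open>B\<close> becomes a polynomial relation \<open>P\<close> on
  \<open>B\<close>. The coefficients \<open>q n\<close> do not involve \<open>b\<close>, so terms
  with different powers of \<open>b\<close> cannot cancel and \<open>P = 0\<close> forces every
  \<open>q n\<close> to be zero.\<close>

lemma alg_independent_imp_dindep:
  fixes k B :: "'a::field_char_0 set"
  assumes k: "sring k" and B: "alg_independent k B"
  shows "dindep k B"
  unfolding dindep_def
proof (intro ballI notI)
  fix b assume b: "b \<in> B" and "b \<in> dcl (k \<union> (B - {b}))"
  then have "algebraic_over (sgen (k \<union> id ` (B - {b}))) b" by (simp add: dcl_algebraic)
  then obtain f where f: "f \<noteq> 0" "\<And>n. coeff f n \<in> sgen (k \<union> id ` (B - {b}))" "poly f b = 0"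
    unfolding algebraic_over_def by blast
  have "\<exists>q. q \<in> mp_ring k (B - {b}) \<and> coeff f n = mp_eval id q" for n
    using f(2)[of n] unfolding sgen_mp_eval[OF k] by blast
  then obtain q where q: "\<And>n. q n \<in> mp_ring k (B - {b})" "\<And>n. coeff f n = mp_eval id (q n)" by metis
  let ?x = "\<lambda>n. Poly_Mapping.single (Poly_Mapping.single b n) 1 :: ('a, 'a) mpol"
  define P where "P = (\<Sum>n\<le>degree f. q n * ?x n)"
  have "q n \<in> mp_ring k B" for n using q(1)[of n] by (auto simp: mp_ring_iff)
  moreover have "?x n \<in> mp_ring k B" for n
    by (rule mp_ring_single) (use k b in \<open>auto simp: sring_def\<close>)
  ultimately have P: "P \<in> mp_ring k B" unfolding P_def by (intro mp_ring_sum mp_ring_mult k)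
  have "mp_eval id P = poly f b"
    unfolding P_def mp_eval_sum mp_eval_mult by (simp add: poly_altdef q(2))
  then have "P = 0" using B P f(3) by (auto simp: alg_independent_def mp_ring_def)
  have free: "Poly_Mapping.lookup \<mu> b = 0" if "\<mu> \<in> Poly_Mapping.keys (q n)" for \<mu> n
    using q(1)[of n] that by (fastforce simp: mp_ring_iff in_keys_iff)
  have coef: "Poly_Mapping.lookup (q n * ?x n) (\<mu> + Poly_Mapping.single b l)
      = (if n = l then Poly_Mapping.lookup (q n) \<mu> else 0)" if \<mu>: "Poly_Mapping.lookup \<mu> b = 0" for n l \<mu>
  proof -
    have eq: "\<nu> + Poly_Mapping.single b n = \<mu> + Poly_Mapping.single b l \<longleftrightarrow> n = l \<and> \<nu> = \<mu>"
      if "\<nu> \<in> Poly_Mapping.keys (q n)" for \<nu>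
    proof
      assume e: "\<nu> + Poly_Mapping.single b n = \<mu> + Poly_Mapping.single b l"
      have "n = l" using arg_cong[OF e, of "\<lambda>h. Poly_Mapping.lookup h b"] free[OF that] \<mu>
        by (simp add: lookup_add)
      then show "n = l \<and> \<nu> = \<mu>" using e by simp
    qed simp
    have "Poly_Mapping.lookup (q n * ?x n) (\<mu> + Poly_Mapping.single b l)
        = (\<Sum>\<nu>\<in>Poly_Mapping.keys (q n). if n = l \<and> \<nu> = \<mu> then Poly_Mapping.lookup (q n) \<nu> else 0)"
      unfolding mp_mult_decomp lookup_sum
      by (rule sum.cong) (simp_all add: lookup_single when_def eq)
    also have "\<dots> = (if n = l then Poly_Mapping.lookup (q n) \<mu> else 0)"
      by (simp add: in_keys_iff)
    finally show ?thesis .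
  qed
  have "q n = 0" if n: "n \<le> degree f" for n
  proof (rule ccontr)
    assume "q n \<noteq> 0"
    then obtain \<mu> where \<mu>: "\<mu> \<in> Poly_Mapping.keys (q n)" by (metis all_not_in_conv keys_eq_empty)
    have "0 = Poly_Mapping.lookup P (\<mu> + Poly_Mapping.single b n)" using \<open>P = 0\<close> by simp
    also have "\<dots> = (\<Sum>i\<le>degree f. if i = n then Poly_Mapping.lookup (q i) \<mu> else 0)"
      unfolding P_def lookup_sum using coef[OF free[OF \<mu>]] by simp
    also have "\<dots> = Poly_Mapping.lookup (q n) \<mu>" using n by simp
    finally show False using \<mu> by (simp add: in_keys_iff)
  qed
  then have "coeff f n = 0" for n
    using q(2)[of n] by (cases "n \<le> degree f") (auto simp: coeff_eq_0)
  then show False using f(1) by (simp add: poly_eq_iff)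
qed

text \<open>\<open>SOME\<close> may choose any basis; by exchange all of them have the cardinality
  of \<open>N\<close>, which is itself a basis.\<close>

lemma trdeg_eq:
  fixes k F N :: "'a::field_char_0 set"
  assumes k: "sring k" and N: "finite N" "dindep k N" "N \<subseteq> F" "F \<subseteq> dcl (k \<union> N)"
  shows "trdeg k F = card N"
proof -
  have basis: "finite B \<and> card B = card N" if "transcendence_basis k F B" for B
  proof -
    have B: "B \<subseteq> F" "dindep k B"
      using that alg_independent_imp_dindep[OF k] by (auto simp: transcendence_basis_def)
    have F: "F \<subseteq> dcl (k \<union> B)"
    proof
      fix x assume x: "x \<in> F"
      show "x \<in> dcl (k \<union> B)"
      proof (rule ccontr)
        assume nx: "x \<notin> dcl (k \<union> B)"
        then have "alg_independent k (insert x B)"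
          by (intro dindep_imp_alg_independent[OF k] dindep_insert[OF B(2)])
        then have "insert x B = B" using that x unfolding transcendence_basis_def by blast
        then show False using nx dcl_superset[of "k \<union> B"] by blast
      qed
    qed
    have fB: "finite B" "card B \<le> card N"
      by (rule dindep_card_le[OF N(1) B(2)], use B(1) N(4) in blast)+
    moreover have "card N \<le> card B"
      by (rule dindep_card_le[OF fB(1) N(2)]) (use N(3) F in blast)
    ultimately show ?thesis by simp
  qed
  have "transcendence_basis k F N"
    unfolding transcendence_basis_def
  proof (intro conjI allI impI)
    show "alg_independent k N" by (rule dindep_imp_alg_independent[OF k N(2)])
    fix B' assume B': "N \<subseteq> B'" "B' \<subseteq> F" "alg_independent k B'"
    then have ind: "dindep k B'" using alg_independent_imp_dindep[OF k] by blast
    have "finite B'" "card B' \<le> card N"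
      by (rule dindep_card_le[OF N(1) ind], use B'(2) N(4) in blast)+
    then show "B' = N" using B'(1) card_seteq by blast
  qed (rule N(3))
  then have "transcendence_basis k F (SOME B. transcendence_basis k F B)" by (rule someI)
  then show ?thesis using basis by (simp add: trdeg_def)
qed

section \<open>Differential algebra: leaders, free prolongation of a jet and its
  specialization\<close>

section \<open>Jets and leaders\<close>

definition idx :: "'b::finite \<Rightarrow> nat" where
  "idx = (SOME f. inj f)"

lemma inj_idx: "inj (idx :: 'b::finite \<Rightarrow> nat)"
proof -
  obtain f :: "'b \<Rightarrow> nat" and n :: nat where "inj_on f UNIV"
    using finite_imp_inj_to_nat_seg[of "UNIV :: 'b set"] by auto
  then show ?thesis unfolding idx_def by (rule someI[of inj f])
qed

lemma idx_eq_iff [simp]: "idx i = idx j \<longleftrightarrow> i = j"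
  using inj_idx by (auto simp: inj_def)

type_synonym ('n, 'm) jet = "'n \<times> ('m \<Rightarrow> nat)"

definition jord :: "('n, 'm::finite) jet \<Rightarrow> nat" where
  "jord l = mord (snd l)"

definition shift :: "('n, 'm) jet \<Rightarrow> 'm \<Rightarrow> ('n, 'm) jet" where
  "shift l j = (fst l, inc (snd l) j)"

text \<open>An orderly ranking; jets are compared through the lexicographic order on \<open>nat \<Rightarrow>\<^sub>0 nat\<close>.\<close>

definition rk :: "('n::finite, 'm::finite) jet \<Rightarrow> nat \<Rightarrow>\<^sub>0 nat" where
  "rk l = Poly_Mapping.single 0 (jord l) + Poly_Mapping.single 1 (idx (fst l)) +
     (\<Sum>j\<in>UNIV. Poly_Mapping.single (idx j + 2) (snd l j))"

lemma jord_shift [simp]: "jord (shift l j) = Suc (jord l)"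
  by (simp add: jord_def shift_def)

lemma lookup_rk_0: "Poly_Mapping.lookup (rk l) 0 = jord l"
  by (simp add: rk_def lookup_add lookup_single lookup_sum)

lemma lookup_rk_1: "Poly_Mapping.lookup (rk l) 1 = idx (fst l)"
  by (simp add: rk_def lookup_add lookup_single lookup_sum)

lemma lookup_rk: "Poly_Mapping.lookup (rk l) (idx j + 2) = snd l j"
proof -
  have "(\<Sum>i\<in>UNIV. Poly_Mapping.lookup (Poly_Mapping.single (idx i + 2) (snd l i)) (idx j + 2))
      = (\<Sum>i\<in>UNIV. if i = j then snd l j else 0)"
    by (rule sum.cong) (auto simp: lookup_single when_def)
  then show ?thesis by (simp add: rk_def lookup_add lookup_single lookup_sum)
qed

lemma rk_inj: "rk l = rk l' \<longleftrightarrow> l = l'"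
proof
  assume eq: "rk l = rk l'"
  have "fst l = fst l'" using lookup_rk_1[of l] lookup_rk_1[of l'] eq by simp
  moreover have "snd l = snd l'" using lookup_rk[of l] lookup_rk[of l'] eq by (simp add: fun_eq_iff)
  ultimately show "l = l'" by (simp add: prod_eq_iff)
qed simp

lemma rk_shift: "rk (shift l j) = rk l + (Poly_Mapping.single 0 1 + Poly_Mapping.single (idx j + 2) 1)"
proof -
  have "(\<Sum>i\<in>UNIV. Poly_Mapping.single (idx i + 2) (inc (snd l) j i))
     = (\<Sum>i\<in>UNIV. Poly_Mapping.single (idx i + 2) (snd l i) + (if i = j then Poly_Mapping.single (idx j + 2) 1 else 0))"
    by (rule sum.cong) (auto simp: inc_apply single_add[symmetric])
  also have "\<dots> = (\<Sum>i\<in>UNIV. Poly_Mapping.single (idx i + 2) (snd l i)) + Poly_Mapping.single (idx j + 2) 1"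
    by (simp add: sum.distrib)
  moreover have "Poly_Mapping.single 0 (Suc (jord l)) = Poly_Mapping.single (0::nat) (jord l) + Poly_Mapping.single 0 1"
    by (simp add: single_add[symmetric])
  ultimately show ?thesis by (simp add: rk_def jord_def shift_def add_ac)
qed

lemma rk_less_shift_iff: "rk (shift l j) < rk (shift l' j) \<longleftrightarrow> rk l < rk l'"
  unfolding rk_shift by simp

lemma rk_less_jord:
  assumes "jord l < jord l'"
  shows "rk l < rk l'"
  unfolding less_poly_mapping.rep_eq less_fun_def
  by (rule exI[of _ 0]) (use assms in \<open>simp add: lookup_rk_0\<close>)

lemma rk_less_imp_jord: "rk l < rk l' \<Longrightarrow> jord l \<le> jord l'"
  using rk_less_jord[of l' l] by (meson less_asym not_le)

lemma rk_less_shift: "rk l < rk (shift l j)"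
  by (rule rk_less_jord) simp

definition lower :: "('n::finite, 'm::finite) jet \<Rightarrow> ('n, 'm) jet set" where
  "lower l = {l'. rk l' < rk l}"

lemma finite_jord: "finite {l :: ('n::finite, 'm::finite) jet. jord l \<le> d}"
proof (rule finite_subset)
  show "{l :: ('n, 'm) jet. jord l \<le> d} \<subseteq> UNIV \<times> (\<Union>e\<le>d. mons UNIV e)"
    by (auto simp: jord_def mons_def)
qed (auto simp: finite_mons)

lemma finite_lower: "finite (lower l)"
  by (rule finite_subset[OF _ finite_jord[of "jord l"]]) (auto simp: lower_def rk_less_imp_jord)

lemma wf_rk: "wf {(l, l'). rk l < rk (l' :: ('n::finite, 'm::finite) jet)}"
proof (rule wf_subset)
  show "wf (measure (\<lambda>l :: ('n, 'm) jet. card (lower l)))" by simp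
  show "{(l, l'). rk l < rk (l' :: ('n, 'm) jet)} \<subseteq> measure (\<lambda>l. card (lower l))"
  proof clarify
    fix l l' :: "('n, 'm) jet"
    assume "rk l < rk l'"
    then have "lower l \<subset> lower l'" by (auto simp: lower_def)
    then show "(l, l') \<in> measure (\<lambda>l. card (lower l))"
      using psubset_card_mono[OF finite_lower] by simp
  qed
qed

lemma rk_induct [case_names less]:
  fixes P :: "('n::finite, 'm::finite) jet \<Rightarrow> bool"
  assumes "\<And>l. (\<And>l'. rk l' < rk l \<Longrightarrow> P l') \<Longrightarrow> P l"
  shows "P l"
  using wf_rk by (rule wf_induct_rule) (use assms in auto)

lemma lower_shift: "l' \<in> lower l \<Longrightarrow> shift l' j \<in> lower (shift l j)"
  by (simp add: lower_def rk_less_shift_iff)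

lemma lower_mono: "rk l \<le> rk l' \<Longrightarrow> lower l \<subseteq> lower l'"
  by (auto simp: lower_def)

definition leader :: "'a::field set \<Rightarrow> (('n::finite, 'm::finite) jet \<Rightarrow> 'a) \<Rightarrow> ('n, 'm) jet \<Rightarrow> bool" where
  "leader k c l \<longleftrightarrow> c l \<in> dcl (k \<union> c ` lower l)"

text \<open>Let \<open>e\<close> kill \<open>k\<close> and the jets below \<open>shift l j\<close>.
  The commutator of \<open>e\<close> and \<open>d\<close> is a derivation that kills
  \<open>k\<close> and the jets below \<open>l\<close>, hence also \<open>c l\<close>, where
  \<open>e\<close> vanishes too. Since \<open>d\<close> is required to shift only jets below
  \<open>l\<close>, this also applies to a jet that is still under construction.\<close>

lemma leader_derivative:
  assumes d: "is_der d" and k: "\<And>a. a \<in> k \<Longrightarrow> d a \<in> k"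
    and c: "\<And>l'. l' \<in> lower l \<Longrightarrow> d (c l') = c (shift l' j)"
    and l: "leader k c l"
  shows "d (c l) \<in> dcl (k \<union> c ` lower (shift l j))"
  unfolding dcl_def
proof (intro CollectI allI impI)
  fix e assume e: "is_der e" "\<forall>a\<in>k \<union> c ` lower (shift l j). e a = 0"
  have "lower l \<subseteq> lower (shift l j)" using rk_less_shift[of l j] by (intro lower_mono) simp
  then have low: "e (c l') = 0" "e (d (c l')) = 0" if "l' \<in> lower l" for l'
  proof -
    have "c l' \<in> c ` lower (shift l j)" "c (shift l' j) \<in> c ` lower (shift l j)"
      using \<open>lower l \<subseteq> _\<close> that lower_shift[OF that] by blast+
    then show "e (c l') = 0" "e (d (c l')) = 0" using e(2) c[OF that] by auto
  qed
  have "e (d a) - d (e a) = 0" if a: "a \<in> k \<union> c ` lower l" for a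
  proof (cases "a \<in> k")
    case True
    then have "e a = 0" "e (d a) = 0" using k e(2) by auto
    then show ?thesis by (simp add: der_0[OF d])
  next
    case False
    then have "e a = 0" "e (d a) = 0" using low a by auto
    then show ?thesis by (simp add: der_0[OF d])
  qed
  then have "e (d (c l)) - d (e (c l)) = 0"
    using l der_commutator[OF e(1) d] unfolding leader_def dcl_def by blast
  moreover have "e (c l) = 0" using e(2) rk_less_shift[of l j] by (auto simp: lower_def)
  ultimately show "e (d (c l)) = 0" by (simp add: der_0[OF d])
qed

lemma leader_shift:
  assumes "is_der d" "\<And>a. a \<in> k \<Longrightarrow> d a \<in> k" "\<And>l. d (c l) = c (shift l j)" "leader k c l"
  shows "leader k c (shift l j)"
  using leader_derivative[OF assms(1,2) _ assms(4), of j] assms(3) by (simp add: leader_def)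

lemma nonleader_inj: "inj_on c {l. \<not> leader k c l}"
proof (rule inj_onI)
  fix l l' assume *: "l \<in> {l. \<not> leader k c l}" "l' \<in> {l. \<not> leader k c l}" "c l = c l'"
  have **: "\<not> rk l < rk l'" if "c l = c l'" "\<not> leader k c l'" for l l'
  proof
    assume "rk l < rk l'"
    then have "c l \<in> c ` lower l'" by (intro imageI) (simp add: lower_def)
    then have "c l' \<in> dcl (k \<union> c ` lower l')"
      using that(1) dcl_superset[of "k \<union> c ` lower l'"] by auto
    then show False using that(2) unfolding leader_def by blast
  qed
  have "rk l = rk l'" using **[of l l'] **[of l' l] * by (metis linorder_neqE mem_Collect_eq)
  then show "l = l'" by (simp add: rk_inj)
qed

lemma nonleader_dindep:
  assumes "finite S" "S \<subseteq> {l. \<not> leader k c l}"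
  shows "dindep k (c ` S)"
  using assms
proof (induction "card S" arbitrary: S)
  case 0
  then show ?case by (simp add: dindep_def)
next
  case (Suc n)
  then have ne: "S \<noteq> {}" by auto
  define M where "M = Max (rk ` S)"
  have "M \<in> rk ` S" unfolding M_def using Suc ne by (intro Max_in) auto
  then obtain l where l: "l \<in> S" "rk l = M" by auto
  have mx: "rk l' \<le> rk l" if "l' \<in> S" for l' using that Suc l by (auto simp: M_def)
  have low: "S - {l} \<subseteq> lower l"
  proof
    fix l' assume l': "l' \<in> S - {l}"
    then have "rk l' \<le> rk l" "rk l' \<noteq> rk l" using mx rk_inj by blast+
    then show "l' \<in> lower l" unfolding lower_def by simp
  qed
  have "dindep k (c ` (S - {l}))"
    by (rule Suc.hyps(1)) (use Suc l in auto)
  moreover have "c l \<notin> dcl (k \<union> c ` (S - {l}))"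
  proof -
    have "dcl (k \<union> c ` (S - {l})) \<subseteq> dcl (k \<union> c ` lower l)" using low by (intro dcl_mono) auto
    then show ?thesis using Suc.prems(2) l by (auto simp: leader_def)
  qed
  ultimately have "dindep k (insert (c l) (c ` (S - {l})))" by (rule dindep_insert)
  moreover have "insert (c l) (c ` (S - {l})) = c ` S" using l by auto
  ultimately show ?case by simp
qed

lemma nonleader_span:
  fixes c :: "('n::finite, 'm::finite) jet \<Rightarrow> 'a::field"
  shows "jord l \<le> s \<Longrightarrow> c l \<in> dcl (k \<union> c ` {l. \<not> leader k c l \<and> jord l \<le> s})"
proof (induction l rule: rk_induct)
  case (less l)
  let ?N = "{l. \<not> leader k c l \<and> jord l \<le> s}"
  show ?case
  proof (cases "leader k c l")
    case False
    then have "c l \<in> k \<union> c ` ?N" using less.prems by auto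
    then show ?thesis by (rule subsetD[OF dcl_superset])
  next
    case True
    have "c l' \<in> dcl (k \<union> c ` ?N)" if "l' \<in> lower l" for l'
      using that less.IH[of l'] rk_less_imp_jord[of l' l] less.prems by (simp add: lower_def)
    moreover have "k \<subseteq> dcl (k \<union> c ` ?N)" by (rule order_trans[OF Un_upper1 dcl_superset])
    ultimately have "k \<union> c ` lower l \<subseteq> dcl (k \<union> c ` ?N)" by auto
    from dcl_minimal[OF this] show ?thesis using True by (auto simp: leader_def)
  qed
qed

subsection \<open>Jets of a point\<close>

definition jets :: "('m::finite \<Rightarrow> 'a \<Rightarrow> 'a) \<Rightarrow> ('n \<Rightarrow> 'a) \<Rightarrow> ('n, 'm) jet \<Rightarrow> 'a" where
  "jets \<delta> b l = dpow \<delta> (snd l) (b (fst l))"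

lemma dpow_inc:
  assumes comm: "\<And>i j x. \<delta> i (\<delta> j x) = \<delta> j (\<delta> i x)"
  shows "dpow \<delta> (inc \<xi> j) x = \<delta> j (dpow \<delta> \<xi> x)"
proof -
  have 1: "\<delta> i ((\<delta> j ^^ n) x) = (\<delta> j ^^ n) (\<delta> i x)" for i j n x
    by (induction n) (simp_all add: comm[of i j])
  have 2: "(\<delta> i ^^ n) ((\<delta> j ^^ n') x) = (\<delta> j ^^ n') ((\<delta> i ^^ n) x)" for i j n n' x
    by (induction n) (auto simp: 1)
  have c: "comp_fun_commute_on UNIV (\<lambda>j. \<delta> j ^^ \<xi> j)" for \<xi>
    by unfold_locales (auto simp: fun_eq_iff 2)
  have rec: "dpow \<delta> \<xi> x = (\<delta> j ^^ \<xi> j) (Finite_Set.fold (\<lambda>j. \<delta> j ^^ \<xi> j) x (UNIV - {j}))" for \<xi>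
    unfolding dpow_def by (rule comp_fun_commute_on.fold_rec[OF c]) auto
  have "Finite_Set.fold (\<lambda>l. \<delta> l ^^ inc \<xi> j l) x (UNIV - {j})
      = Finite_Set.fold (\<lambda>l. \<delta> l ^^ \<xi> l) x (UNIV - {j})"
    by (rule fold_closed_eq[of _ UNIV]) (auto simp: inc_apply)
  then show ?thesis by (simp add: rec[of "inc \<xi> j"] rec[of \<xi>] inc_apply)
qed

lemma dpow_0:
  fixes \<delta> :: "'m::finite \<Rightarrow> 'b \<Rightarrow> 'b"
  shows "dpow \<delta> (\<lambda>_. 0) x = x"
proof -
  interpret comp_fun_commute_on UNIV "\<lambda>_ :: 'm. id :: 'b \<Rightarrow> 'b" by unfold_locales auto
  have "Finite_Set.fold (\<lambda>_ :: 'm. id :: 'b \<Rightarrow> 'b) x A = x" if "finite A" for A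
    using that
  proof (induction A rule: finite_induct)
    case (insert y F)
    show ?case by (subst fold_insert) (simp_all only: insert.IH insert.hyps id_apply subset_UNIV not_False_eq_True)
  qed simp
  from this[of UNIV] show ?thesis by (simp add: dpow_def id_def)
qed

lemma dp_eval_jets: "dp_eval \<delta> b p = mp_eval (jets \<delta> b) p"
proof -
  have "jets \<delta> b = (\<lambda>(i, \<xi>). dpow \<delta> \<xi> (b i))" by (auto simp: jets_def fun_eq_iff)
  then show ?thesis by (simp add: dp_eval_def)
qed

section \<open>Cardinalities\<close>

lemma lepoll_ordLeq: "lepoll A B \<longleftrightarrow> (card_of A, card_of B) \<in> ordLeq"
  unfolding lepoll_def using card_of_ordLeq[of A B] by blast

lemma UN_lepoll:
  assumes "infinite B" "lepoll I B" "\<And>i. i \<in> I \<Longrightarrow> lepoll (A i) B"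
  shows "lepoll (\<Union>i\<in>I. A i) B"
  using card_of_UNION_ordLeq_infinite[of B I A] assms by (simp add: lepoll_ordLeq)

lemma infinite_Times_lepoll: 
  assumes "infinite A"
  shows "lepoll (A \<times> A) A"
  using card_of_Times_same_infinite[OF assms] unfolding lepoll_ordLeq by (simp add: ordIso_iff_ordLeq)

lemma lists_lepoll:
  assumes A: "infinite A"
  shows "lepoll (lists A) A"
proof -
  have n: "lepoll {xs \<in> lists A. length xs = n} A" for n
  proof (induction n)
    case 0
    have "finite {xs \<in> lists A. length xs = 0}" by (rule finite_subset[of _ "{[]}"]) auto
    then show ?case using A by (rule finite_lepoll_infinite[rotated])
  next
    case (Suc n)
    have "{xs \<in> lists A. length xs = Suc n} \<subseteq> (\<lambda>(x, xs). x # xs) ` (A \<times> {xs \<in> lists A. length xs = n})"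
      by (auto simp: length_Suc_conv image_iff)
    then have "lepoll {xs \<in> lists A. length xs = Suc n} (A \<times> {xs \<in> lists A. length xs = n})"
      using subset_image_lepoll by blast
    also have "lepoll \<dots> (A \<times> A)" by (rule times_lepoll_mono[OF lepoll_refl Suc])
    also have "lepoll \<dots> A" by (rule infinite_Times_lepoll[OF A])
    finally show ?case .
  qed
  have "lists A = (\<Union>n. {xs \<in> lists A. length xs = n})" by auto
  also have "lepoll \<dots> A" using A n by (intro UN_lepoll) (auto simp: infinite_le_lepoll)
  finally show ?thesis .
qed

text \<open>Elements of the subring are sums of products of elements of \<open>S\<close> and of -1,
  so lists of lists over \<open>insert (- 1) S\<close> cover it.\<close>

lemma sgen_lepoll:
  fixes S :: "'a::field set"
  assumes S: "infinite S"
  shows "lepoll (sgen S) S"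
proof -
  define T where "T = insert (- 1) S"
  let ?f = "\<lambda>ls :: 'a list list. sum_list (map prod_list ls)"
  have add: "?f ls + ?f ls' = ?f (ls @ ls')" for ls ls' by simp
  have m1: "prod_list l * ?f ls' = ?f (map ((@) l) ls')" for l ls'
    by (induction ls') (auto simp: algebra_simps)
  have mult: "?f ls * ?f ls' = ?f (concat (map (\<lambda>l. map ((@) l) ls') ls))" for ls ls'
    by (induction ls) (auto simp: algebra_simps m1)
  have mem: "concat (map (\<lambda>l. map ((@) l) ls') ls) \<in> lists (lists T)"
    if "ls \<in> lists (lists T)" "ls' \<in> lists (lists T)" for ls ls'
    using that by (auto simp: in_lists_conv_set)
  have "x \<in> ?f ` lists (lists T)" if "x \<in> sgen S" for x
    using that
  proof induction
    case (sgen_base x)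
    then show ?case by (intro image_eqI[of _ _ "[[x]]"]) (auto simp: T_def)
  next
    case sgen_one
    then show ?case by (intro image_eqI[of _ _ "[[]]"]) auto
  next
    case (sgen_add x x')
    then obtain ls ls' where "ls \<in> lists (lists T)" "ls' \<in> lists (lists T)" "x = ?f ls" "x' = ?f ls'" by blast
    then show ?case by (intro image_eqI[of _ _ "ls @ ls'"]) auto
  next
    case (sgen_mult x x')
    then obtain ls ls' where ls: "ls \<in> lists (lists T)" "ls' \<in> lists (lists T)" "x = ?f ls" "x' = ?f ls'" by blast
    then show ?case unfolding ls(3,4) mult by (intro imageI mem)
  next
    case (sgen_minus x)
    then obtain ls where ls: "ls \<in> lists (lists T)" "x = ?f ls" by blast
    have "- x = ?f (concat (map (\<lambda>l. map ((@) l) ls) [[- 1]]))"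
      unfolding mult[symmetric] by (simp add: ls)
    moreover have "concat (map (\<lambda>l. map ((@) l) ls) [[- 1]]) \<in> lists (lists T)"
      by (rule mem[OF _ ls(1)]) (simp add: T_def)
    ultimately show ?case by (rule image_eqI)
  qed
  then have sub: "sgen S \<subseteq> ?f ` lists (lists T)" by blast
  have T: "infinite T" using S by (simp add: T_def)
  have "lepoll (sgen S) (lists (lists T))" using sub subset_image_lepoll by blast
  also have "lepoll \<dots> (lists T)" by (rule lists_lepoll_mono[OF lists_lepoll[OF T]])
  also have "lepoll \<dots> T" by (rule lists_lepoll[OF T])
  also have "lepoll \<dots> S" unfolding T_def by (rule infinite_insert_lepoll[OF S])
  finally show ?thesis .
qed

lemma dcl_lepoll:
  fixes S :: "'a::field_char_0 set"
  assumes S: "infinite S"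
  shows "lepoll (dcl S) S"
proof -
  let ?P = "{p. p \<noteq> 0 \<and> (\<forall>n. coeff p n \<in> sgen S)}"
  have eq: "dcl S = (\<Union>p\<in>?P. {x. poly p x = 0})"
    by (auto simp: dcl_algebraic algebraic_over_def)
  have "inj_on coeffs ?P" by (rule inj_onI) (simp only: coeffs_eq_iff)
  moreover have "coeffs ` ?P \<subseteq> lists (sgen S)"
  proof (rule image_subsetI)
    fix p :: "'a poly"
    assume "p \<in> ?P"
    then show "coeffs p \<in> lists (sgen S)" by (simp add: in_lists_conv_set coeffs_def image_subset_iff) 
  qed
  ultimately have "lepoll ?P (lists (sgen S))" unfolding lepoll_def by blast
  also have "lepoll \<dots> (lists S)" by (rule lists_lepoll_mono[OF sgen_lepoll[OF S]])
  also have "lepoll \<dots> S" by (rule lists_lepoll[OF S])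
  finally show ?thesis unfolding eq
  proof (rule UN_lepoll[OF S])
    fix p :: "'a poly" assume "p \<in> ?P"
    then show "lepoll {x. poly p x = 0} S"
      by (intro finite_lepoll_infinite[OF S] poly_roots_finite) simp
  qed
qed

text \<open>An infinite set and its algebraic closure have the same cardinality, so a set smaller
  than the field does not span it, even with finitely many elements added.\<close>

lemma exists_transcendental:
  fixes k :: "'a::field_char_0 set"
  assumes k: "infinite k" "k \<prec> (UNIV :: 'a set)" and Y: "finite Y"
  shows "\<exists>v. v \<notin> dcl (k \<union> Y)"
proof (rule ccontr)
  assume "\<not> ?thesis"
  then have eq: "dcl (k \<union> Y) = UNIV" by auto
  have "lepoll (k \<union> Y) k" using Y
  proof (induction Y rule: finite_induct)
    case (insert y Y)
    have "lepoll (insert y (k \<union> Y)) (k \<union> Y)" by (rule infinite_insert_lepoll) (use k in auto)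
    then show ?case using insert.IH lepoll_trans by (metis Un_insert_right)
  qed simp
  moreover have "lepoll (dcl (k \<union> Y)) (k \<union> Y)" by (rule dcl_lepoll) (use k in auto)
  ultimately have "lepoll (UNIV :: 'a set) k" using eq lepoll_trans by metis
  then show False using k(2) lepoll_antisym[of k UNIV] by (auto simp: lesspoll_def)
qed

section \<open>Extending a jet to a generic solution\<close>

inductive_set dgen :: "('a::field \<times> 'a) set \<Rightarrow> ('a \<times> 'a) set" for S where
  dgen_base: "x \<in> S \<Longrightarrow> x \<in> dgen S"
| dgen_zero: "(0, 0) \<in> dgen S"
| dgen_one: "(1, 0) \<in> dgen S"
| dgen_add: "(x, y) \<in> dgen S \<Longrightarrow> (x', y') \<in> dgen S \<Longrightarrow> (x + x', y + y') \<in> dgen S"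
| dgen_mult: "(x, y) \<in> dgen S \<Longrightarrow> (x', y') \<in> dgen S \<Longrightarrow> (x * x', y * x' + x * y') \<in> dgen S"
| dgen_minus: "(x, y) \<in> dgen S \<Longrightarrow> (- x, - y) \<in> dgen S"

lemma dring_dgen: "dring (dgen S)"
  unfolding dring_def by (auto intro: dgen.intros)

lemma lower_trans: "x \<in> lower y \<Longrightarrow> y \<in> lower z \<Longrightarrow> x \<in> lower z"
  by (auto simp: lower_def)

lemma below_pred:
  fixes u :: "'m::finite \<Rightarrow> nat"
  assumes "u \<in> below d E" "mord u > d"
  shows "\<exists>j. u j > 0 \<and> dec u j \<in> below d E"
proof -
  obtain e where e: "e \<in> E" "mord e \<le> d" "e \<le> u" using assms(1) by (auto simp: below_def above_def)
  obtain j where j: "e j < u j" using mord_less_ex[OF e(3)] e(2) assms(2) by auto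
  then have "e \<le> dec u j" by (rule le_dec[OF e(3)])
  then have "dec u j \<in> below d E" using e(1,2) unfolding below_def above_def by blast
  moreover have "u j > 0" using j by simp
  ultimately show ?thesis by blast
qed

lemma below_inc: "u \<in> below d E \<Longrightarrow> inc u j \<in> below d E"
  unfolding below_def above_def using order_trans[OF _ le_inc[of u j]] by fast

text \<open>\<open>transcendental\<close> is the form in which the smallness of \<open>k\<close>
  provides free values for the jet at non-leaders.\<close>

locale diff_point =
  fixes \<delta> :: "'m::finite \<Rightarrow> 'a::field_char_0 \<Rightarrow> 'a" and k :: "'a set" and b :: "'n::finite \<Rightarrow> 'a"
  assumes der_\<delta>: "is_der (\<delta> j)" and comm: "\<delta> i (\<delta> j x) = \<delta> j (\<delta> i x)"
    and k_ring: "sring k" and k_stable: "a \<in> k \<Longrightarrow> \<delta> j a \<in> k"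
    and transcendental: "finite Y \<Longrightarrow> \<exists>v. v \<notin> dcl (k \<union> Y)"
begin

abbreviation bj :: "('n, 'm) jet \<Rightarrow> 'a" where
  "bj \<equiv> jets \<delta> b"

definition lead :: "'n \<Rightarrow> ('m \<Rightarrow> nat) set" where
  "lead i = {\<xi>. leader k bj (i, \<xi>)}"

lemma bj_shift: "\<delta> j (bj l) = bj (shift l j)"
  using dpow_inc[of \<delta> "snd l" j] comm by (simp add: jets_def shift_def)

lemma lead_inc: "\<xi> \<in> lead i \<Longrightarrow> inc \<xi> j \<in> lead i"
  unfolding lead_def using leader_shift[of "\<delta> j" k bj j "(i, \<xi>)"] der_\<delta> k_stable bj_shift
  by (simp add: shift_def)

lemma lead_le: "\<xi> \<in> lead i \<Longrightarrow> \<xi> \<le> \<eta> \<Longrightarrow> \<eta> \<in> lead i"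
  using upset_le[of "lead i" \<xi> \<eta>] lead_inc by blast

definition gen_lead :: "nat \<Rightarrow> ('n, 'm) jet \<Rightarrow> bool" where
  "gen_lead d l \<longleftrightarrow> snd l \<in> below d (lead (fst l))"

lemma gen_lead_low: "jord l \<le> d \<Longrightarrow> gen_lead d l \<longleftrightarrow> leader k bj l"
  unfolding gen_lead_def below_def above_def jord_def
  using lead_le[of _ "fst l" "snd l"] by (auto simp: lead_def intro!: exI[of _ "snd l"])

text \<open>\<open>e\<close> plays the role of the \<open>j\<close>-th derivation as far as its
  values are prescribed by the jets in \<open>Y\<close>. It is defined on the whole field and may
  change from one stage to the next; commutation is visible only through the jets.\<close>

definition stage :: "(('n, 'm) jet \<Rightarrow> 'a) \<Rightarrow> 'm \<Rightarrow> ('n, 'm) jet set \<Rightarrow> ('a \<Rightarrow> 'a) \<Rightarrow> bool" where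
  "stage c j Y e \<longleftrightarrow> is_der e \<and> (\<forall>a\<in>k. e a = \<delta> j a) \<and> (\<forall>l. shift l j \<in> Y \<longrightarrow> e (c l) = c (shift l j))"

definition good :: "nat \<Rightarrow> (('n, 'm) jet \<Rightarrow> 'a) \<Rightarrow> ('n, 'm) jet \<Rightarrow> 'a \<Rightarrow> bool" where
  "good d c l v \<longleftrightarrow> (jord l \<le> d \<longrightarrow> v = bj l) \<and>
     (gen_lead d l \<longleftrightarrow> v \<in> dcl (k \<union> c ` lower l)) \<and>
     (\<forall>j. \<exists>e. stage (c(l := v)) j (insert l (lower l)) e)"

lemma stage_cong:
  assumes "\<And>l. l \<in> Y \<Longrightarrow> c l = c' l" "\<And>l j. shift l j \<in> Y \<Longrightarrow> l \<in> Y"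
  shows "stage c j Y e \<longleftrightarrow> stage c' j Y e"
  unfolding stage_def using assms by metis

lemma shift_lowerD: "shift l j \<in> insert l' (lower l') \<Longrightarrow> l \<in> lower l'"
  using rk_less_shift[of l j] by (auto simp: lower_def)

lemma good_cong:
  assumes "\<And>l'. l' \<in> lower l \<Longrightarrow> c l' = c' l'"
  shows "good d c l v \<longleftrightarrow> good d c' l v"
proof -
  have "c ` lower l = c' ` lower l" using assms by auto
  moreover have "stage (c(l := v)) j (insert l (lower l)) e \<longleftrightarrow> stage (c'(l := v)) j (insert l (lower l)) e" for j e
  proof (rule stage_cong)
    show "(c(l := v)) l' = (c'(l := v)) l'" if "l' \<in> insert l (lower l)" for l' using that assms by (cases "l' = l") simp_all
  qed (use shift_lowerD in blast)
  ultimately show ?thesis by (simp add: good_def)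
qed

lemma lower_max:
  assumes "lower l \<noteq> {}"
  obtains l' where "lower l = insert l' (lower l')" "l' \<in> lower (l :: ('n, 'm) jet)"
proof -
  define M where "M = Max (rk ` lower l)"
  have fin: "finite (lower l)" by (rule finite_lower)
  then have "M \<in> rk ` lower l" unfolding M_def using assms by (intro Max_in) auto
  then obtain l' where l': "l' \<in> lower l" "rk l' = M" by auto
  have "lower l = insert l' (lower l')"
  proof (intro equalityI subsetI)
    fix x assume x: "x \<in> lower l"
    then have "rk x \<le> rk l'" using fin l'(2) by (simp add: M_def)
    then show "x \<in> insert l' (lower l')" using rk_inj[of x l'] by (auto simp: lower_def)
  qed (use l' in \<open>auto simp: lower_def\<close>)
  then show ?thesis using that l' by blast
qed

lemma stage_lower:
  assumes "\<And>l'. l' \<in> lower l \<Longrightarrow> good d c l' (c l')"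
  shows "\<exists>e. stage c j (lower l) e"
proof (cases "lower l = {}")
  case True
  then show ?thesis by (intro exI[of _ "\<delta> j"]) (simp add: stage_def der_\<delta>)
next
  case False
  then obtain l' where l': "lower l = insert l' (lower l')" "l' \<in> lower l" by (rule lower_max)
  have "c(l' := c l') = c" by simp
  then show ?thesis using assms[OF l'(2)] l'(1) unfolding good_def by metis
qed

text \<open>Every leader \<open>p j\<close> directly below \<open>l\<close> forces the value at
  \<open>l\<close>. The hypothesis \<open>conn\<close> joins all these leaders by edges, and
  adjacent ones force the same value. If there is no such leader, any value can be accommodated, and
  a transcendental one makes \<open>l\<close> a non-leader as required.\<close>

lemma good_step:
  assumes conn: "\<And>i u. Suc d \<le> mord u \<Longrightarrow> lconn (below d (lead i)) u"
    and c: "\<And>l'. l' \<in> lower l \<Longrightarrow> good d c l' (c l')"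
  shows "\<exists>v. good d c l v"
proof (cases "jord l \<le> d")
  case True
  have low: "c l' = bj l'" if "l' \<in> lower l" for l'
    using c[OF that] that True rk_less_imp_jord[of l' l] by (auto simp: good_def lower_def)
  then have img: "c ` lower l = bj ` lower l" by auto
  have "stage (c(l := bj l)) j (insert l (lower l)) (\<delta> j)" for j
  proof -
    have "stage (c(l := bj l)) j (insert l (lower l)) (\<delta> j) \<longleftrightarrow> stage bj j (insert l (lower l)) (\<delta> j)"
    proof (rule stage_cong)
      show "(c(l := bj l)) l' = bj l'" if "l' \<in> insert l (lower l)" for l' using that low by (cases "l' = l") simp_all
    qed (use shift_lowerD in blast)
    then show ?thesis by (simp add: stage_def der_\<delta> bj_shift)
  qed
  then have "good d c l (bj l)"
    using True gen_lead_low[of l d] unfolding good_def leader_def img by blast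
  then show ?thesis ..
next
  case False
  obtain i u where l: "l = (i, u)" by (cases l)
  have du: "Suc d \<le> mord u" using False by (simp add: l jord_def)
  have "\<exists>e. stage c j (lower l) e" for j by (rule stage_lower) (rule c)
  then obtain D where D: "\<And>j. stage c j (lower l) (D j)" by metis
  have Dder: "is_der (D j)" and Dk: "a \<in> k \<Longrightarrow> D j a = \<delta> j a"
    and Dc: "shift l' j \<in> lower l \<Longrightarrow> D j (c l') = c (shift l' j)" for j a l'
    using D[of j] unfolding stage_def by blast+
  have lead_iff: "gen_lead d l' \<longleftrightarrow> c l' \<in> dcl (k \<union> c ` lower l')" if "l' \<in> lower l" for l'
    using c[OF that] by (simp add: good_def)
  define p where "p j = (i, dec u j)" for j
  have shp: "shift (p j) j = l" if "u j > 0" for j using that by (simp add: p_def l shift_def)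
  have pl: "p j \<in> lower l" if "u j > 0" for j
    using rk_less_shift[of "p j" j] shp[OF that] by (simp add: lower_def)
  have lowp: "shift l' j \<in> lower l" if "u j > 0" "l' \<in> lower (p j)" for j l'
    using lower_shift[OF that(2), of j] shp[OF that(1)] by simp
  let ?I = "below d (lead i)"
  have gp: "gen_lead d (p j) \<longleftrightarrow> dec u j \<in> ?I" for j by (simp add: p_def gen_lead_def)
  text \<open>Commutators of the stage derivations vanish at the leader below both neighbours.\<close>
  have edge: "D j (c (p j)) = D j' (c (p j'))" if e: "(j, j') \<in> lnbr ?I u" for j j'
  proof -
    have jj: "j \<noteq> j'" "u j > 0" "u j' > 0" "dec (dec u j) j' \<in> ?I" using e by (auto simp: lnbr_def)
    define q where "q = (i, dec (dec u j) j')"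
    have q1: "shift q j' = p j" using jj by (simp add: q_def p_def shift_def dec_apply)
    have "dec (dec u j) j' = dec (dec u j') j" by (rule dec_commute)
    then have q2: "shift q j = p j'" using jj by (simp add: q_def p_def shift_def dec_apply)
    have ql: "q \<in> lower l"
      using rk_less_shift[of q j'] pl[OF jj(2)] unfolding q1 by (auto simp: lower_def)
    have qd: "c q \<in> dcl (k \<union> c ` lower q)" using lead_iff[OF ql] jj(4) by (simp add: gen_lead_def q_def)
    have zero: "D j (D j' a) - D j' (D j a) = 0" if a: "a \<in> k \<union> c ` lower q" for a
    proof (cases "a \<in> k")
      case True
      then show ?thesis using Dk k_stable comm[of j j' a] by simp
    next
      case False
      then obtain l' where l': "l' \<in> lower q" "a = c l'" using a by blast
      have s1: "shift l' j' \<in> lower (p j)" and s2: "shift l' j \<in> lower (p j')"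
        using lower_shift[OF l'(1), of j'] lower_shift[OF l'(1), of j] q1 q2 by simp_all
      have t: "shift (shift l' j') j = shift (shift l' j) j'"
        using jj(1) by (simp add: shift_def inc_def fun_upd_twist)
      have r1: "shift l' j' \<in> lower l" "shift l' j \<in> lower l"
        using lower_trans[OF s1 pl[OF jj(2)]] lower_trans[OF s2 pl[OF jj(3)]] by blast+
      have "D j (D j' a) = c (shift (shift l' j') j)"
        using Dc[OF r1(1)] Dc[OF lowp[OF jj(2) s1]] l'(2) by simp
      moreover have "D j' (D j a) = c (shift (shift l' j) j')"
        using Dc[OF r1(2)] Dc[OF lowp[OF jj(3) s2]] l'(2) by simp
      ultimately show ?thesis by (simp add: t)
    qed
    have "D j (D j' (c q)) - D j' (D j (c q)) = 0"
      using qd zero der_commutator[OF Dder[of j] Dder[of j']] unfolding dcl_def by blast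
    moreover have "D j' (c q) = c (p j)" "D j (c q) = c (p j')"
      using Dc[of q j'] Dc[of q j] pl jj unfolding q1 q2 by auto
    ultimately show ?thesis by simp
  qed
  have path: "D j (c (p j)) = D j' (c (p j'))" if "(j, j') \<in> (lnbr ?I u)\<^sup>*" for j j'
    using that by (induction rule: rtrancl_induct) (auto dest: edge)
  have agree: "D j (c (p j)) = D j' (c (p j'))"
    if "u j > 0" "dec u j \<in> ?I" "u j' > 0" "dec u j' \<in> ?I" for j j'
    using conn[OF du, of i] that path unfolding lconn_def by blast
  text \<open>Once the new value \<open>v\<close> is compatible at the leaders, the other derivations can be corrected.\<close>
  have extend: "\<exists>e. stage (c(l := v)) j (insert l (lower l)) e"
    if v: "\<And>j. u j > 0 \<Longrightarrow> dec u j \<in> ?I \<Longrightarrow> D j (c (p j)) = v" for v j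
  proof -
    have fix_l: "(c(l := v)) l' = c l'" if "l' \<in> lower l" for l' using that by (auto simp: lower_def)
    have red: "stage (c(l := v)) j (insert l (lower l)) e"
      if e: "is_der e" "\<forall>a\<in>k. e a = \<delta> j a" "\<And>l'. shift l' j \<in> lower l \<Longrightarrow> e (c l') = c (shift l' j)"
        "u j > 0 \<Longrightarrow> e (c (p j)) = v" for e
      unfolding stage_def
    proof (intro conjI allI impI e(1,2))
      fix l' assume s: "shift l' j \<in> insert l (lower l)"
      have ll: "l' \<in> lower l" using shift_lowerD[OF s] .
      show "e ((c(l := v)) l') = (c(l := v)) (shift l' j)"
      proof (cases "shift l' j = l")
        case True
        then have "u j > 0" "l' = p j" by (auto simp: l shift_def p_def inc_apply prod_eq_iff)
        then show ?thesis using e(4) True fix_l[OF ll] by simp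
      next
        case False
        then have "shift l' j \<in> lower l" using s by simp
        then show ?thesis using e(3) fix_l[OF ll] fix_l[of "shift l' j"] by simp
      qed
    qed
    show ?thesis
    proof (cases "u j > 0 \<and> dec u j \<notin> ?I")
      case False
      then show ?thesis using red[of "D j"] Dder Dk Dc v by blast
    next
      case True
      \<comment> \<open>As a non-leader, \<open>p j\<close> is moved by a derivation that kills
        \<open>k\<close> and all jets below it. Every other jet whose shift is already prescribed
        lies below \<open>p j\<close>, so a multiple of this derivation corrects \<open>D j\<close>
        at \<open>p j\<close> alone.\<close>
      then have "c (p j) \<notin> dcl (k \<union> c ` lower (p j))" using lead_iff[OF pl] gp by blast
      then obtain e where e: "is_der e" "\<And>a. a \<in> k \<union> c ` lower (p j) \<Longrightarrow> e a = 0" "e (c (p j)) = 1"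
        using not_dclD by blast
      let ?e = "\<lambda>x. D j x + (v - D j (c (p j))) * e x"
      have "stage (c(l := v)) j (insert l (lower l)) ?e"
      proof (rule red)
        show "is_der ?e" by (rule der_comb[OF Dder e(1)])
        show "\<forall>a\<in>k. ?e a = \<delta> j a" using Dk e(2) by simp
        show "?e (c (p j)) = v" using e(3) by simp
        fix l' assume s: "shift l' j \<in> lower l"
        then have "shift l' j \<in> lower (shift (p j) j)" using shp True by simp
        then have "l' \<in> lower (p j)" by (simp add: lower_def rk_less_shift_iff)
        then show "?e (c l') = c (shift l' j)" using e(2) Dc[OF s] by simp
      qed
      then show ?thesis by blast
    qed
  qed
  show ?thesis
  proof (cases "gen_lead d l")
    case True
    then obtain j where j: "u j > 0" "dec u j \<in> ?I"
      using below_pred[of u d "lead i"] du by (auto simp: gen_lead_def l)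
    define v where "v = D j (c (p j))"
    have "leader k c (p j)" using lead_iff[OF pl[OF j(1)]] gp j(2) by (simp add: leader_def)
    then have "v \<in> dcl (k \<union> c ` lower l)"
      using leader_derivative[of "D j" k "p j" c j] Dder Dk k_stable Dc lowp[OF j(1)] shp[OF j(1)]
      unfolding v_def by simp
    moreover have "D j' (c (p j')) = v" if "u j' > 0" "dec u j' \<in> ?I" for j'
      using agree[OF that j] by (simp add: v_def)
    ultimately have "good d c l v" using True False extend[of v] by (simp add: good_def)
    then show ?thesis ..
  next
    case nl: False
    obtain v where v: "v \<notin> dcl (k \<union> c ` lower l)" using transcendental[of "c ` lower l"] finite_lower by blast
    have "dec u j \<notin> ?I" if "u j > 0" for j
      using nl below_inc[of "dec u j" d "lead i" j] that by (auto simp: gen_lead_def l)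
    then have "good d c l v" using nl v False extend[of v] by (simp add: good_def)
    then show ?thesis ..
  qed
qed

text \<open>The values come from recursion along the ranking. The derivations of different stages
  need not be equal, but on each element of the ring generated by \<open>k\<close> and the jets all
  sufficiently late ones give the same result; this limit is single-valued and extends to the
  field.\<close>

theorem generic_jet:
  assumes conn: "\<And>i u. Suc d \<le> mord u \<Longrightarrow> lconn (below d (lead i)) u"
  obtains c D where "\<And>l. jord l \<le> d \<Longrightarrow> c l = bj l"
    and "\<And>l. leader k c l \<longleftrightarrow> gen_lead d l"
    and "\<And>j. is_der (D j)" and "\<And>j a. a \<in> k \<Longrightarrow> D j a = \<delta> j a"
    and "\<And>j l. D j (c l) = c (shift l j)"
proof -
  have "\<exists>c. \<forall>l. good d c l (c l)"
  proof (rule dependent_wf_choice[OF wf_rk])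
    fix f g :: "('n, 'm) jet \<Rightarrow> 'a" and l :: "('n, 'm) jet" and r :: 'a
    assume "\<And>z. (z, l) \<in> {(l, l'). rk l < rk l'} \<Longrightarrow> f z = g z"
    then show "good d f l r = good d g l r" by (intro good_cong) (simp add: lower_def)
  next
    fix l :: "('n, 'm) jet" and f :: "('n, 'm) jet \<Rightarrow> 'a"
    assume "\<And>y. (y, l) \<in> {(l, l'). rk l < rk l'} \<Longrightarrow> good d f y (f y)"
    then show "\<exists>r. good d f l r" by (intro good_step conn) (simp_all add: lower_def)
  qed
  then obtain c where c: "\<And>l. good d c l (c l)" by blast
  have "\<exists>e. is_der e \<and> (\<forall>a\<in>k. e a = \<delta> j a) \<and> (\<forall>l. e (c l) = c (shift l j))" for j
  proof -
    let ?S = "(\<lambda>a. (a, \<delta> j a)) ` k \<union> range (\<lambda>l. (c l, c (shift l j)))"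
    have loc: "\<exists>n. \<forall>e l. stage c j (lower l) e \<longrightarrow> n \<le> jord l \<longrightarrow> e x = y" if "(x, y) \<in> dgen ?S" for x y
      using that
    proof (induction "(x, y)" arbitrary: x y rule: dgen.induct)
      case dgen_base
      then consider "x \<in> k" "y = \<delta> j x" | l where "x = c l" "y = c (shift l j)" by blast
      then show ?case
      proof cases
        case 1
        then show ?thesis by (auto simp: stage_def)
      next
        case 2
        have "e (c l) = c (shift l j)" if "stage c j (lower l') e" "Suc (Suc (jord l)) \<le> jord l'" for e l'
        proof -
          have "shift l j \<in> lower l'" using that(2) rk_less_jord[of "shift l j" l'] by (simp add: lower_def)
          then show ?thesis using that(1) unfolding stage_def by blast
        qed
        then show ?thesis unfolding 2 by blast
      qed
    next
      case dgen_zero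
      show ?case by (auto simp: stage_def der_0)
    next
      case dgen_one
      show ?case by (auto simp: stage_def der_1)
    next
      case (dgen_add x y x' y')
      then obtain n n' where "\<And>e l. stage c j (lower l) e \<Longrightarrow> n \<le> jord l \<Longrightarrow> e x = y"
        "\<And>e l. stage c j (lower l) e \<Longrightarrow> n' \<le> jord l \<Longrightarrow> e x' = y'" by blast
      then show ?case by (intro exI[of _ "max n n'"]) (auto simp: stage_def der_add)
    next
      case (dgen_mult x y x' y')
      then obtain n n' where "\<And>e l. stage c j (lower l) e \<Longrightarrow> n \<le> jord l \<Longrightarrow> e x = y"
        "\<And>e l. stage c j (lower l) e \<Longrightarrow> n' \<le> jord l \<Longrightarrow> e x' = y'" by blast
      then show ?case by (intro exI[of _ "max n n'"]) (auto simp: stage_def der_mult)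
    next
      case (dgen_minus x y)
      then obtain n where "\<And>e l. stage c j (lower l) e \<Longrightarrow> n \<le> jord l \<Longrightarrow> e x = y" by blast
      then show ?case by (intro exI[of _ n]) (auto simp: stage_def der_minus)
    qed
    have "dsv (dgen ?S)"
      unfolding dsv_def
    proof (intro allI impI)
      fix y assume "(0, y) \<in> dgen ?S"
      from loc[OF this] obtain n where n: "\<And>e l. stage c j (lower l) e \<Longrightarrow> n \<le> jord l \<Longrightarrow> e 0 = y" by blast
      \<comment> \<open>Some jet of order at least \<open>n\<close>; \<open>undefined\<close> stands
        for an arbitrary coordinate and an arbitrary derivation.\<close>
      define l :: "('n, 'm) jet" where "l = (undefined, (\<lambda>_. 0)(undefined := n))"
      have "n \<le> jord l" using le_mord[of "snd l" undefined] by (simp add: jord_def l_def)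
      moreover obtain e where "stage c j (lower l) e" using stage_lower c by blast
      ultimately show "y = 0" using n[of l e] by (auto simp: stage_def der_0)
    qed
    from derivation_extension[OF dring_dgen this]
    obtain e where e: "is_der e" "\<And>x y. (x, y) \<in> dgen ?S \<Longrightarrow> e x = y" by force
    have "e a = \<delta> j a" if "a \<in> k" for a by (rule e(2)) (use that in \<open>auto intro: dgen_base\<close>)
    moreover have "e (c l) = c (shift l j)" for l by (rule e(2)) (auto intro: dgen_base)
    ultimately show ?thesis using e(1) by blast
  qed
  then obtain D where D: "\<And>j. is_der (D j)" "\<And>j a. a \<in> k \<Longrightarrow> D j a = \<delta> j a"
    "\<And>j l. D j (c l) = c (shift l j)" by metis
  show thesis
  proof (rule that[of c D])
    show "c l = bj l" if "jord l \<le> d" for l using c[of l] that by (simp add: good_def)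
    show "leader k c l \<longleftrightarrow> gen_lead d l" for l using c[of l] by (simp add: good_def leader_def)
  qed (use D in auto)
qed

end

subsection \<open>The generic solution specializes to the given point\<close>

lemma poly_sum_upto:
  fixes p :: "'a::field poly"
  shows "degree p \<le> n \<Longrightarrow> poly p x = (\<Sum>i\<le>n. coeff p i * x ^ i)"
  unfolding poly_altdef by (rule sum.mono_neutral_left) (auto intro: coeff_eq_0)

lemma degree_map_poly_le_der: "is_der f \<Longrightarrow> degree (map_poly f p) \<le> degree p"
  by (rule degree_le) (simp add: coeff_map_poly coeff_eq_0 der_0)

lemma pgen_fst: "x \<in> pgen ((\<lambda>a. (a, a)) ` k \<union> (\<lambda>l. (c l, b l)) ` A) \<Longrightarrow> fst x \<in> sgen (k \<union> c ` A)"
  by (induction rule: pgen.induct) (auto intro: sgen.intros)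

lemma pgen_adjoin:
  assumes "(x, y) \<in> pgen (insert (z, w) S)"
  shows "\<exists>p q. (\<forall>n. (coeff p n, coeff q n) \<in> pgen S) \<and> x = poly p z \<and> y = poly q w"
  using assms
proof (induction "(x, y)" arbitrary: x y rule: pgen.induct)
  case pgen_base
  then consider "x = z" "y = w" | "(x, y) \<in> S" by auto
  then show ?case
  proof cases
    case 1
    have "(coeff [:0, 1:] n, coeff [:0, 1:] n) \<in> pgen S" for n
      by (auto simp: coeff_pCons pgen_zero pgen_one split: nat.split)
    then show ?thesis using 1 by (intro exI[of _ "[:0, 1:]"]) simp
  next
    case 2
    then have "(coeff [:x:] n, coeff [:y:] n) \<in> pgen S" for n
      by (auto simp: coeff_pCons pgen_zero pgen.pgen_base split: nat.split)
    then show ?thesis by (intro exI[of _ "[:x:]"] exI[of _ "[:y:]"]) simp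
  qed
next
  case pgen_one
  have "(coeff 1 n, coeff 1 n) \<in> pgen S" for n
    by (simp add: coeff_1 pgen_zero pgen.pgen_one)
  then show ?case by (intro exI[of _ 1]) simp
next
  case (pgen_add x y x' y')
  then obtain p q p' q' where "\<forall>n. (coeff p n, coeff q n) \<in> pgen S" "x = poly p z" "y = poly q w"
    "\<forall>n. (coeff p' n, coeff q' n) \<in> pgen S" "x' = poly p' z" "y' = poly q' w" by blast
  then show ?case by (intro exI[of _ "p + p'"] exI[of _ "q + q'"]) (simp add: pgen.pgen_add)
next
  case (pgen_mult x y x' y')
  then obtain p q p' q' where *: "\<forall>n. (coeff p n, coeff q n) \<in> pgen S" "x = poly p z" "y = poly q w"
    "\<forall>n. (coeff p' n, coeff q' n) \<in> pgen S" "x' = poly p' z" "y' = poly q' w" by blast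
  have "(coeff (p * p') n, coeff (q * q') n) \<in> pgen S" for n
    unfolding coeff_mult by (intro pgen_sum pgen.pgen_mult) (use * in auto)
  then show ?case using * by (intro exI[of _ "p * p'"] exI[of _ "q * q'"]) simp
next
  case (pgen_minus x y)
  then obtain p q where "\<forall>n. (coeff p n, coeff q n) \<in> pgen S" "x = poly p z" "y = poly q w" by blast
  then show ?case by (intro exI[of _ "- p"] exI[of _ "- q"]) (simp add: pgen.pgen_minus)
qed

context diff_point
begin

context
  fixes c :: "('n, 'm) jet \<Rightarrow> 'a" and D :: "'m \<Rightarrow> 'a \<Rightarrow> 'a" and d :: nat
  assumes cb: "\<And>l. jord l \<le> d \<Longrightarrow> c l = bj l"
    and c_lead: "\<And>l. leader k c l \<longleftrightarrow> gen_lead d l"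
    and D_der: "\<And>j. is_der (D j)" and D_k: "\<And>j a. a \<in> k \<Longrightarrow> D j a = \<delta> j a"
    and D_c: "\<And>j l. D j (c l) = c (shift l j)"
begin

text \<open>The simultaneous values at \<open>c\<close> and at \<open>b\<close> of polynomials over
  \<open>k\<close> in the jets of \<open>Y\<close>. The goal is that it relates 0 to 0
  alone.\<close>

definition prel :: "('n, 'm) jet set \<Rightarrow> ('a \<times> 'a) set" where
  "prel Y = pgen ((\<lambda>a. (a, a)) ` k \<union> (\<lambda>l. (c l, bj l)) ` Y)"

lemma prel_mono: "Y \<subseteq> Z \<Longrightarrow> prel Y \<subseteq> prel Z"
  unfolding prel_def by (intro pgen_mono) auto

lemma prel_k: "a \<in> k \<Longrightarrow> (a, a) \<in> prel Y"
  unfolding prel_def by (auto intro: pgen_base)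

lemma prel_jet: "l \<in> Y \<Longrightarrow> (c l, bj l) \<in> prel Y"
  unfolding prel_def by (auto intro: pgen_base)

lemma prel_der:
  assumes "(x, y) \<in> prel Y" and Z: "Y \<subseteq> Z" "\<And>l. l \<in> Y \<Longrightarrow> shift l j \<in> Z"
  shows "(D j x, \<delta> j y) \<in> prel Z"
  using assms(1) unfolding prel_def
proof (induction "(x, y)" arbitrary: x y rule: pgen.induct)
  case pgen_base
  then consider "x \<in> k" "y = x" | l where "l \<in> Y" "x = c l" "y = bj l" by auto
  then show ?case unfolding prel_def[symmetric]
  proof cases
    case 1
    then show "(D j x, \<delta> j y) \<in> prel Z" using prel_k[OF k_stable] by (simp add: D_k)
  next
    case 2
    then show "(D j x, \<delta> j y) \<in> prel Z" using prel_jet[OF Z(2)] by (simp add: D_c bj_shift)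
  qed
next
  case pgen_one
  then show ?case by (simp add: der_1[OF D_der] der_1[OF der_\<delta>] pgen_zero)
next
  case (pgen_add x y x' y')
  then show ?case by (simp add: der_add[OF D_der] der_add[OF der_\<delta>] pgen.pgen_add)
next
  case (pgen_mult x y x' y')
  have "(x, y) \<in> prel Z" "(x', y') \<in> prel Z"
    using pgen_mult(1,3) prel_mono[OF Z(1)] unfolding prel_def by blast+
  then show ?case using pgen_mult(2,4) unfolding prel_def
    by (simp add: der_mult[OF D_der] der_mult[OF der_\<delta>]) (intro pgen.pgen_add pgen.pgen_mult)
next
  case (pgen_minus x y)
  then show ?case by (simp add: der_minus[OF D_der] der_minus[OF der_\<delta>] pgen.pgen_minus)
qed

lemma prel_low: "x \<in> sgen (k \<union> bj ` Y) \<Longrightarrow> (\<And>l. l \<in> Y \<Longrightarrow> jord l \<le> d) \<Longrightarrow> (x, x) \<in> prel Y"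
  unfolding prel_def
proof (induction rule: sgen.induct)
  case (sgen_base x)
  then consider "x \<in> k" | l where "l \<in> Y" "x = bj l" by auto
  then show ?case
  proof cases
    case 2
    then have "(x, x) = (c l, bj l)" using cb[of l] sgen_base(2) by simp
    then show ?thesis using prel_jet[OF 2(1)] unfolding prel_def by metis
  qed (auto intro: pgen_base)
qed (auto intro: pgen.intros)

lemma prel_low_diag:
  assumes "(x, y) \<in> prel Y" "\<And>l. l \<in> Y \<Longrightarrow> jord l \<le> d"
  shows "x = y"
  using assms(1) unfolding prel_def
  by (induction "(x, y)" arbitrary: x y rule: pgen.induct) (auto simp: cb assms(2))

text \<open>The values of \<open>c\<close> at leaders beyond order \<open>d\<close> are polynomial in the lower ones, up to a separant
  of order at most \<open>d\<close>, where \<open>c\<close> and \<open>b\<close> agree.\<close>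

lemma leader_linear:
  assumes "jord l > d" "gen_lead d l"
  shows "\<exists>s. s \<noteq> 0 \<and> (s, s) \<in> prel {l. jord l \<le> d} \<and> (s * c l, s * bj l) \<in> prel (lower l)"
  using assms
proof (induction l rule: rk_induct)
  case (less l)
  have "mord (snd l) > d" using less.prems by (simp add: jord_def)
  then obtain j where j: "snd l j > 0" "dec (snd l) j \<in> below d (lead (fst l))"
    using below_pred less.prems(2) unfolding gen_lead_def by blast
  define m where "m = (fst l, dec (snd l) j)"
  have sh: "shift m j = l" using j(1) by (simp add: m_def shift_def)
  have g: "gen_lead d m" using j(2) by (simp add: gen_lead_def m_def)
  have ml: "rk m < rk l" using rk_less_shift[of m j] sh by simp
  have ord: "jord l = Suc (jord m)" using jord_shift[of m j] sh by simp
  have low: "lower m \<subseteq> lower l" "\<And>l'. l' \<in> lower m \<Longrightarrow> shift l' j \<in> lower l"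
    using ml lower_mono[of m l] lower_shift[of _ m j] sh by auto
  have mm: "m \<in> lower l" using ml by (simp add: lower_def)
  show ?case
  proof (cases "jord m \<le> d")
    case True
    have ordm: "jord l' \<le> d" if "l' \<in> lower m" for l'
      using that True rk_less_imp_jord[of l' m] by (simp add: lower_def)
    let ?A = "sgen (k \<union> bj ` lower m)"
    have "leader k bj m" using g gen_lead_low[OF True] by simp
    then have "algebraic_over ?A (bj m)" by (simp add: leader_def dcl_algebraic)
    \<comment> \<open>Differentiating an algebraic equation \<open>p\<close> of the leader
      \<open>m\<close> gives an equation linear in \<open>l\<close> whose coefficient is the
      separant. It holds alike for \<open>c\<close> with \<open>D j\<close> and for \<open>b\<close>
      with \<open>\<delta> j\<close>, because both agree up to order \<open>d\<close>.\<close>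
    from algebraic_separable[OF sring_sgen this]
    obtain p where p: "\<And>n. coeff p n \<in> ?A" "poly p (bj m) = 0" "poly (pderiv p) (bj m) \<noteq> 0" by blast
    define s where "s = poly (pderiv p) (bj m)"
    have "s \<in> sgen (k \<union> bj ` {l. jord l \<le> d})"
    proof -
      have "?A \<subseteq> sgen (k \<union> bj ` {l. jord l \<le> d})" using ordm by (intro sgen_mono) auto
      moreover have "coeff (pderiv p) n \<in> ?A" for n
        unfolding coeff_pderiv by (intro sgen_mult p(1) sring_of_nat sring_sgen)
      ultimately have cf: "coeff (pderiv p) n \<in> sgen (k \<union> bj ` {l. jord l \<le> d})" for n by blast
      have bm: "bj m \<in> sgen (k \<union> bj ` {l. jord l \<le> d})" using True by (auto intro: sgen_base)
      have pw: "bj m ^ n \<in> sgen (k \<union> bj ` {l. jord l \<le> d})" for n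
        by (induction n) (auto intro: sgen_one sgen_mult bm)
      show ?thesis unfolding s_def poly_altdef by (intro sring_sum sring_sgen sgen_mult cf pw)
    qed
    then have sd: "(s, s) \<in> prel {l. jord l \<le> d}" by (rule prel_low) simp
    have "(poly (map_poly (D j) p) (bj m), poly (map_poly (\<delta> j) p) (bj m)) \<in> prel (lower l)"
    proof -
      have "(D j (coeff p n), \<delta> j (coeff p n)) \<in> prel (lower l)" for n
        by (rule prel_der[OF prel_low[OF p(1) ordm] low])
      moreover have "(bj m, bj m) \<in> prel (lower l)" using prel_jet[OF mm] cb[OF True] by simp
      ultimately have "((\<Sum>n\<le>degree p. D j (coeff p n) * bj m ^ n), (\<Sum>n\<le>degree p. \<delta> j (coeff p n) * bj m ^ n))
          \<in> prel (lower l)"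
        unfolding prel_def by (intro pgen_sum pgen_mult pgen_power)
      then show ?thesis
        using poly_sum_upto[OF degree_map_poly_le_der[OF D_der]]
          poly_sum_upto[OF degree_map_poly_le_der[OF der_\<delta>]]
        by (simp add: coeff_map_poly der_0[OF D_der] der_0[OF der_\<delta>])
    qed
    moreover have "s * c l = - poly (map_poly (D j) p) (bj m)"
      using der_poly[OF D_der[of j], of p "bj m"] p(2) D_c[of j m] cb[OF True]
      by (simp add: der_0[OF D_der] s_def sh eq_neg_iff_add_eq_0 add.commute)
    moreover have "s * bj l = - poly (map_poly (\<delta> j) p) (bj m)"
      using der_poly[OF der_\<delta>[of j], of p "bj m"] p(2) bj_shift[of j m]
      by (simp add: der_0[OF der_\<delta>] s_def sh eq_neg_iff_add_eq_0 add.commute)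
    ultimately have "(s * c l, s * bj l) \<in> prel (lower l)" unfolding prel_def by (simp add: pgen_minus)
    then show ?thesis using sd p(3) s_def by blast
  next
    case False
    \<comment> \<open>The linear equation for \<open>m\<close> is differentiated once more. The
      extra Leibniz term contains the derivative of \<open>s\<close>, which only involves jets below
      \<open>l\<close>, so \<open>s\<close> remains the coefficient.\<close>
    then obtain s where s: "s \<noteq> 0" "(s, s) \<in> prel {l. jord l \<le> d}" "(s * c m, s * bj m) \<in> prel (lower m)"
      using less.IH[OF ml _ g] by auto
    have less_l: "l' \<in> lower l" if "jord l' < jord l" for l'
      using rk_less_jord[OF that] by (simp add: lower_def)
    have lo: "{l. jord l \<le> d} \<subseteq> lower l" "\<And>l'. l' \<in> {l. jord l \<le> d} \<Longrightarrow> shift l' j \<in> lower l"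
      using False ord by (auto intro!: less_l)
    have "(D j (s * c m), \<delta> j (s * bj m)) \<in> prel (lower l)" by (rule prel_der[OF s(3) low])
    moreover have "(D j s, \<delta> j s) \<in> prel (lower l)" by (rule prel_der[OF s(2) lo])
    moreover have "(c m, bj m) \<in> prel (lower l)" by (rule prel_jet[OF mm])
    ultimately have "(D j (s * c m) - D j s * c m, \<delta> j (s * bj m) - \<delta> j s * bj m) \<in> prel (lower l)"
      unfolding prel_def by (rule pgen_diff[OF _ pgen_mult])
    moreover have "D j (s * c m) - D j s * c m = s * c l"
      by (simp add: der_mult[OF D_der] D_c sh)
    moreover have "\<delta> j (s * bj m) - \<delta> j s * bj m = s * bj l"
      by (simp add: der_mult[OF der_\<delta>] bj_shift sh)
    ultimately show ?thesis using s by auto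
  qed
qed

text \<open>The highest jet \<open>m\<close> is eliminated. If it is a leader beyond order
  \<open>d\<close>, multiplying by a power of the separant \<open>s\<close> leads to a relation
  below \<open>m\<close>, and \<open>s\<close> is nonzero and related to itself. If it is a
  non-leader, \<open>c m\<close> is transcendental over the lower jets, so the relation at
  \<open>c\<close> holds coefficientwise and the induction hypothesis kills each coefficient at
  \<open>b\<close>.\<close>

lemma prel_single_valued: "(0, y) \<in> prel (lower l) \<Longrightarrow> y = 0"
proof (induction l arbitrary: y rule: rk_induct)
  case (less l)
  show ?case
  proof (cases "lower l = {}")
    case True
    then show ?thesis using prel_low_diag[OF less.prems] by simp
  next
    case False
    then obtain m where m: "lower l = insert m (lower m)" "m \<in> lower l" by (rule lower_max)
    have IH: "y = 0" if "(0, y) \<in> prel (lower m)" for y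
      using less.IH[OF _ that] m(2) by (simp add: lower_def)
    have eq: "prel (lower l) = pgen (insert (c m, bj m) ((\<lambda>a. (a, a)) ` k \<union> (\<lambda>l. (c l, bj l)) ` lower m))"
      unfolding prel_def m(1) by simp
    consider "jord m \<le> d" | "jord m > d" "gen_lead d m" | "jord m > d" "\<not> gen_lead d m" by linarith
    then show ?thesis
    proof cases
      case 1
      have "jord l' \<le> d" if "l' \<in> lower l" for l'
      proof -
        have "l' = m \<or> l' \<in> lower m" using that m(1) by blast
        then show ?thesis using 1 rk_less_imp_jord[of l' m] by (auto simp: lower_def)
      qed
      then show ?thesis using prel_low_diag[OF less.prems] by simp
    next
      case 2
      then obtain s where s: "s \<noteq> 0" "(s, s) \<in> prel {l. jord l \<le> d}" "(s * c m, s * bj m) \<in> prel (lower m)"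
        using leader_linear by blast
      have "{l. jord l \<le> d} \<subseteq> lower m"
      proof
        fix l :: "('n, 'm) jet" assume "l \<in> {l. jord l \<le> d}"
        then show "l \<in> lower m" using 2(1) rk_less_jord[of l m] by (simp add: lower_def)
      qed
      then have ss: "(s, s) \<in> prel (lower m)" using s(2) prel_mono by blast
      have "\<exists>N. (s ^ N * x, s ^ N * y) \<in> prel (lower m)" if "(x, y) \<in> prel (lower l)" for x y
        using that unfolding eq
      proof (induction "(x, y)" arbitrary: x y rule: pgen.induct)
        case pgen_base
        then consider "x = c m" "y = bj m" | "(x, y) \<in> (\<lambda>a. (a, a)) ` k \<union> (\<lambda>l. (c l, bj l)) ` lower m" by auto
        then show ?case
        proof cases
          case 1
          then show ?thesis using s(3) by (intro exI[of _ 1]) simp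
        next
          case 2
          then show ?thesis by (intro exI[of _ 0]) (simp add: prel_def pgen.pgen_base)
        qed
      next
        case pgen_one
        show ?case by (intro exI[of _ 0]) (simp add: prel_def pgen.pgen_one)
      next
        case (pgen_add x y x' y')
        then obtain N N' where N: "(s ^ N * x, s ^ N * y) \<in> prel (lower m)" "(s ^ N' * x', s ^ N' * y') \<in> prel (lower m)"
          by blast
        have "(s ^ N' * (s ^ N * x) + s ^ N * (s ^ N' * x'), s ^ N' * (s ^ N * y) + s ^ N * (s ^ N' * y')) \<in> prel (lower m)"
          
          using pgen.pgen_add[OF pgen.pgen_mult[OF pgen_power N(1)[unfolded prel_def]]
              pgen.pgen_mult[OF pgen_power N(2)[unfolded prel_def]], OF ss[unfolded prel_def] ss[unfolded prel_def]]
          unfolding prel_def .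
        then show ?case by (intro exI[of _ "N + N'"]) (simp add: power_add algebra_simps)
      next
        case (pgen_mult x y x' y')
        then obtain N N' where N: "(s ^ N * x, s ^ N * y) \<in> prel (lower m)" "(s ^ N' * x', s ^ N' * y') \<in> prel (lower m)"
          by blast
        have "((s ^ N * x) * (s ^ N' * x'), (s ^ N * y) * (s ^ N' * y')) \<in> prel (lower m)"
          using N unfolding prel_def by (rule pgen.pgen_mult)
        then show ?case by (intro exI[of _ "N + N'"]) (simp add: power_add algebra_simps)
      next
        case (pgen_minus x y)
        then obtain N where N: "(s ^ N * x, s ^ N * y) \<in> prel (lower m)" by blast
        then have "(- (s ^ N * x), - (s ^ N * y)) \<in> prel (lower m)"
          unfolding prel_def by (rule pgen.pgen_minus)
        then show ?case by (intro exI[of _ N]) simp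
      qed
      from this[OF less.prems] obtain N where "(s ^ N * 0, s ^ N * y) \<in> prel (lower m)" by blast
      then have "(0, s ^ N * y) \<in> prel (lower m)" by simp
      then have "s ^ N * y = 0" by (rule IH)
      then show ?thesis using s(1) by simp
    next
      case 3
      then have "\<not> leader k c m" using c_lead by blast
      then have na: "\<not> algebraic_over (sgen (k \<union> c ` lower m)) (c m)" by (simp add: leader_def dcl_algebraic)
      obtain p q where pq: "\<And>n. (coeff p n, coeff q n) \<in> prel (lower m)" "0 = poly p (c m)" "y = poly q (bj m)"
        using pgen_adjoin[OF less.prems[unfolded eq]] unfolding prel_def by blast
      have "coeff p n \<in> sgen (k \<union> c ` lower m)" for n
        using pgen_fst[of "(coeff p n, coeff q n)"] pq(1)[of n] unfolding prel_def by simp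
      then have "p = 0" using na pq(2) unfolding algebraic_over_def by metis
      then have "coeff q n = 0" for n using IH pq(1)[of n] by simp
      then have "q = 0" by (simp add: poly_eq_iff)
      then show ?thesis using pq(3) by simp
    qed
  qed
qed

theorem specialization:
  assumes p: "p \<in> mp_ring k UNIV" and 0: "mp_eval c p = 0"
  shows "mp_eval bj p = 0"
proof -
  define n where "n = Suc (Max (insert 0 (jord ` mp_vars p)))"
  have fin: "finite (mp_vars p)" by (auto simp: mp_vars_def)
  define l :: "('n, 'm) jet" where "l = (undefined, (\<lambda>_. 0)(undefined := n))"
  have n: "n \<le> jord l" using le_mord[of "snd l" undefined] by (simp add: jord_def l_def)
  have "mp_vars p \<subseteq> lower l"
  proof
    fix v assume "v \<in> mp_vars p"
    then have "jord v < n" using fin by (auto simp: n_def less_Suc_eq_le intro: Max_ge)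
    then show "v \<in> lower l" using n rk_less_jord[of v l] by (simp add: lower_def)
  qed
  then have "p \<in> mp_ring k (lower l)" using p by (auto simp: mp_ring_def)
  then have "(mp_eval c p, mp_eval bj p) \<in> prel (lower l)"
    unfolding prel_def pgen_mp_eval[OF k_ring] by blast
  then show ?thesis using prel_single_valued 0 by simp
qed

end

end

section \<open>Model theory: power series solutions and their realization by points of the
  field\<close>

section \<open>Multivariate formal power series\<close>

typedef (overloaded) ('m, 'a) mps = "UNIV :: (('m \<Rightarrow> nat) \<Rightarrow> 'a) set"
  morphisms mcoeff Abs_mps ..

setup_lifting type_definition_mps

lemma mps_eqI: "(\<And>u. mcoeff f u = mcoeff g u) \<Longrightarrow> f = g"
  by (simp add: mcoeff_inject[symmetric] fun_eq_iff)

definition madd :: "('m \<Rightarrow> nat) \<Rightarrow> ('m \<Rightarrow> nat) \<Rightarrow> 'm \<Rightarrow> nat" where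
  "madd u v = (\<lambda>j. u j + v j)"

definition splits :: "('m \<Rightarrow> nat) \<Rightarrow> (('m \<Rightarrow> nat) \<times> ('m \<Rightarrow> nat)) set" where
  "splits u = {(v, w). madd v w = u}"

lemma finite_splits: "finite (splits (u :: 'm::finite \<Rightarrow> nat))"
proof (rule finite_subset)
  show "splits u \<subseteq> (\<Union>d\<le>mord u. mons UNIV d) \<times> (\<Union>d\<le>mord u. mons UNIV d)"
    by (auto simp: splits_def mons_def intro!: mord_mono) (auto simp: le_fun_def madd_def)
qed (auto simp: finite_mons)

lemma madd_0: "madd v w = (\<lambda>_. 0) \<longleftrightarrow> v = (\<lambda>_. 0) \<and> w = (\<lambda>_. 0)"
  by (auto simp: madd_def fun_eq_iff)

lemma splits_0: "splits (\<lambda>_. 0) = {(\<lambda>_. 0, \<lambda>_. 0)}"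
  by (auto simp: splits_def madd_0)

instantiation mps :: (finite, comm_ring_1) comm_ring_1
begin

lift_definition zero_mps :: "('a, 'b) mps" is "\<lambda>_. 0" .
lift_definition one_mps :: "('a, 'b) mps" is "\<lambda>u. if u = (\<lambda>_. 0) then 1 else 0" .
lift_definition plus_mps :: "('a, 'b) mps \<Rightarrow> ('a, 'b) mps \<Rightarrow> ('a, 'b) mps" is "\<lambda>f g u. f u + g u" .
lift_definition minus_mps :: "('a, 'b) mps \<Rightarrow> ('a, 'b) mps \<Rightarrow> ('a, 'b) mps" is "\<lambda>f g u. f u - g u" .
lift_definition uminus_mps :: "('a, 'b) mps \<Rightarrow> ('a, 'b) mps" is "\<lambda>f u. - f u" .
lift_definition times_mps :: "('a, 'b) mps \<Rightarrow> ('a, 'b) mps \<Rightarrow> ('a, 'b) mps" is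
  "\<lambda>f g u. \<Sum>(v, w)\<in>splits u. f v * g w" .

instance
proof
  fix f g h :: "('a, 'b) mps"
  have comm: "f * g = g * f" for f g :: "('a, 'b) mps"
  proof (transfer, rule ext)
    fix f g :: "('a \<Rightarrow> nat) \<Rightarrow> 'b" and u
    show "(\<Sum>(v, w)\<in>splits u. f v * g w) = (\<Sum>(v, w)\<in>splits u. g v * f w)"
      by (rule sum.reindex_bij_witness[of _ prod.swap prod.swap])
        (auto simp: splits_def madd_def add.commute mult.commute)
  qed
  then show "f * g = g * f" .
  show "f * g * h = f * (g * h)"
  proof (transfer, rule ext)
    fix f g h :: "('a \<Rightarrow> nat) \<Rightarrow> 'b" and u
    have "(\<Sum>(v, w)\<in>splits u. (\<Sum>(x, y)\<in>splits v. f x * g y) * h w)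
        = (\<Sum>((v, w), (x, y))\<in>(SIGMA p:splits u. splits (fst p)). f x * g y * h w)"
      by (subst sum.Sigma[symmetric]) (auto simp: finite_splits sum_distrib_right intro!: sum.cong)
    also have "\<dots> = (\<Sum>((v, w), (x, y))\<in>(SIGMA p:splits u. splits (snd p)). f v * (g x * h y))"
      by (rule sum.reindex_bij_witness[of _ "\<lambda>((v, w), (x, y)). ((madd v x, y), (v, x))"
            "\<lambda>((v, w), (x, y)). ((x, madd y w), (y, w))"])
        (auto simp: splits_def madd_def add.assoc mult.assoc)
    also have "\<dots> = (\<Sum>(v, w)\<in>splits u. f v * (\<Sum>(x, y)\<in>splits w. g x * h y))"
      by (subst sum.Sigma[symmetric]) (auto simp: finite_splits sum_distrib_left intro!: sum.cong)
    finally show "(\<Sum>(v, w)\<in>splits u. (\<Sum>(x, y)\<in>splits v. f x * g y) * h w)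
        = (\<Sum>(v, w)\<in>splits u. f v * (\<Sum>(x, y)\<in>splits w. g x * h y))" .
  qed
  show "1 * f = f"
  proof (transfer, rule ext)
    fix f :: "('a \<Rightarrow> nat) \<Rightarrow> 'b" and u
    have "(\<Sum>(v, w)\<in>splits u. (if v = (\<lambda>_. 0) then 1 else 0) * f w)
        = (\<Sum>p\<in>splits u. if p = (\<lambda>_. 0, u) then f u else 0)"
    proof (rule sum.cong)
      fix p assume "p \<in> splits u"
      then obtain v w where p: "p = (v, w)" "madd v w = u" by (auto simp: splits_def)
      then have "v = (\<lambda>_. 0) \<Longrightarrow> w = u" by (auto simp: madd_def)
      then show "(case p of (v, w) \<Rightarrow> (if v = (\<lambda>_. 0) then 1 else 0) * f w)
          = (if p = (\<lambda>_. 0, u) then f u else 0)"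
        using p(1) by simp
    qed simp
    also have "\<dots> = f u" by (simp add: finite_splits) (simp add: splits_def madd_def)
    finally show "(\<Sum>(v, w)\<in>splits u. (if v = (\<lambda>_. 0) then 1 else 0) * f w) = f u" .
  qed
  show "(f + g) * h = f * h + g * h"
    by (transfer, rule ext) (simp add: distrib_right sum.distrib case_prod_unfold)
  show "(0 :: ('a, 'b) mps) \<noteq> 1"
    by transfer (auto simp: fun_eq_iff)
qed (transfer; auto simp: algebra_simps)+

end

lemma mcoeff_mult: "mcoeff (f * g) u = (\<Sum>(v, w)\<in>splits u. mcoeff f v * mcoeff g w)"
  by (simp add: times_mps.rep_eq)

lemma mcoeff_mult_0: "mcoeff (f * g) (\<lambda>_. 0) = mcoeff f (\<lambda>_. 0) * mcoeff g (\<lambda>_. 0)"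
  by (simp add: mcoeff_mult splits_0)

text \<open>Lexicographic order on exponents, used to single out a lowest term.\<close>

definition mkey :: "('m::finite \<Rightarrow> nat) \<Rightarrow> nat \<Rightarrow>\<^sub>0 nat" where
  "mkey u = (\<Sum>j\<in>UNIV. Poly_Mapping.single (idx j) (u j))"

lemma lookup_mkey: "Poly_Mapping.lookup (mkey u) (idx j) = u j"
proof -
  have "(\<Sum>i\<in>UNIV. Poly_Mapping.lookup (Poly_Mapping.single (idx i) (u i)) (idx j))
      = (\<Sum>i\<in>UNIV. if i = j then u j else 0)"
    by (rule sum.cong) (auto simp: lookup_single when_def)
  then show ?thesis by (simp add: mkey_def lookup_sum)
qed

lemma mkey_inj: "mkey u = mkey v \<longleftrightarrow> u = v"
  by (metis lookup_mkey ext)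

lemma mkey_madd: "mkey (madd u v) = mkey u + mkey v"
  by (simp add: mkey_def madd_def single_add sum.distrib)

lemma lowest_exists:
  fixes f :: "('m::finite, 'a::zero) mps"
  assumes "mcoeff f u \<noteq> 0"
  shows "\<exists>v. mcoeff f v \<noteq> 0 \<and> (\<forall>w. mcoeff f w \<noteq> 0 \<longrightarrow> mord v < mord w \<or> mord v = mord w \<and> mkey v \<le> mkey w)"
proof -
  define d where "d = (LEAST d. \<exists>v. mcoeff f v \<noteq> 0 \<and> mord v = d)"
  have ex: "\<exists>v. mcoeff f v \<noteq> 0 \<and> mord v = d"
    unfolding d_def by (rule LeastI[of _ "mord u"]) (use assms in auto)
  have d: "d \<le> mord v" if "mcoeff f v \<noteq> 0" for v
    unfolding d_def by (rule Least_le) (use that in auto)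
  let ?S = "{v. mcoeff f v \<noteq> 0 \<and> mord v = d}"
  have fin: "finite ?S" by (rule finite_subset[OF _ finite_mons[of UNIV d]]) (auto simp: mons_def)
  then have "Min (mkey ` ?S) \<in> mkey ` ?S" using ex by (intro Min_in) auto
  then obtain v where v: "v \<in> ?S" "mkey v = Min (mkey ` ?S)" by auto
  have "mkey v \<le> mkey w" if "w \<in> ?S" for w using fin that by (simp add: v(2))
  then have "mord v < mord w \<or> mord v = mord w \<and> mkey v \<le> mkey w" if "mcoeff f w \<noteq> 0" for w
    using v(1) d[OF that] that by (cases "mord w = d") auto
  then show ?thesis using v(1) by blast
qed

lemma mord_madd: "mord (madd u v) = mord u + mord v"
  by (simp add: mord_def madd_def sum.distrib)

text \<open>The product of the two lowest terms survives: \<open>mord\<close> and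
  \<open>mkey\<close> are additive, so no other splitting of its exponent has both parts in the
  supports.\<close>

instance mps :: (finite, idom) idom
proof
  fix f g :: "('a, 'b) mps"
  assume fg: "f \<noteq> 0" "g \<noteq> 0"
  have "\<exists>u. mcoeff h u \<noteq> 0" if "h \<noteq> 0" for h :: "('a, 'b) mps"
    using that mps_eqI[of h 0] by (auto simp: zero_mps.rep_eq)
  then obtain a' b' where nz: "mcoeff f a' \<noteq> 0" "mcoeff g b' \<noteq> 0" using fg by meson
  obtain a where a: "mcoeff f a \<noteq> 0"
      "\<And>w. mcoeff f w \<noteq> 0 \<Longrightarrow> mord a < mord w \<or> mord a = mord w \<and> mkey a \<le> mkey w"
    using lowest_exists[OF nz(1)] by auto
  obtain b where b: "mcoeff g b \<noteq> 0"
      "\<And>w. mcoeff g w \<noteq> 0 \<Longrightarrow> mord b < mord w \<or> mord b = mord w \<and> mkey b \<le> mkey w"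
    using lowest_exists[OF nz(2)] by auto
  have zero: "mcoeff f v * mcoeff g w = 0" if "(v, w) \<in> splits (madd a b)" "(v, w) \<noteq> (a, b)" for v w
  proof (rule ccontr)
    assume "mcoeff f v * mcoeff g w \<noteq> 0"
    then have nz: "mcoeff f v \<noteq> 0" "mcoeff g w \<noteq> 0" by auto
    have s: "madd v w = madd a b" using that(1) by (simp add: splits_def)
    have o: "mord v + mord w = mord a + mord b" using s mord_madd by metis
    have k: "mkey v + mkey w = mkey a + mkey b" using s mkey_madd by metis
    have av: "mkey a \<le> mkey v" and bw: "mkey b \<le> mkey w" using a(2)[OF nz(1)] b(2)[OF nz(2)] o by auto
    have "mkey v = mkey a \<and> mkey w = mkey b"
    proof (rule ccontr)
      assume "\<not> ?thesis"
      then have "mkey a < mkey v \<or> mkey b < mkey w" using av bw by (auto simp: order.strict_iff_order)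
      then have "mkey a + mkey b < mkey v + mkey w"
        using av bw add_less_le_mono add_le_less_mono by blast
      then show False using k by simp
    qed
    then show False using that(2) by (simp add: mkey_inj)
  qed
  have "mcoeff (f * g) (madd a b) = (\<Sum>(v, w)\<in>{(a, b)}. mcoeff f v * mcoeff g w)"
    unfolding mcoeff_mult
  proof (rule sum.mono_neutral_right)
    show "\<forall>p\<in>splits (madd a b) - {(a, b)}. (case p of (v, w) \<Rightarrow> mcoeff f v * mcoeff g w) = 0"
      using zero by fast
  qed (auto simp: finite_splits, simp add: splits_def)
  then have "mcoeff (f * g) (madd a b) \<noteq> 0" using a(1) b(1) by simp
  then show "f * g \<noteq> 0" by (auto simp: zero_mps.rep_eq)
qed

lift_definition mderiv :: "'m \<Rightarrow> ('m, 'a::comm_ring_1) mps \<Rightarrow> ('m, 'a) mps" is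
  "\<lambda>j f u. of_nat (Suc (u j)) * f (inc u j)" .

lemma mcoeff_mderiv: "mcoeff (mderiv j f) u = of_nat (Suc (u j)) * mcoeff f (inc u j)"
  by (simp add: mderiv.rep_eq)

lemma mderiv_add: "mderiv j (f + g) = mderiv j f + mderiv j g"
  by (rule mps_eqI) (simp add: mcoeff_mderiv plus_mps.rep_eq algebra_simps)

lemma mderiv_commute: "mderiv i (mderiv j f) = mderiv j (mderiv i f)"
proof (rule mps_eqI)
  fix u
  have "inc (inc u i) j = inc (inc u j) i" by (auto simp: inc_def fun_eq_iff)
  then show "mcoeff (mderiv i (mderiv j f)) u = mcoeff (mderiv j (mderiv i f)) u"
    by (cases "i = j") (simp_all add: mcoeff_mderiv inc_apply algebra_simps)
qed

text \<open>Along each splitting of the exponent the factor \<open>Suc (u j)\<close> is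
  \<open>v j + w j\<close>. By \<open>half\<close>, each of the two summands is a product with one
  factor differentiated, after an index shift.\<close>

lemma mderiv_mult: "mderiv j (f * g) = mderiv j f * g + f * mderiv j g"
proof (rule mps_eqI)
  fix u
  let ?S = "splits (inc u j)"
  have half: "(\<Sum>(v, w)\<in>?S. of_nat (v j) * (F v * G w))
      = (\<Sum>(v, w)\<in>splits u. of_nat (Suc (v j)) * F (inc v j) * G w)" for F G :: "_ \<Rightarrow> 'b"
  proof -
    have "(\<Sum>(v, w)\<in>?S. of_nat (v j) * (F v * G w))
        = (\<Sum>(v, w)\<in>{(v, w) \<in> ?S. v j > 0}. of_nat (v j) * (F v * G w))"
      by (rule sum.mono_neutral_right) (auto simp: finite_splits intro: gr0I)
    also have "\<dots> = (\<Sum>(v, w)\<in>splits u. of_nat (Suc (v j)) * F (inc v j) * G w)"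
    proof (rule sum.reindex_bij_witness[of _ "\<lambda>(v, w). (inc v j, w)" "\<lambda>(v, w). (dec v j, w)"])
      fix p assume p: "p \<in> {(v, w) \<in> ?S. v j > 0}"
      obtain v w where vw: "p = (v, w)" by (cases p)
      have e: "madd v w = inc u j" "v j > 0" using p vw by (auto simp: splits_def)
      show "(case case p of (v, w) \<Rightarrow> (dec v j, w) of (v, w) \<Rightarrow> (inc v j, w)) = p"
        using e by (simp add: vw)
      have "madd (dec v j) w = u"
      proof
        fix i show "madd (dec v j) w i = u i"
          using fun_cong[OF e(1), of i] e(2) by (auto simp: madd_def dec_apply inc_apply split: if_splits)
      qed
      then show "(case p of (v, w) \<Rightarrow> (dec v j, w)) \<in> splits u" by (simp add: vw splits_def)
      show "(case case p of (v, w) \<Rightarrow> (dec v j, w) of (v, w) \<Rightarrow> of_nat (Suc (v j)) * F (inc v j) * G w)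
          = (case p of (v, w) \<Rightarrow> of_nat (v j) * (F v * G w))"
        using e(2) by (simp add: vw dec_apply mult.assoc del: of_nat_Suc)
    next
      fix p assume p: "p \<in> splits u"
      obtain v w where vw: "p = (v, w)" by (cases p)
      show "(case case p of (v, w) \<Rightarrow> (inc v j, w) of (v, w) \<Rightarrow> (dec v j, w)) = p" by (simp add: vw)
      have "madd (inc v j) w = inc u j" using p by (auto simp: vw splits_def madd_def inc_apply fun_eq_iff)
      then show "(case p of (v, w) \<Rightarrow> (inc v j, w)) \<in> {(v, w) \<in> ?S. v j > 0}"
        by (simp add: vw splits_def inc_apply)
    qed
    finally show ?thesis .
  qed
  have "mcoeff (mderiv j (f * g)) u = (\<Sum>(v, w)\<in>?S. of_nat (Suc (u j)) * (mcoeff f v * mcoeff g w))"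
    by (simp add: mcoeff_mderiv mcoeff_mult sum_distrib_left case_prod_unfold)
  also have "\<dots> = (\<Sum>(v, w)\<in>?S. of_nat (v j) * (mcoeff f v * mcoeff g w))
      + (\<Sum>(v, w)\<in>?S. of_nat (w j) * (mcoeff g w * mcoeff f v))"
  proof (subst sum.distrib[symmetric], rule sum.cong)
    fix p assume p: "p \<in> ?S"
    obtain v w where vw: "p = (v, w)" by (cases p)
    have "Suc (u j) = v j + w j"
      using p by (auto simp: vw splits_def madd_def inc_apply dest: fun_cong[of _ _ j])
    then show "(case p of (v, w) \<Rightarrow> of_nat (Suc (u j)) * (mcoeff f v * mcoeff g w))
       = (case p of (v, w) \<Rightarrow> of_nat (v j) * (mcoeff f v * mcoeff g w))
         + (case p of (v, w) \<Rightarrow> of_nat (w j) * (mcoeff g w * mcoeff f v))"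
      by (simp add: vw algebra_simps del: of_nat_Suc)
  qed simp
  also have "(\<Sum>(v, w)\<in>?S. of_nat (w j) * (mcoeff g w * mcoeff f v))
      = (\<Sum>(v, w)\<in>?S. of_nat (v j) * (mcoeff g v * mcoeff f w))"
    by (rule sum.reindex_bij_witness[of _ prod.swap prod.swap]) (auto simp: splits_def madd_def add.commute)
  also have "\<dots> = (\<Sum>(v, w)\<in>splits u. of_nat (Suc (v j)) * mcoeff g (inc v j) * mcoeff f w)"
    by (rule half)
  also have "(\<Sum>(v, w)\<in>?S. of_nat (v j) * (mcoeff f v * mcoeff g w))
      = (\<Sum>(v, w)\<in>splits u. of_nat (Suc (v j)) * mcoeff f (inc v j) * mcoeff g w)"
    by (rule half)
  finally show "mcoeff (mderiv j (f * g)) u = mcoeff (mderiv j f * g + f * mderiv j g) u"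
    by (simp only: plus_mps.rep_eq mcoeff_mult mcoeff_mderiv mult.commute[of f "mderiv j g"])
qed

instance fract :: ("{idom, ring_char_0}") field_char_0
proof
  show "inj (of_nat :: nat \<Rightarrow> 'a fract)"
    by (rule injI) (simp add: of_nat_fract eq_fract)
qed

instance mps :: (finite, "{comm_ring_1, ring_char_0}") ring_char_0
proof
  have "mcoeff (of_nat n :: ('a, 'b) mps) (\<lambda>_. 0) = of_nat n" for n
    by (induction n) (auto simp: zero_mps.rep_eq one_mps.rep_eq plus_mps.rep_eq)
  then show "inj (of_nat :: nat \<Rightarrow> ('a, 'b) mps)"
    by (metis injI of_nat_eq_iff)
qed

section \<open>Moving solutions into a differentially closed field\<close>

lemma rta_simps:
  "carrier (ring_of_type_algebra :: 'a::field ring) = UNIV"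
  "x \<otimes>\<^bsub>ring_of_type_algebra :: 'a ring\<^esub> y = x * y"
  "x \<oplus>\<^bsub>ring_of_type_algebra :: 'a ring\<^esub> y = x + y"
  "\<one>\<^bsub>ring_of_type_algebra :: 'a ring\<^esub> = 1"
  "\<zero>\<^bsub>ring_of_type_algebra :: 'a ring\<^esub> = 0"
  by (simp_all add: ring_of_type_algebra_def)

lemma rta_field: "Ring.field (ring_of_type_algebra :: 'a::field ring)"
  by (rule field_from_type_algebra)

lemma rta_a_inv: "\<ominus>\<^bsub>ring_of_type_algebra :: 'a::field ring\<^esub> x = - x"
proof -
  interpret R: Ring.field "ring_of_type_algebra :: 'a ring" by (rule rta_field)
  show ?thesis by (rule R.minus_equality) (simp_all add: rta_simps)
qed

lemma rta_m_inv:
  assumes "x \<noteq> (0 :: 'a::field)"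
  shows "inv\<^bsub>ring_of_type_algebra :: 'a ring\<^esub> x = inverse x"
proof -
  interpret R: Ring.field "ring_of_type_algebra :: 'a ring" by (rule rta_field)
  show ?thesis by (rule R.comm_inv_char) (use assms in \<open>simp_all add: rta_simps\<close>)
qed

lemma subfield_rtaI:
  fixes A :: "'a::field set"
  assumes "1 \<in> A" "\<And>x y. x \<in> A \<Longrightarrow> y \<in> A \<Longrightarrow> x + y \<in> A" "\<And>x y. x \<in> A \<Longrightarrow> y \<in> A \<Longrightarrow> x * y \<in> A"
    "\<And>x. x \<in> A \<Longrightarrow> - x \<in> A" "\<And>x. x \<in> A \<Longrightarrow> x \<noteq> 0 \<Longrightarrow> inverse x \<in> A"
  shows "subfield A (ring_of_type_algebra :: 'a ring)"
proof -
  interpret R: Ring.field "ring_of_type_algebra :: 'a ring" by (rule rta_field)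
  show ?thesis
  proof (rule R.subfieldI')
    show "subring A (ring_of_type_algebra :: 'a ring)"
      by (rule R.subringI) (use assms in \<open>auto simp: rta_simps rta_a_inv\<close>)
    show "inv\<^bsub>ring_of_type_algebra :: 'a ring\<^esub> x \<in> A"
      if "x \<in> A - {\<zero>\<^bsub>ring_of_type_algebra :: 'a ring\<^esub>}" for x
      using that assms(5)[of x] by (simp add: rta_simps rta_m_inv)
  qed
qed

lemma subfield_rtaD:
  fixes A :: "'a::field set"
  assumes "subfield A (ring_of_type_algebra :: 'a ring)"
  shows "1 \<in> A" "\<And>x y. x \<in> A \<Longrightarrow> y \<in> A \<Longrightarrow> x + y \<in> A" "\<And>x y. x \<in> A \<Longrightarrow> y \<in> A \<Longrightarrow> x * y \<in> A"
    "\<And>x. x \<in> A \<Longrightarrow> - x \<in> A"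
proof -
  note s = subfieldE(1)[OF assms]
  show "1 \<in> A" using subringE(3)[OF s] by (simp add: rta_simps)
  show "x + y \<in> A" if "x \<in> A" "y \<in> A" for x y using subringE(7)[OF s that] by (simp add: rta_simps)
  show "x * y \<in> A" if "x \<in> A" "y \<in> A" for x y using subringE(6)[OF s that] by (simp add: rta_simps)
  show "- x \<in> A" if "x \<in> A" for x using subringE(5)[OF s that] by (simp add: rta_a_inv)
qed

text \<open>The subfield \<open>L0\<close> is copied along an injection into \<open>'a\<close>, because differential closedness
  speaks only of extensions living on that type.\<close>

lemma differentially_closed_solution:
  fixes \<delta> :: "'m \<Rightarrow> 'a::field_char_0 \<Rightarrow> 'a" and \<Delta> :: "'m \<Rightarrow> 'f::field \<Rightarrow> 'f" and h :: "'a \<Rightarrow> 'f"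
  assumes dc: "differentially_closed \<delta>"
    and \<Delta>: "\<And>j. is_der (\<Delta> j)" "\<And>i j x. \<Delta> i (\<Delta> j x) = \<Delta> j (\<Delta> i x)"
    and L0: "subfield L0 (ring_of_type_algebra :: 'f ring)" "\<And>j x. x \<in> L0 \<Longrightarrow> \<Delta> j x \<in> L0"
      "lepoll L0 (UNIV :: 'a set)"
    and h: "range h \<subseteq> L0" "\<And>x y. h (x + y) = h x + h y" "\<And>x y. h (x * y) = h x * h y" "h 1 = 1"
      "\<And>j x. h (\<delta> j x) = \<Delta> j (h x)"
    and e: "range e \<subseteq> L0" and \<phi>: "quantifier_free \<phi>" "sat ring_of_type_algebra \<Delta> h e \<phi>"
  shows "\<exists>e'. sat ring_of_type_algebra \<delta> id e' \<phi>"
proof -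
  obtain g :: "'f \<Rightarrow> 'a" where g: "inj_on g L0" using L0(3) by (auto simp: lepoll_def)
  define R0 where "R0 = (ring_of_type_algebra :: 'f ring)\<lparr>carrier := L0\<rparr>"
  define L where "L = image_ring g R0"
  define \<delta>' where "\<delta>' j x = g (\<Delta> j (inv_into L0 g x))" for j x
  interpret R: Ring.field "ring_of_type_algebra :: 'f ring" by (rule rta_field)
  have R0: "carrier R0 = L0" "\<And>x y. x \<otimes>\<^bsub>R0\<^esub> y = x * y" "\<And>x y. x \<oplus>\<^bsub>R0\<^esub> y = x + y"
    "\<one>\<^bsub>R0\<^esub> = 1" "\<zero>\<^bsub>R0\<^esub> = 0"
    by (simp_all add: R0_def rta_simps)
  interpret R0: Ring.field R0 unfolding R0_def by (rule R.subfield_iff(2)[OF L0(1)])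
  have g': "inj_on g (carrier R0)" using g R0 by simp
  interpret L: Ring.field L unfolding L_def by (rule R0.inj_imp_image_ring_is_field[OF g'])
  have iso: "g \<in> ring_iso R0 L" unfolding L_def by (rule inj_imp_image_ring_iso[OF g'])
  then have ghom: "g \<in> ring_hom R0 L" by (simp add: ring_iso_def)
  interpret G: ring_hom_ring R0 L g by (rule ring_hom_ringI2[OF R0.ring_axioms L.ring_axioms ghom])
  have L_car: "carrier L = g ` L0" by (simp add: L_def image_ring_carrier R0)
  note sf = subfield_rtaD[OF L0(1)]
  have R0_minus: "\<ominus>\<^bsub>R0\<^esub> x = - x" if "x \<in> L0" for x
    by (rule R0.minus_equality) (use that sf(4)[of x] in \<open>simp_all add: R0\<close>)
  have g_add: "g (x + y) = g x \<oplus>\<^bsub>L\<^esub> g y" and g_mult: "g (x * y) = g x \<otimes>\<^bsub>L\<^esub> g y"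
    if "x \<in> L0" "y \<in> L0" for x y
    using G.hom_add[of x y] G.hom_mult[of x y] that by (simp_all add: R0)
  have g_minus: "g (- x) = \<ominus>\<^bsub>L\<^esub> g x" if "x \<in> L0" for x
    using G.hom_a_inv[of x] that by (simp add: R0 R0_minus)
  have g_one: "g 1 = \<one>\<^bsub>L\<^esub>" and g_zero: "g 0 = \<zero>\<^bsub>L\<^esub>"
    using ring_hom_one[OF ghom] G.hom_zero by (simp_all add: R0)
  have zero: "0 \<in> L0" using R0.zero_closed by (simp add: R0)
  have g_der: "\<delta>' j (g x) = g (\<Delta> j x)" if "x \<in> L0" for j x
    using g that by (simp add: \<delta>'_def)
  have "differential_field L \<delta>'"
    unfolding differential_field_def derivation_def
  proof (intro conjI allI ballI)
    show "Ring.field L" by (rule L.field_axioms)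
    fix i j x assume "x \<in> carrier L"
    then obtain x0 where x: "x0 \<in> L0" "x = g x0" by (auto simp: L_car)
    show "\<delta>' j x \<in> carrier L" using x L0(2) by (simp add: g_der L_car)
    show "\<delta>' i (\<delta>' j x) = \<delta>' j (\<delta>' i x)" using x L0(2) \<Delta>(2)[of i j] by (simp add: g_der)
    fix y assume "y \<in> carrier L"
    then obtain y0 where y: "y0 \<in> L0" "y = g y0" by (auto simp: L_car)
    show "\<delta>' j (x \<oplus>\<^bsub>L\<^esub> y) = \<delta>' j x \<oplus>\<^bsub>L\<^esub> \<delta>' j y"
      using x y L0(2) sf \<Delta>(1)[of j] by (simp add: g_add[symmetric] g_der is_der_def)
    show "\<delta>' j (x \<otimes>\<^bsub>L\<^esub> y) = \<delta>' j x \<otimes>\<^bsub>L\<^esub> y \<oplus>\<^bsub>L\<^esub> x \<otimes>\<^bsub>L\<^esub> \<delta>' j y"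
      using x y L0(2) sf \<Delta>(1)[of j]
      by (simp add: g_mult[symmetric] g_add[symmetric] g_der is_der_def)
  qed
  moreover have "(\<lambda>x. g (h x)) \<in> ring_hom ring_of_type_algebra L"
    using h(1) by (intro ring_hom_memI)
      (auto simp: rta_simps h(2-4) g_add[symmetric] g_mult[symmetric] g_one L_car image_subset_iff)
  ultimately have ext: "differential_extension \<delta> L \<delta>' (\<lambda>x. g (h x))"
    using h(1) by (auto simp: differential_extension_def h(5) g_der image_subset_iff)
  have t: "tval ring_of_type_algebra \<Delta> h e t \<in> L0 \<and>
      tval L \<delta>' (\<lambda>x. g (h x)) (\<lambda>v. g (e v)) t = g (tval ring_of_type_algebra \<Delta> h e t)"
    for t :: "('m, 'a) dterm"
    by (induction t) (use h(1) e L0(2) sf zero in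
        \<open>auto simp: rta_simps rta_a_inv g_add g_mult g_minus g_one g_zero g_der\<close>)
  have "sat L \<delta>' (\<lambda>x. g (h x)) (\<lambda>v. g (e v)) \<psi> = sat ring_of_type_algebra \<Delta> h e \<psi>"
    if "quantifier_free \<psi>" for \<psi> :: "('m, 'a) dform"
    using that by (induction \<psi>) (use t g in \<open>auto dest: inj_onD\<close>)
  then have "sat L \<delta>' (\<lambda>x. g (h x)) (\<lambda>v. g (e v)) \<phi>" using \<phi> by simp
  moreover have "range (\<lambda>v. g (e v)) \<subseteq> carrier L" using e by (auto simp: L_car)
  moreover have "\<And>(L :: 'a ring) \<delta>' h (\<phi> :: ('m, 'a) dform) e. differential_extension \<delta> L \<delta>' h \<Longrightarrow>
      quantifier_free \<phi> \<Longrightarrow> range e \<subseteq> carrier L \<Longrightarrow> sat L \<delta>' h e \<phi> \<Longrightarrow>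
      \<exists>e'. sat ring_of_type_algebra \<delta> id e' \<phi>"
    using dc unfolding differentially_closed_def by simp
  ultimately show ?thesis using ext \<phi>(1) by metis
qed

lemma subfield_dcl: "subfield (dcl A) (ring_of_type_algebra :: 'a::field_char_0 ring)"
  by (rule subfield_rtaI) (auto simp: dcl_def der_0 der_1 der_add der_mult der_minus der_inverse)

lemma dcl_stable:
  assumes \<Delta>: "is_der \<Delta>" "\<And>s. s \<in> S \<Longrightarrow> \<Delta> s \<in> S" and x: "x \<in> dcl S"
  shows "\<Delta> x \<in> dcl S"
  unfolding dcl_def
proof (clarify)
  fix d assume d: "is_der d" "\<forall>a\<in>S. d a = 0"
  have "d (\<Delta> x) - \<Delta> (d x) = 0"
    using x der_commutator[OF d(1) \<Delta>(1)] d \<Delta>(2) by (auto simp: dcl_def der_0[OF \<Delta>(1)])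
  moreover have "d x = 0" using x d by (auto simp: dcl_def)
  ultimately show "d (\<Delta> x) = 0" by (simp add: der_0[OF \<Delta>(1)])
qed

section \<open>Derivations of the field of fractions\<close>

lemma Fract_eq_divide: "b \<noteq> 0 \<Longrightarrow> Fract a b = Fract a 1 * inverse (Fract b (1 :: 'r::idom))"
  by simp

lemma der_fract_zero:
  assumes d: "is_der d" "\<And>a. d (Fract a 1) = 0"
  shows "d (q :: 'r::{idom, ring_char_0} fract) = 0"
proof (cases q)
  case (Fract a b)
  have ne: "Fract b 1 \<noteq> (0 :: 'r fract)" using Fract(2) by (simp add: Zero_fract_def eq_fract)
  have "d (Fract a 1 * inverse (Fract b 1)) = 0"
    by (simp only: der_mult[OF d(1)] der_inverse[OF d(1) ne] d(2)) simp
  then show ?thesis unfolding Fract(1) Fract_eq_divide[OF Fract(2), of a] .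
qed

text \<open>No quotient rule is needed: the extension theorem supplies derivations of the fraction
  field, and their commutators vanish on the ring and therefore on all fractions.\<close>

lemma fract_derivations:
  fixes D :: "'m \<Rightarrow> 'r::{idom, ring_char_0} \<Rightarrow> 'r"
  assumes add: "\<And>j x y. D j (x + y) = D j x + D j y"
    and mult: "\<And>j x y. D j (x * y) = D j x * y + x * D j y"
    and comm: "\<And>i j x. D i (D j x) = D j (D i x)"
  obtains \<Delta> :: "'m \<Rightarrow> 'r fract \<Rightarrow> 'r fract"
    where "\<And>j. is_der (\<Delta> j)" "\<And>j x. \<Delta> j (Fract x 1) = Fract (D j x) 1"
      "\<And>i j x. \<Delta> i (\<Delta> j x) = \<Delta> j (\<Delta> i x)"
proof -
  have "\<exists>d. is_der d \<and> (\<forall>x. d (Fract x 1) = Fract (D j x) (1 :: 'r))" for j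
  proof -
    have z: "D j 0 = 0" using add[of j 0 0] by simp
    have o: "D j 1 = 0" using mult[of j 1 1] by simp
    have m: "D j (- x) = - D j x" for x using add[of j x "- x"] z by (simp add: eq_neg_iff_add_eq_0 add.commute)
    let ?G = "{(Fract x 1, Fract (D j x) 1) | x. True} :: ('r fract \<times> 'r fract) set"
    have G1: "(Fract 0 1, Fract (D j 0) 1) \<in> ?G" "(Fract 1 1, Fract (D j 1) 1) \<in> ?G" by blast+
    have "dring ?G"
      unfolding dring_def
    proof (intro conjI allI impI)
      show "(0, 0) \<in> ?G" using G1(1) z by (simp add: Zero_fract_def)
      show "(1, 0) \<in> ?G" using G1(2) o by (simp add: Zero_fract_def One_fract_def)
      fix x y assume "(x, y) \<in> ?G"
      then obtain a where a: "x = Fract a 1" "y = Fract (D j a) 1" by auto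
      show "(- x, - y) \<in> ?G" using a m[of a] by auto
      fix x' y' assume "(x', y') \<in> ?G"
      then obtain c where c: "x' = Fract c 1" "y' = Fract (D j c) 1" by auto
      show "(x + x', y + y') \<in> ?G" using a c add[of j a c] by auto
      show "(x * x', y * x' + x * y') \<in> ?G" using a c mult[of j a c] by auto
    qed
    moreover have "dsv ?G" using z by (auto simp: dsv_def Zero_fract_def eq_fract)
    ultimately obtain d where "is_der d" "\<forall>(x, y)\<in>?G. d x = y" using derivation_extension[of ?G] by blast
    moreover from this have "d (Fract x 1) = Fract (D j x) 1" for x by auto
    ultimately show ?thesis by blast
  qed
  then obtain \<Delta> where \<Delta>: "\<And>j. is_der (\<Delta> j)" "\<And>j x. \<Delta> j (Fract x 1) = Fract (D j x) (1 :: 'r)"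
    by metis
  have "\<Delta> i (\<Delta> j x) - \<Delta> j (\<Delta> i x) = 0" for i j x
    by (rule der_fract_zero[OF der_commutator[OF \<Delta>(1) \<Delta>(1)]]) (simp add: \<Delta>(2) comm[of i j])
  then show ?thesis using that[of \<Delta>] \<Delta> by simp
qed

section \<open>Saturation for finitely many variables\<close>

primrec tsubst :: "(nat \<Rightarrow> ('m, 'c) dterm) \<Rightarrow> ('m, 'c) dterm \<Rightarrow> ('m, 'c) dterm" where
  "tsubst \<sigma> (Var v) = \<sigma> v"
| "tsubst \<sigma> (Param c) = Param c"
| "tsubst \<sigma> Zero = Zero"
| "tsubst \<sigma> One = One"
| "tsubst \<sigma> (Add t u) = Add (tsubst \<sigma> t) (tsubst \<sigma> u)"
| "tsubst \<sigma> (Mult t u) = Mult (tsubst \<sigma> t) (tsubst \<sigma> u)"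
| "tsubst \<sigma> (Minus t) = Minus (tsubst \<sigma> t)"
| "tsubst \<sigma> (Der j t) = Der j (tsubst \<sigma> t)"

text \<open>Only used for quantifier-free formulas, so that capture is not an issue.\<close>

primrec fsubst :: "(nat \<Rightarrow> ('m, 'c) dterm) \<Rightarrow> ('m, 'c) dform \<Rightarrow> ('m, 'c) dform" where
  "fsubst \<sigma> (FEq t u) = FEq (tsubst \<sigma> t) (tsubst \<sigma> u)"
| "fsubst \<sigma> (FNot \<phi>) = FNot (fsubst \<sigma> \<phi>)"
| "fsubst \<sigma> (FAnd \<phi> \<psi>) = FAnd (fsubst \<sigma> \<phi>) (fsubst \<sigma> \<psi>)"
| "fsubst \<sigma> (FEx v \<phi>) = FEx v \<phi>"

lemma tval_tsubst: "tval R \<delta> h e (tsubst \<sigma> t) = tval R \<delta> h (\<lambda>v. tval R \<delta> h e (\<sigma> v)) t"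
  by (induction t) simp_all

lemma sat_fsubst:
  "quantifier_free \<phi> \<Longrightarrow> sat R \<delta> h e (fsubst \<sigma> \<phi>) = sat R \<delta> h (\<lambda>v. tval R \<delta> h e (\<sigma> v)) \<phi>"
  by (induction \<phi>) (simp_all add: tval_tsubst)

lemma tvars_tsubst: "tvars (tsubst \<sigma> t) = (\<Union>v\<in>tvars t. tvars (\<sigma> v))"
  by (induction t) auto

lemma free_vars_fsubst:
  "quantifier_free \<phi> \<Longrightarrow> free_vars (fsubst \<sigma> \<phi>) = (\<Union>v\<in>free_vars \<phi>. tvars (\<sigma> v))"
  by (induction \<phi>) (auto simp: tvars_tsubst)

lemma tparams_tsubst: "tparams (tsubst \<sigma> t) \<subseteq> tparams t \<union> (\<Union>v. tparams (\<sigma> v))"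
  by (induction t) auto

lemma fparams_fsubst: "fparams (fsubst \<sigma> \<phi>) \<subseteq> fparams \<phi> \<union> (\<Union>v. tparams (\<sigma> v))"
proof (induction \<phi>)
  case (FEq t u)
  then show ?case using tparams_tsubst[of \<sigma> t] tparams_tsubst[of \<sigma> u] by auto
qed auto

lemma tval_cong: "(\<And>v. v \<in> tvars t \<Longrightarrow> e v = e' v) \<Longrightarrow> tval R \<delta> h e t = tval R \<delta> h e' t"
  by (induction t) auto

lemma sat_cong:
  "quantifier_free \<phi> \<Longrightarrow> (\<And>v. v \<in> free_vars \<phi> \<Longrightarrow> e v = e' v) \<Longrightarrow> sat R \<delta> h e \<phi> = sat R \<delta> h e' \<phi>"
proof (induction \<phi>)
  case (FEq t u)
  then show ?case using tval_cong[of t e e' R \<delta> h] tval_cong[of u e e' R \<delta> h] by simp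
qed auto

lemma sat_foldr_FEx:
  fixes R :: "'a ring"
  assumes R: "carrier R = UNIV"
  shows "sat R \<delta> h e (foldr FEx vs \<phi>) \<longleftrightarrow> (\<exists>e'. (\<forall>v. v \<notin> set vs \<longrightarrow> e' v = e v) \<and> sat R \<delta> h e' \<phi>)"
proof (induction vs arbitrary: e)
  case Nil
  have "e' = e" if "\<forall>v. e' v = e v" for e' :: "nat \<Rightarrow> 'a" using that by auto
  then show ?case by auto
next
  case (Cons x vs)
  show ?case
  proof
    assume "sat R \<delta> h e (foldr FEx (x # vs) \<phi>)"
    then obtain a where "sat R \<delta> h (e(x := a)) (foldr FEx vs \<phi>)" by auto
    then obtain e' where "\<forall>v. v \<notin> set vs \<longrightarrow> e' v = (e(x := a)) v" "sat R \<delta> h e' \<phi>"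
      using Cons by blast
    then show "\<exists>e'. (\<forall>v. v \<notin> set (x # vs) \<longrightarrow> e' v = e v) \<and> sat R \<delta> h e' \<phi>"
      by (intro exI[of _ e']) auto
  next
    assume "\<exists>e'. (\<forall>v. v \<notin> set (x # vs) \<longrightarrow> e' v = e v) \<and> sat R \<delta> h e' \<phi>"
    then obtain e' where "\<forall>v. v \<notin> set (x # vs) \<longrightarrow> e' v = e v" "sat R \<delta> h e' \<phi>" by blast
    then have "sat R \<delta> h (e(x := e' x)) (foldr FEx vs \<phi>)"
      unfolding Cons by (intro exI[of _ e']) auto
    then show "sat R \<delta> h e (foldr FEx (x # vs) \<phi>)" using R by auto
  qed
qed

lemma free_vars_foldr_FEx: "free_vars (foldr FEx vs \<phi>) = free_vars \<phi> - set vs"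
  by (induction vs) auto

lemma fparams_foldr_FEx: "fparams (foldr FEx vs \<phi>) = fparams \<phi>"
  by (induction vs) auto

lemma lesspoll_Un_finite:
  fixes k :: "'a set"
  assumes "infinite k" "k \<prec> (UNIV :: 'a set)" "finite Y"
  shows "k \<union> Y \<prec> (UNIV :: 'a set)"
proof -
  have "lepoll (\<Union>i\<in>(UNIV :: bool set). if i then k else Y) k"
  proof (rule UN_lepoll[OF assms(1)])
    show "lepoll (UNIV :: bool set) k" using finite_lepoll_infinite[OF assms(1) finite[of "UNIV :: bool set"]] .
    show "lepoll (if i then k else Y) k" for i
      using finite_lepoll_infinite[OF assms(1,3)] by (simp add: lepoll_refl)
  qed
  moreover have "(\<Union>i\<in>(UNIV :: bool set). if i then k else Y) = k \<union> Y" by (auto split: if_splits)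
  ultimately show ?thesis using assms(2) lesspoll_trans1 by metis
qed

text \<open>The coordinates of a solution are found one at a time. At each point the conditions on
  the next coordinate are that the remaining ones exist; this is a 1-type over \<open>k\<close> and
  finitely many parameters, and closure under conjunction makes it finitely satisfiable.\<close>

theorem saturated_realises:
  fixes \<delta> :: "'m \<Rightarrow> 'a::field \<Rightarrow> 'a" and \<Theta> :: "('m, 'a) dform set"
  assumes sat: "saturated \<delta>" and k: "infinite k" "k \<prec> (UNIV :: 'a set)"
    and \<Theta>: "\<And>\<phi>. \<phi> \<in> \<Theta> \<Longrightarrow> quantifier_free \<phi> \<and> fparams \<phi> \<subseteq> k \<and> free_vars \<phi> \<subseteq> {..<N}"
      "\<And>\<phi> \<psi>. \<phi> \<in> \<Theta> \<Longrightarrow> \<psi> \<in> \<Theta> \<Longrightarrow> FAnd \<phi> \<psi> \<in> \<Theta>"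
      "\<And>\<phi>. \<phi> \<in> \<Theta> \<Longrightarrow> \<exists>e. sat ring_of_type_algebra \<delta> id e \<phi>" "\<Theta> \<noteq> {}"
  shows "\<exists>e. \<forall>\<phi>\<in>\<Theta>. sat ring_of_type_algebra \<delta> id e \<phi>"
proof -
  obtain h :: "'a \<Rightarrow> 'a" where h: "id = h" by simp
  then have hx: "h x = x" for x by auto
  note sat = sat[unfolded saturated_def h]
  note \<Theta> = \<Theta>[unfolded h]
  let ?R = "ring_of_type_algebra :: 'a ring"
  have R: "carrier ?R = UNIV" by (simp add: ring_of_type_algebra_def)
  have step: "\<exists>w. \<forall>\<phi>\<in>\<Theta>. \<exists>e. (\<forall>v<j. e v = w v) \<and> sat ?R \<delta> h e \<phi>" if "j \<le> N" for j
    using that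
  proof (induction j)
    case 0
    then show ?case using \<Theta>(3) by simp
  next
    case (Suc j)
    from Suc.IH[OF Suc_leD[OF Suc.prems]] obtain w
      where w: "\<forall>\<phi>\<in>\<Theta>. \<exists>e. (\<forall>v<j. e v = w v) \<and> sat ?R \<delta> h e \<phi>" by (rule exE)
    \<comment> \<open>Coordinates already found become parameters, coordinate \<open>j\<close>
      becomes variable 0, which is the free variable of a 1-type, and the later ones keep their
      names and are quantified away in \<open>\<psi>\<close>.\<close>
    define \<sigma> :: "nat \<Rightarrow> ('m, 'a) dterm" where
      "\<sigma> v = (if v < j then Param (w v) else if v = j then Var 0 else Var v)" for v
    define \<psi> where "\<psi> \<phi> = foldr FEx [Suc j..<N] (fsubst \<sigma> \<phi>)" for \<phi>
    have \<psi>: "sat ?R \<delta> h (\<lambda>_. a) (\<psi> \<phi>) \<longleftrightarrow>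
        (\<exists>e. (\<forall>v<j. e v = w v) \<and> e j = a \<and> sat ?R \<delta> h e \<phi>)" if "\<phi> \<in> \<Theta>" for \<phi> a
    proof
      assume "sat ?R \<delta> h (\<lambda>_. a) (\<psi> \<phi>)"
      then obtain e where e: "\<And>v. v \<notin> {Suc j..<N} \<Longrightarrow> e v = a" "sat ?R \<delta> h e (fsubst \<sigma> \<phi>)"
        using R by (auto simp: \<psi>_def sat_foldr_FEx)
      have "sat ?R \<delta> h (\<lambda>v. tval ?R \<delta> h e (\<sigma> v)) \<phi>" using e(2) \<Theta>(1)[OF that] by (simp add: sat_fsubst)
      moreover have "tval ?R \<delta> h e (\<sigma> v) = w v" if "v < j" for v using that by (simp add: \<sigma>_def hx)
      moreover have "tval ?R \<delta> h e (\<sigma> j) = a" using e(1)[of 0] by (simp add: \<sigma>_def)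
      ultimately show "\<exists>e. (\<forall>v<j. e v = w v) \<and> e j = a \<and> sat ?R \<delta> h e \<phi>"
        by (intro exI[of _ "\<lambda>v. tval ?R \<delta> h e (\<sigma> v)"] conjI allI impI) assumption+
    next
      assume "\<exists>e. (\<forall>v<j. e v = w v) \<and> e j = a \<and> sat ?R \<delta> h e \<phi>"
      then obtain e where e: "\<And>v. v < j \<Longrightarrow> e v = w v" "e j = a" "sat ?R \<delta> h e \<phi>" by blast
      define e' where "e' v = (if v \<in> {Suc j..<N} then e v else a)" for v
      have "tval ?R \<delta> h e' (\<sigma> v) = e v" if "v < N" for v
        using that e(1)[of v] e(2) by (auto simp: \<sigma>_def e'_def hx)
      then have "sat ?R \<delta> h (\<lambda>v. tval ?R \<delta> h e' (\<sigma> v)) \<phi>"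
        using sat_cong[of \<phi> e "\<lambda>v. tval ?R \<delta> h e' (\<sigma> v)" ?R \<delta> h] \<Theta>(1)[OF that] e(3)
        by (metis lessThan_iff subsetD)
      then have "sat ?R \<delta> h e' (fsubst \<sigma> \<phi>)" using \<Theta>(1)[OF that] by (simp add: sat_fsubst)
      then show "sat ?R \<delta> h (\<lambda>_. a) (\<psi> \<phi>)"
        unfolding \<psi>_def sat_foldr_FEx[OF R] by (intro exI[of _ e']) (auto simp: e'_def)
    qed
    let ?A = "k \<union> w ` {..<j}"
    have "\<exists>a. \<forall>\<chi>\<in>\<psi> ` \<Theta>. sat ?R \<delta> h (\<lambda>_. a) \<chi>"
    proof (rule sat[rule_format])
      show "?A \<prec> (UNIV :: 'a set)" by (rule lesspoll_Un_finite[OF k]) simp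
    next
      fix \<chi> assume "\<chi> \<in> \<psi> ` \<Theta>"
      then obtain \<phi> where \<phi>: "\<phi> \<in> \<Theta>" "\<chi> = \<psi> \<phi>" by auto
      note q = \<Theta>(1)[OF \<phi>(1)]
      have "tparams (\<sigma> v) \<subseteq> w ` {..<j}" for v by (simp add: \<sigma>_def)
      then have "fparams (fsubst \<sigma> \<phi>) \<subseteq> ?A" using fparams_fsubst[of \<sigma> \<phi>] q by blast
      moreover have "tvars (\<sigma> v) \<subseteq> insert 0 {Suc j..<N}" if "v < N" for v using that by (auto simp: \<sigma>_def)
      then have "free_vars (fsubst \<sigma> \<phi>) \<subseteq> insert 0 {Suc j..<N}"
        using q by (auto simp: free_vars_fsubst)
      ultimately show "fparams \<chi> \<subseteq> ?A \<and> free_vars \<chi> \<subseteq> {0}"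
        unfolding \<phi>(2) \<psi>_def free_vars_foldr_FEx fparams_foldr_FEx by auto
    next
      fix \<Phi>0 assume F: "\<Phi>0 \<subseteq> \<psi> ` \<Theta>" "finite \<Phi>0"
      then obtain F0 where F0: "F0 \<subseteq> \<Theta>" "finite F0" "\<Phi>0 = \<psi> ` F0" by (meson finite_subset_image)
      have "\<exists>\<phi>0\<in>\<Theta>. \<forall>e. sat ?R \<delta> h e \<phi>0 \<longrightarrow> (\<forall>\<phi>\<in>F0. sat ?R \<delta> h e \<phi>)"
        using F0(2,1)
      proof (induction F0)
        case empty
        then show ?case using \<Theta>(4) by auto
      next
        case (insert \<phi> F0)
        have F0: "F0 \<subseteq> \<Theta>" "\<phi> \<in> \<Theta>" using insert.prems by auto
        from insert.IH[OF F0(1)] obtain \<phi>0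
          where \<phi>0: "\<phi>0 \<in> \<Theta>" "\<forall>e. sat ?R \<delta> h e \<phi>0 \<longrightarrow> (\<forall>\<phi>\<in>F0. sat ?R \<delta> h e \<phi>)" by (rule bexE)
        show ?case using \<Theta>(2)[OF F0(2) \<phi>0(1)] \<phi>0(2) by (intro bexI[of _ "FAnd \<phi> \<phi>0"]) simp_all
      qed
      then obtain \<phi>0 where \<phi>0: "\<phi>0 \<in> \<Theta>"
        "\<forall>e. sat ?R \<delta> h e \<phi>0 \<longrightarrow> (\<forall>\<phi>\<in>F0. sat ?R \<delta> h e \<phi>)" by (rule bexE)
      obtain e where e: "\<forall>v<j. e v = w v" "sat ?R \<delta> h e \<phi>0" using bspec[OF w \<phi>0(1)] by (elim exE conjE)
      have "sat ?R \<delta> h (\<lambda>_. e j) (\<psi> \<phi>)" if "\<phi> \<in> F0" for \<phi>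
        unfolding \<psi>[OF subsetD[OF F0(1) that]]
        by (intro exI[of _ e] conjI allI impI refl) (simp add: e(1), rule bspec[OF mp[OF spec[OF \<phi>0(2)] e(2)] that])
      then show "\<exists>a. \<forall>\<chi>\<in>\<Phi>0. sat ?R \<delta> h (\<lambda>_. a) \<chi>"
        unfolding F0(3) by (intro exI[of _ "e j"] ballI) (erule imageE, simp only:)
    qed
    then obtain a where "\<forall>\<chi>\<in>\<psi> ` \<Theta>. sat ?R \<delta> h (\<lambda>_. a) \<chi>" by (rule exE)
    then have a: "sat ?R \<delta> h (\<lambda>_. a) (\<psi> \<phi>)" if "\<phi> \<in> \<Theta>" for \<phi> using that by (rule bspec[OF _ imageI])
    show ?case
    proof (rule exI[of _ "w(j := a)"], rule ballI)
      fix \<phi> assume \<phi>: "\<phi> \<in> \<Theta>"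
      obtain e where "\<forall>v<j. e v = w v" "e j = a" "sat ?R \<delta> h e \<phi>"
        using a[OF \<phi>, unfolded \<psi>[OF \<phi>]] by (elim exE conjE)
      then show "\<exists>e. (\<forall>v<Suc j. e v = (w(j := a)) v) \<and> sat ?R \<delta> h e \<phi>"
        by (intro exI[of _ e]) (auto simp: less_Suc_eq)
    qed
  qed
  from step[OF order_refl] obtain w
    where w: "\<forall>\<phi>\<in>\<Theta>. \<exists>e. (\<forall>v<N. e v = w v) \<and> sat ?R \<delta> h e \<phi>" by (rule exE)
  have res: "sat ?R \<delta> h w \<phi>" if \<phi>: "\<phi> \<in> \<Theta>" for \<phi>
  proof -
    obtain e where e: "\<forall>v<N. e v = w v" "sat ?R \<delta> h e \<phi>" using bspec[OF w \<phi>] by (elim exE conjE)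
    have "e v = w v" if "v \<in> free_vars \<phi>" for v using \<Theta>(1)[OF \<phi>] that e(1) by auto
    then show ?thesis using sat_cong[of \<phi> e w ?R \<delta> h] \<Theta>(1)[OF \<phi>] e(2) by simp
  qed
  show ?thesis unfolding h by (rule exI[of _ w], rule ballI, rule res)
qed

section \<open>Taylor series\<close>

lemma exponent_induct [case_names zero inc]:
  fixes \<xi> :: "'m::finite \<Rightarrow> nat"
  assumes "P (\<lambda>_. 0)" "\<And>\<xi> j. P \<xi> \<Longrightarrow> P (inc \<xi> j)"
  shows "P \<xi>"
proof (induction "mord \<xi>" arbitrary: \<xi>)
  case 0
  then have "\<xi> = (\<lambda>_. 0)" by (auto simp: mord_def)
  then show ?case using assms(1) by simp
next
  case (Suc n)
  then obtain j where "\<xi> j > 0" by (metis mord_0_iff neq0_conv nat.distinct(1) ext)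
  then have "\<xi> = inc (dec \<xi> j) j" "mord (dec \<xi> j) = n"
    using Suc(2) mord_dec[of \<xi> j] by (auto simp: inc_apply dec_apply fun_eq_iff)
  then show ?case using assms(2) Suc(1) by metis
qed

definition mfact :: "('m::finite \<Rightarrow> nat) \<Rightarrow> 'a::field_char_0" where
  "mfact \<xi> = (\<Prod>j\<in>UNIV. fact (\<xi> j))"

lemma mfact_0: "mfact (\<lambda>_. 0) = 1"
  by (simp add: mfact_def)

lemma mfact_nonzero: "mfact \<xi> \<noteq> 0"
  by (simp add: mfact_def)

lemma mfact_inc: "(mfact (inc \<xi> j) :: 'a::field_char_0) = of_nat (Suc (\<xi> j)) * mfact \<xi>"
proof -
  have "(mfact (inc \<xi> j) :: 'a) = fact (Suc (\<xi> j)) * (\<Prod>i\<in>UNIV - {j}. fact (\<xi> i))"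
    unfolding mfact_def by (subst prod.remove[of _ j]) (auto simp: inc_apply)
  also have "\<dots> = of_nat (Suc (\<xi> j)) * mfact \<xi>"
    unfolding mfact_def by (subst prod.remove[of UNIV j]) (auto simp: algebra_simps)
  finally show ?thesis .
qed

definition egf :: "(('m::finite \<Rightarrow> nat) \<Rightarrow> 'a::field_char_0) \<Rightarrow> ('m, 'a) mps" where
  "egf F = Abs_mps (\<lambda>\<xi>. F \<xi> / mfact \<xi>)"

lemma mcoeff_egf: "mcoeff (egf F) \<xi> = F \<xi> / mfact \<xi>"
  by (simp add: egf_def Abs_mps_inverse)

lemma mderiv_egf: "mderiv j (egf F) = egf (\<lambda>\<xi>. F (inc \<xi> j))"
proof (rule mps_eqI)
  fix \<xi>
  have "of_nat (Suc (\<xi> j)) \<noteq> (0 :: 'b)" by (simp del: of_nat_Suc)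
  then show "mcoeff (mderiv j (egf F)) \<xi> = mcoeff (egf (\<lambda>\<xi>. F (inc \<xi> j))) \<xi>"
    by (simp add: mcoeff_mderiv mcoeff_egf mfact_inc mfact_nonzero del: of_nat_Suc)
qed

lemma mderiv_minus: "mderiv j (- f) = - mderiv j f"
  by (rule mps_eqI) (simp add: mcoeff_mderiv uminus_mps.rep_eq)

lemma mderiv_one: "mderiv j 1 = 0"
  by (rule mps_eqI) (auto simp: mcoeff_mderiv one_mps.rep_eq zero_mps.rep_eq inc_apply fun_eq_iff)

lemma mcoeff_inc_mderiv:
  fixes f :: "('m::finite, 'a::field_char_0) mps"
  shows "mcoeff f (inc \<xi> j) = mcoeff (mderiv j f) \<xi> / of_nat (Suc (\<xi> j))"
  by (simp add: mcoeff_mderiv del: of_nat_Suc)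

locale formal_solution =
  fixes \<delta> :: "'m::finite \<Rightarrow> 'a::field_char_0 \<Rightarrow> 'a" and k :: "'a set"
    and c :: "('n::finite, 'm) jet \<Rightarrow> 'a" and D :: "'m \<Rightarrow> 'a \<Rightarrow> 'a"
  assumes der_\<delta>: "is_der (\<delta> j)" and comm: "\<delta> i (\<delta> j x) = \<delta> j (\<delta> i x)"
    and k_ring: "sring k" and k_stable: "a \<in> k \<Longrightarrow> \<delta> j a \<in> k"
    and der_D: "is_der (D j)" and D_k: "a \<in> k \<Longrightarrow> D j a = \<delta> j a" and D_c: "D j (c l) = c (shift l j)"
begin

definition taylor :: "'a \<Rightarrow> ('m, 'a) mps" where
  "taylor a = egf (\<lambda>\<xi>. dpow \<delta> \<xi> a)"

text \<open>The power series whose derivatives at the origin are the jets above \<open>l\<close>;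
  these series are related by \<open>mderiv\<close> as the jets are by \<open>D\<close>.\<close>

definition sol :: "('n, 'm) jet \<Rightarrow> ('m, 'a) mps" where
  "sol l = egf (\<lambda>\<xi>. c (fst l, \<lambda>j. snd l j + \<xi> j))"

lemma dpow_der: "dpow \<delta> \<xi> (\<delta> j a) = dpow \<delta> (inc \<xi> j) a"
proof (induction \<xi> rule: exponent_induct)
  case zero
  then show ?case using dpow_inc[of \<delta> "\<lambda>_. 0" j a] comm by (simp add: dpow_0)
next
  case (inc \<xi> i)
  have "inc (inc \<xi> i) j = inc (inc \<xi> j) i" by (auto simp: inc_apply fun_eq_iff)
  then show ?case
    using inc dpow_inc[of \<delta> \<xi> i "\<delta> j a"] dpow_inc[of \<delta> "inc \<xi> j" i a] comm by simp
qed

lemma mderiv_taylor: "mderiv j (taylor a) = taylor (\<delta> j a)"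
  by (simp add: taylor_def mderiv_egf dpow_der)

lemma taylor_0: "mcoeff (taylor a) (\<lambda>_. 0) = a"
  by (simp add: taylor_def mcoeff_egf mfact_0 dpow_0)

lemma taylor_add: "taylor (a + b) = taylor a + taylor b"
proof -
  have "mcoeff (taylor (a + b)) \<xi> = mcoeff (taylor a + taylor b) \<xi>" for \<xi>
  proof (induction \<xi> arbitrary: a b rule: exponent_induct)
    case zero
    then show ?case by (simp add: plus_mps.rep_eq taylor_0)
  next
    case (inc \<xi> j)
    show ?case unfolding mcoeff_inc_mderiv mderiv_taylor mderiv_add der_add[OF der_\<delta>] inc ..
  qed
  then show ?thesis by (rule mps_eqI)
qed

lemma taylor_mult: "taylor (a * b) = taylor a * taylor b"
proof -
  have "mcoeff (taylor (a * b)) \<xi> = mcoeff (taylor a * taylor b) \<xi>" for \<xi>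
  proof (induction \<xi> arbitrary: a b rule: exponent_induct)
    case zero
    then show ?case by (simp add: mcoeff_mult_0 taylor_0)
  next
    case (inc \<xi> j)
    show ?case unfolding mcoeff_inc_mderiv mderiv_taylor mderiv_mult der_mult[OF der_\<delta>] taylor_add
      by (simp add: plus_mps.rep_eq inc)
  qed
  then show ?thesis by (rule mps_eqI)
qed

lemma taylor_inj: "inj taylor"
  using taylor_0 by (metis injI)

lemma taylor_1: "taylor 1 = 1"
proof -
  have "taylor 1 * taylor 1 = 1 * taylor 1" using taylor_mult[of 1 1] by simp
  moreover have "taylor 1 \<noteq> 0" using taylor_0[of 1] by (auto simp: zero_mps.rep_eq)
  ultimately show ?thesis using mult_right_cancel[of "taylor 1" "taylor 1" 1] by simp
qed

lemma mderiv_sol: "mderiv j (sol l) = sol (shift l j)"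
proof -
  have "(\<lambda>i. snd l i + inc \<xi> j i) = (\<lambda>i. inc (snd l) j i + \<xi> i)" for \<xi>
    by (auto simp: inc_apply)
  then show ?thesis by (simp add: sol_def mderiv_egf shift_def)
qed

lemma sol_0: "mcoeff (sol l) (\<lambda>_. 0) = c l"
  by (simp add: sol_def mcoeff_egf mfact_0)

text \<open>Matches the differential ring generated by the series \<open>sol\<close> over the Taylor
  image of \<open>k\<close> with the ring generated by \<open>c\<close> over \<open>k\<close>. The
  second component is the value at the origin, and \<open>mderiv\<close> corresponds to
  \<open>D\<close>.\<close>

definition evals :: "(('m, 'a) mps \<times> 'a) set" where
  "evals = pgen ((\<lambda>a. (taylor a, a)) ` k \<union> range (\<lambda>l. (sol l, c l)))"

lemma evals_0: "(u, y) \<in> evals \<Longrightarrow> mcoeff u (\<lambda>_. 0) = y"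
  unfolding evals_def
  by (induction "(u, y)" arbitrary: u y rule: pgen.induct)
    (auto simp: taylor_0 sol_0 one_mps.rep_eq plus_mps.rep_eq mcoeff_mult_0 uminus_mps.rep_eq)

lemma evals_mderiv: "(u, y) \<in> evals \<Longrightarrow> (mderiv j u, D j y) \<in> evals"
  unfolding evals_def
proof (induction "(u, y)" arbitrary: u y rule: pgen.induct)
  case pgen_base
  then consider a where "a \<in> k" "u = taylor a" "y = a" | l where "u = sol l" "y = c l" by auto
  then show ?case
  proof cases
    case 1
    then show ?thesis using k_stable[of a j]
      by (intro pgen.pgen_base) (auto simp: mderiv_taylor D_k)
  next
    case 2
    then show ?thesis by (intro pgen.pgen_base) (auto simp: mderiv_sol D_c)
  qed
next
  case pgen_one
  then show ?case by (simp add: mderiv_one der_1[OF der_D] pgen_zero)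
next
  case (pgen_add u y u' y')
  then show ?case by (simp add: mderiv_add der_add[OF der_D] pgen.pgen_add)
next
  case (pgen_mult u y u' y')
  then show ?case by (simp add: mderiv_mult der_mult[OF der_D] pgen.pgen_add pgen.pgen_mult)
next
  case (pgen_minus u y)
  then show ?case by (simp add: mderiv_minus der_minus[OF der_D] pgen.pgen_minus)
qed

text \<open>If the value at the origin is 0, so are its images under iterated \<open>D\<close>, and
  up to factorials these are all the coefficients of the series.\<close>

lemma evals_eq_0_iff:
  assumes "(u, y) \<in> evals"
  shows "u = 0 \<longleftrightarrow> y = 0"
proof
  assume "u = 0"
  then show "y = 0" using evals_0[OF assms] by (simp add: zero_mps.rep_eq)
next
  have "mcoeff u \<xi> = 0" if "(u, 0) \<in> evals" for u \<xi>
    using that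
  proof (induction \<xi> arbitrary: u rule: exponent_induct)
    case zero
    then show ?case by (rule evals_0)
  next
    case (inc \<xi> j)
    then show ?case
      using evals_mderiv[OF inc.prems, of j] by (simp add: mcoeff_inc_mderiv der_0[OF der_D])
  qed
  then show "u = 0" if "y = 0" using assms that by (intro mps_eqI) (simp add: zero_mps.rep_eq)
qed

lemma exists_total_derivations:
  "\<exists>\<Delta> :: 'm \<Rightarrow> ('m, 'a) mps fract \<Rightarrow> ('m, 'a) mps fract. (\<forall>j. is_der (\<Delta> j)) \<and>
     (\<forall>j f. \<Delta> j (Fract f 1) = Fract (mderiv j f) 1) \<and> (\<forall>i j x. \<Delta> i (\<Delta> j x) = \<Delta> j (\<Delta> i x))"
proof (rule fract_derivations[of "mderiv :: 'm \<Rightarrow> ('m, 'a) mps \<Rightarrow> _", OF mderiv_add mderiv_mult mderiv_commute])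
  fix \<Delta> :: "'m \<Rightarrow> ('m, 'a) mps fract \<Rightarrow> ('m, 'a) mps fract"
  assume "\<And>j. is_der (\<Delta> j)" "\<And>j f. \<Delta> j (Fract f 1) = Fract (mderiv j f) 1"
    "\<And>i j x. \<Delta> i (\<Delta> j x) = \<Delta> j (\<Delta> i x)"
  then show ?thesis by (intro exI[of _ \<Delta>] conjI allI) assumption+
qed

context
  fixes \<Delta> :: "'m \<Rightarrow> ('m, 'a) mps fract \<Rightarrow> ('m, 'a) mps fract"
  assumes \<Delta>: "\<And>j. is_der (\<Delta> j)" "\<And>j f. \<Delta> j (Fract f 1) = Fract (mderiv j f) 1"
    "\<And>i j x. \<Delta> i (\<Delta> j x) = \<Delta> j (\<Delta> i x)"
begin

definition incl :: "'a \<Rightarrow> ('m, 'a) mps fract" where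
  "incl a = Fract (taylor a) 1"

definition env :: "nat \<Rightarrow> ('m, 'a) mps fract" where
  "env v = (if v \<in> range (idx :: 'n \<Rightarrow> nat) then Fract (sol (inv_into UNIV idx v, \<lambda>_. 0)) 1 else 0)"

lemma env_idx: "env (idx i) = Fract (sol (i, \<lambda>_. 0)) 1"
  using inj_idx[where 'b = 'n] by (simp add: env_def)

text \<open>Polynomials in the jets over \<open>k\<close> are values of terms, simultaneously at all points of
  \<open>K\<^sup>n\<close> and at the power series solution.\<close>

definition termval :: "((nat \<Rightarrow> 'a) \<Rightarrow> 'a) \<Rightarrow> 'a \<Rightarrow> bool" where
  "termval F y \<longleftrightarrow> (\<exists>t u. tparams t \<subseteq> k \<and> tvars t \<subseteq> range (idx :: 'n \<Rightarrow> nat) \<and>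
     (\<forall>e. tval ring_of_type_algebra \<delta> id e t = F e) \<and>
     tval ring_of_type_algebra \<Delta> incl env t = Fract u 1 \<and> (u, y) \<in> evals)"

lemma termval_const: "a \<in> k \<Longrightarrow> termval (\<lambda>_. a) a"
  unfolding termval_def
  by (intro exI[of _ "Param a"] exI[of _ "taylor a"]) (auto simp: incl_def evals_def intro: pgen.pgen_base)

lemma termval_one: "termval (\<lambda>_. 1) 1"
  unfolding termval_def evals_def
  by (intro exI[of _ One] exI[of _ 1]) (auto simp: rta_simps One_fract_def intro: pgen.pgen_one)

lemma termval_zero: "termval (\<lambda>_. 0) 0"
  unfolding termval_def evals_def
  by (intro exI[of _ Zero] exI[of _ 0]) (auto simp: rta_simps Zero_fract_def intro: pgen_zero)

lemma termval_add:
  assumes "termval F x" "termval G y"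
  shows "termval (\<lambda>e. F e + G e) (x + y)"
proof -
  obtain t u t' u' where "tparams t \<subseteq> k" "tvars t \<subseteq> range (idx :: 'n \<Rightarrow> nat)"
      "\<forall>e. tval ring_of_type_algebra \<delta> id e t = F e"
      "tval ring_of_type_algebra \<Delta> incl env t = Fract u 1" "(u, x) \<in> evals"
      "tparams t' \<subseteq> k" "tvars t' \<subseteq> range (idx :: 'n \<Rightarrow> nat)"
      "\<forall>e. tval ring_of_type_algebra \<delta> id e t' = G e"
      "tval ring_of_type_algebra \<Delta> incl env t' = Fract u' 1" "(u', y) \<in> evals"
    using assms unfolding termval_def by blast
  then show ?thesis
    unfolding termval_def evals_def
    by (intro exI[of _ "Add t t'"] exI[of _ "u + u'"]) (auto simp: rta_simps intro: pgen.pgen_add)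
qed

lemma termval_mult:
  assumes "termval F x" "termval G y"
  shows "termval (\<lambda>e. F e * G e) (x * y)"
proof -
  obtain t u t' u' where "tparams t \<subseteq> k" "tvars t \<subseteq> range (idx :: 'n \<Rightarrow> nat)"
      "\<forall>e. tval ring_of_type_algebra \<delta> id e t = F e"
      "tval ring_of_type_algebra \<Delta> incl env t = Fract u 1" "(u, x) \<in> evals"
      "tparams t' \<subseteq> k" "tvars t' \<subseteq> range (idx :: 'n \<Rightarrow> nat)"
      "\<forall>e. tval ring_of_type_algebra \<delta> id e t' = G e"
      "tval ring_of_type_algebra \<Delta> incl env t' = Fract u' 1" "(u', y) \<in> evals"
    using assms unfolding termval_def by blast
  then show ?thesis
    unfolding termval_def evals_def
    by (intro exI[of _ "Mult t t'"] exI[of _ "u * u'"]) (auto simp: rta_simps intro: pgen.pgen_mult)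
qed

lemma termval_jet: "termval (\<lambda>e. jets \<delta> (\<lambda>i. e (idx i)) l) (c l)"
proof -
  have "\<exists>t. tparams t \<subseteq> k \<and> tvars t \<subseteq> range (idx :: 'n \<Rightarrow> nat) \<and>
     (\<forall>e. tval ring_of_type_algebra \<delta> id e t = jets \<delta> (\<lambda>i. e (idx i)) (i, \<xi>)) \<and>
     tval ring_of_type_algebra \<Delta> incl env t = Fract (sol (i, \<xi>)) 1" for i :: 'n and \<xi>
  proof (induction \<xi> rule: exponent_induct)
    case zero
    show ?case by (intro exI[of _ "Var (idx i)"]) (auto simp: jets_def dpow_0 env_idx)
  next
    case (inc \<xi> j)
    then obtain t where t: "tparams t \<subseteq> k" "tvars t \<subseteq> range (idx :: 'n \<Rightarrow> nat)"
      "\<forall>e. tval ring_of_type_algebra \<delta> id e t = jets \<delta> (\<lambda>i. e (idx i)) (i, \<xi>)"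
      "tval ring_of_type_algebra \<Delta> incl env t = Fract (sol (i, \<xi>)) 1" by blast
    have "jets \<delta> b (i, inc \<xi> j) = \<delta> j (jets \<delta> b (i, \<xi>))" for b :: "'n \<Rightarrow> 'a"
      using dpow_inc[of \<delta> \<xi> j "b i"] comm by (simp add: jets_def)
    moreover have "mderiv j (sol (i, \<xi>)) = sol (i, inc \<xi> j)" by (simp add: mderiv_sol shift_def)
    ultimately have v: "tval ring_of_type_algebra \<delta> id e (Der j t) = jets \<delta> (\<lambda>i. e (idx i)) (i, inc \<xi> j)"
      "tval ring_of_type_algebra \<Delta> incl env (Der j t) = Fract (sol (i, inc \<xi> j)) 1" for e
      using t(3,4) by (simp_all add: \<Delta>(2))
    show ?case
    proof (intro exI[of _ "Der j t"] conjI allI)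
      show "tparams (Der j t) \<subseteq> k" "tvars (Der j t) \<subseteq> range (idx :: 'n \<Rightarrow> nat)" using t(1,2) by simp_all
    qed (fact v)+
  qed
  from this[of "fst l" "snd l", unfolded prod.collapse] obtain t
    where "tparams t \<subseteq> k" "tvars t \<subseteq> range (idx :: 'n \<Rightarrow> nat)"
      "\<forall>e. tval ring_of_type_algebra \<delta> id e t = jets \<delta> (\<lambda>i. e (idx i)) l"
      "tval ring_of_type_algebra \<Delta> incl env t = Fract (sol l) 1" by (elim exE conjE)
  moreover have "(sol l, c l) \<in> evals" unfolding evals_def by (rule pgen.pgen_base) simp
  ultimately show ?thesis
    unfolding termval_def by (intro exI[of _ t] exI[of _ "sol l"] conjI)
qed

lemma termval_power: "termval F y \<Longrightarrow> termval (\<lambda>e. F e ^ n) (y ^ n)"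
  by (induction n) (auto intro: termval_one termval_mult)

lemma termval_prod:
  "(\<And>i. i \<in> I \<Longrightarrow> termval (F i) (f i)) \<Longrightarrow> termval (\<lambda>e. \<Prod>i\<in>I. F i e) (prod f I)"
  by (induction I rule: infinite_finite_induct) (auto intro: termval_one termval_mult)

lemma termval_sum:
  "(\<And>i. i \<in> I \<Longrightarrow> termval (F i) (f i)) \<Longrightarrow> termval (\<lambda>e. \<Sum>i\<in>I. F i e) (sum f I)"
  by (induction I rule: infinite_finite_induct) (auto intro: termval_zero termval_add)

lemma termval_mp_eval:
  assumes "mp_over k p"
  shows "termval (\<lambda>e. mp_eval (jets \<delta> (\<lambda>i. e (idx i))) p) (mp_eval c p)"
  unfolding mp_eval_def
  by (intro termval_sum termval_mult termval_prod termval_power termval_jet termval_const)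
    (use assms in \<open>auto simp: mp_over_def\<close>)

text \<open>The fraction field of the series ring may be too large to be copied onto the type of
  \<open>K\<close>. The closure of the images of \<open>K\<close> and of the jets is stable under
  \<open>\<Delta>\<close>, contains the solution and has at most the cardinality of
  \<open>K\<close>.\<close>

lemma sat_transfer:
  assumes dc: "differentially_closed \<delta>"
    and \<phi>: "quantifier_free \<phi>" "sat ring_of_type_algebra \<Delta> incl env \<phi>"
  shows "\<exists>e. sat ring_of_type_algebra \<delta> id e \<phi>"
proof -
  let ?\<iota> = "\<lambda>f :: ('m, 'a) mps. Fract f 1"
  define S0 where "S0 = range incl \<union> range (\<lambda>l. ?\<iota> (sol l))"
  have inf: "infinite (UNIV :: 'a set)" by (simp add: infinite_UNIV_char_0)
  have "inj incl" unfolding incl_def using taylor_inj by (auto simp: inj_def eq_fract)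
  then have infS: "infinite S0" using inf by (auto simp: S0_def finite_image_iff)
  have nat: "lepoll (UNIV :: nat set) (UNIV :: 'a set)" using inf by (simp add: infinite_le_lepoll)
  have countable: "lepoll (UNIV :: ('n, 'm) jet set) (UNIV :: nat set)"
  proof -
    have "inj (\<lambda>l :: ('n, 'm) jet. to_nat (idx (fst l), snd l))" by (auto simp: inj_def prod_eq_iff)
    then show ?thesis unfolding lepoll_def by blast
  qed
  have jets: "lepoll (range (\<lambda>l. ?\<iota> (sol l))) (UNIV :: 'a set)"
    by (rule lepoll_trans[OF image_lepoll lepoll_trans[OF countable nat]])
  have "lepoll (\<Union>i\<in>(UNIV :: bool set). if i then range incl else range (\<lambda>l. ?\<iota> (sol l))) (UNIV :: 'a set)"
  proof (rule UN_lepoll[OF inf])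
    show "lepoll (UNIV :: bool set) (UNIV :: 'a set)"
      using finite_lepoll_infinite[OF inf finite[of "UNIV :: bool set"]] .
    show "lepoll (if i then range incl else range (\<lambda>l. ?\<iota> (sol l))) (UNIV :: 'a set)" for i
      using image_lepoll[of incl UNIV] jets by simp
  qed
  moreover have "(\<Union>i\<in>(UNIV :: bool set). if i then range incl else range (\<lambda>l. ?\<iota> (sol l))) = S0"
    by (auto simp: S0_def split: if_splits)
  ultimately have "lepoll S0 (UNIV :: 'a set)" by simp
  then have L0: "lepoll (dcl S0) (UNIV :: 'a set)" by (rule lepoll_trans[OF dcl_lepoll[OF infS]])
  have \<Delta>S0: "\<Delta> j s \<in> S0" if "s \<in> S0" for j s
    using that by (auto simp: S0_def incl_def \<Delta>(2) mderiv_taylor mderiv_sol)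
  note sf = subfield_rtaD[OF subfield_dcl]
  note sup = dcl_superset[of S0]
  have "0 \<in> dcl S0" by (simp add: dcl_def der_0)
  show ?thesis
  proof (rule differentially_closed_solution[OF dc, of \<Delta> "dcl S0" incl env])
    show "is_der (\<Delta> j)" for j by (rule \<Delta>(1))
    show "\<Delta> i (\<Delta> j x) = \<Delta> j (\<Delta> i x)" for i j x by (rule \<Delta>(3))
    show "subfield (dcl S0) ring_of_type_algebra" by (rule subfield_dcl)
    show "\<Delta> j x \<in> dcl S0" if "x \<in> dcl S0" for j x using dcl_stable[OF \<Delta>(1) \<Delta>S0 that] .
    show "range incl \<subseteq> dcl S0" using sup by (auto simp: S0_def)
    show "range env \<subseteq> dcl S0" using sup \<open>0 \<in> dcl S0\<close> by (auto simp: S0_def env_def)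
    show "incl (x + y) = incl x + incl y" for x y by (simp add: incl_def taylor_add)
    show "incl (x * y) = incl x * incl y" for x y by (simp add: incl_def taylor_mult)
    show "incl 1 = 1" by (simp add: incl_def taylor_1 One_fract_def)
    show "incl (\<delta> j x) = \<Delta> j (incl x)" for j x by (simp add: incl_def \<Delta>(2) mderiv_taylor)
  qed (use L0 \<phi> in auto)
qed

end

text \<open>\<open>\<Theta>\<close> is the quantifier-free type over \<open>k\<close> of the series
  solution. Differential closedness satisfies its members one by one, saturation all at once;
  inequations belong to the type too, so no further equations hold at the point.\<close>

theorem realisation:
  assumes dc: "differentially_closed \<delta>" and sat: "saturated \<delta>" and k: "infinite k" "k \<prec> (UNIV :: 'a set)"
  shows "\<exists>w :: 'n \<Rightarrow> 'a. \<forall>p. mp_over k p \<longrightarrow> (mp_eval (jets \<delta> w) p = 0 \<longleftrightarrow> mp_eval c p = 0)"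
proof -
  from exists_total_derivations obtain \<Delta> :: "'m \<Rightarrow> ('m, 'a) mps fract \<Rightarrow> ('m, 'a) mps fract"
    where \<Delta>0: "\<forall>j. is_der (\<Delta> j)" "\<forall>j f. \<Delta> j (Fract f 1) = Fract (mderiv j f) 1"
      "\<forall>i j x. \<Delta> i (\<Delta> j x) = \<Delta> j (\<Delta> i x)" by (elim exE conjE)
  note \<Delta> = \<Delta>0[rule_format]
  define N where "N = Suc (Max (range (idx :: 'n \<Rightarrow> nat)))"
  have N: "range (idx :: 'n \<Rightarrow> nat) \<subseteq> {..<N}" by (auto simp: N_def less_Suc_eq_le)
  let ?sat = "sat ring_of_type_algebra \<Delta> incl env"
  define \<Theta> where "\<Theta> = {\<phi>. quantifier_free \<phi> \<and> fparams \<phi> \<subseteq> k \<and> free_vars \<phi> \<subseteq> {..<N} \<and> ?sat \<phi>}"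
  have "\<exists>e. \<forall>\<phi>\<in>\<Theta>. sat ring_of_type_algebra \<delta> id e \<phi>"
  proof (rule saturated_realises[OF sat k, of \<Theta> N])
    fix \<phi> \<psi> assume \<phi>: "\<phi> \<in> \<Theta>"
    then show "quantifier_free \<phi> \<and> fparams \<phi> \<subseteq> k \<and> free_vars \<phi> \<subseteq> {..<N}" by (simp add: \<Theta>_def)
    show "FAnd \<phi> \<psi> \<in> \<Theta>" if "\<psi> \<in> \<Theta>" using \<phi> that by (simp add: \<Theta>_def)
    show "\<exists>e. sat ring_of_type_algebra \<delta> id e \<phi>"
      by (rule sat_transfer[OF \<Delta> dc]) (use \<phi> in \<open>simp_all add: \<Theta>_def\<close>)
  next
    have "FEq Zero Zero \<in> \<Theta>" by (simp add: \<Theta>_def)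
    then show "\<Theta> \<noteq> {}" by auto
  qed
  then obtain e where "\<forall>\<phi>\<in>\<Theta>. sat ring_of_type_algebra \<delta> id e \<phi>" by (rule exE)
  note e = bspec[OF this]
  show ?thesis
  proof (intro exI[of _ "\<lambda>i. e (idx i)"] allI impI)
    fix p :: "('n, 'm, 'a) dpol" assume "mp_over k p"
    then obtain t u where t: "tparams t \<subseteq> k" "tvars t \<subseteq> range (idx :: 'n \<Rightarrow> nat)"
      "\<And>e. tval ring_of_type_algebra \<delta> id e t = mp_eval (jets \<delta> (\<lambda>i. e (idx i))) p"
      "tval ring_of_type_algebra \<Delta> incl env t = Fract u 1" "(u, mp_eval c p) \<in> evals"
      using termval_mp_eval[OF \<Delta>] unfolding termval_def[OF \<Delta>] by blast
    have u: "Fract u 1 = 0 \<longleftrightarrow> u = 0" by (simp add: Zero_fract_def eq_fract)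
    have t0: "tvars t \<subseteq> {..<N}" using t(2) N by blast
    show "mp_eval (jets \<delta> (\<lambda>i. e (idx i))) p = 0 \<longleftrightarrow> mp_eval c p = 0"
    proof (cases "u = 0")
      case True
      then have "FEq t Zero \<in> \<Theta>" using t(1,4) t0 u by (simp add: \<Theta>_def rta_simps)
      then show ?thesis using e[of "FEq t Zero"] evals_eq_0_iff[OF t(5)] True by (simp add: t(3) rta_simps)
    next
      case False
      then have "FNot (FEq t Zero) \<in> \<Theta>" using t(1,4) t0 u by (simp add: \<Theta>_def rta_simps)
      then show ?thesis using e[of "FNot (FEq t Zero)"] evals_eq_0_iff[OF t(5)] False by (simp add: t(3) rta_simps)
    qed
  qed
qed

end

section \<open>Geometry: comparison of the component with the locus of the new solution\<close>

section \<open>Irreducible components\<close>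

lemma mp_eval_cong: "(\<And>v. v \<in> mp_vars p \<Longrightarrow> f v = g v) \<Longrightarrow> mp_eval f p = mp_eval g p"
  unfolding mp_eval_def mp_vars_def
  by (intro sum.cong prod.cong refl arg_cong2[of _ _ _ _ "(*)"] arg_cong2[of _ _ _ _ "(^)"]) blast

lemma finite_mp_vars: "finite (mp_vars p)"
  by (simp add: mp_vars_def)

lemma dp_orderD:
  assumes "dp_order p \<le> r" "l \<in> mp_vars p"
  shows "jord l \<le> r"
proof -
  have "mord (snd l) \<in> insert 0 ((\<lambda>(i, \<xi>). mord \<xi>) ` mp_vars p)"
    using assms(2) by (auto simp: image_iff case_prod_unfold)
  then have "mord (snd l) \<le> dp_order p"
    unfolding dp_order_def by (intro Max_ge) (simp_all add: finite_mp_vars)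
  then show ?thesis using assms(1) by (simp add: jord_def)
qed

text \<open>The relation \<open>?G\<close> of simultaneous values transports an algebraic equation
  for \<open>f l\<close> coefficient by coefficient to \<open>g l\<close>. As it relates 0 to 0
  alone in both directions, the leading coefficient stays nonzero and the root stays a root.\<close>

lemma leader_vanishing_imp:
  fixes k :: "'a::field_char_0 set" and f g :: "('n::finite, 'm::finite) jet \<Rightarrow> 'a"
  assumes k: "sring k" and v: "\<And>p. mp_over k p \<Longrightarrow> mp_eval f p = 0 \<longleftrightarrow> mp_eval g p = 0"
    and l: "leader k f l"
  shows "leader k g l"
proof -
  let ?G = "\<lambda>A. pgen ((\<lambda>a. (a, a)) ` k \<union> (\<lambda>v. (f v, g v)) ` A)"
  have zero: "x = 0 \<longleftrightarrow> y = 0" if xy: "(x, y) \<in> ?G UNIV" for x y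
  proof -
    obtain p where "p \<in> mp_ring k UNIV" "x = mp_eval f p" "y = mp_eval g p"
      using xy pgen_mp_eval[OF k, of x y f g UNIV] by blast
    then show ?thesis using v[of p] by (simp add: mp_ring_def)
  qed
  have mono: "?G (lower l) \<subseteq> ?G UNIV" by (rule pgen_mono) blast
  obtain p where p: "p \<noteq> 0" "\<And>n. coeff p n \<in> sgen (k \<union> f ` lower l)" "poly p (f l) = 0"
    using l unfolding leader_def dcl_algebraic algebraic_over_def by blast
  have ex: "\<exists>y. (coeff p n, y) \<in> ?G (lower l) \<and> y \<in> sgen (k \<union> g ` lower l)" for n
  proof -
    obtain q where "q \<in> mp_ring k (lower l)" "coeff p n = mp_eval f q"
      using p(2)[of n] sgen_mp_eval[OF k] by blast
    then show ?thesis
      using pgen_mp_eval[OF k, of _ _ f g "lower l"] sgen_mp_eval[OF k, of _ g "lower l"] by blast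
  qed
  from choice[OF allI[OF ex]] obtain y
    where "\<forall>n. (coeff p n, y n) \<in> ?G (lower l) \<and> y n \<in> sgen (k \<union> g ` lower l)" by (rule exE)
  then have y: "(coeff p n, y n) \<in> ?G (lower l)" "y n \<in> sgen (k \<union> g ` lower l)" for n by simp_all
  define q where "q = (\<Sum>n\<le>degree p. monom (y n) n)"
  have cq: "coeff q n = (if n \<le> degree p then y n else 0)" for n by (simp add: q_def coeff_sum)
  have z: "0 \<in> sgen (k \<union> g ` lower l)" using sring_sgen[of "k \<union> g ` lower l"] by (simp add: sring_def)
  have "y (degree p) \<noteq> 0" using zero[OF subsetD[OF mono y(1)], of "degree p"] p(1) by simp
  then have "q \<noteq> 0" using cq[of "degree p"] by auto
  moreover have "coeff q n \<in> sgen (k \<union> g ` lower l)" for n using y(2)[of n] z by (simp add: cq)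
  moreover have "(poly p (f l), poly q (g l)) \<in> ?G UNIV"
  proof -
    have "poly q (g l) = (\<Sum>n\<le>degree p. y n * g l ^ n)" by (simp add: q_def poly_sum poly_monom)
    moreover have "(\<Sum>n\<le>degree p. coeff p n * f l ^ n, \<Sum>n\<le>degree p. y n * g l ^ n) \<in> ?G UNIV"
    proof (intro pgen_sum pgen.pgen_mult pgen_power)
      show "(coeff p n, y n) \<in> ?G UNIV" for n using y(1) mono by blast
      show "(f l, g l) \<in> ?G UNIV" by (rule pgen.pgen_base) blast
    qed
    ultimately show ?thesis by (simp only: poly_altdef)
  qed
  then have "poly q (g l) = 0" using zero p(3) by blast
  ultimately show ?thesis unfolding leader_def dcl_algebraic algebraic_over_def by blast
qed

lemma leader_vanishing:
  fixes k :: "'a::field_char_0 set" and f g :: "('n::finite, 'm::finite) jet \<Rightarrow> 'a"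
  assumes "sring k" "\<And>p. mp_over k p \<Longrightarrow> mp_eval f p = 0 \<longleftrightarrow> mp_eval g p = 0"
  shows "leader k f l \<longleftrightarrow> leader k g l"
  using leader_vanishing_imp[of k f g l] leader_vanishing_imp[of k g f l] assms by blast

definition locus ::
    "('m::finite \<Rightarrow> 'a::comm_semiring_1 \<Rightarrow> 'a) \<Rightarrow> 'a set \<Rightarrow> ('n \<Rightarrow> 'a) \<Rightarrow> ('n \<Rightarrow> 'a) set" where
  "locus \<delta> k w = zero_set \<delta> {p. mp_over k p \<and> dp_eval \<delta> w p = 0}"

lemma irreducible_locus:
  fixes w :: "'n \<Rightarrow> 'a::comm_semiring_1"
  shows "irreducible_variety \<delta> k (locus \<delta> k w)"
proof -
  have w: "w \<in> locus \<delta> k w" by (simp add: locus_def zero_set_def)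
  have min: "locus \<delta> k w \<subseteq> W1" if W1: "diff_variety \<delta> k W1" and "w \<in> W1" for W1
  proof -
    obtain S1 :: "('n, 'b, 'a) dpol set" where "\<forall>p\<in>S1. mp_over k p" "W1 = zero_set \<delta> S1"
      using W1 unfolding diff_variety_def by blast
    then show ?thesis using \<open>w \<in> W1\<close> by (auto simp: locus_def zero_set_def)
  qed
  show ?thesis
    unfolding irreducible_variety_def
  proof (intro conjI allI impI)
    show "diff_variety \<delta> k (locus \<delta> k w)"
      unfolding diff_variety_def locus_def by (intro exI conjI) auto
    show "locus \<delta> k w \<noteq> {}" using w by blast
    fix W1 W2 assume *: "diff_variety \<delta> k W1" "diff_variety \<delta> k W2" "locus \<delta> k w = W1 \<union> W2"
    then have "w \<in> W1 \<or> w \<in> W2" using w by blast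
    then show "locus \<delta> k w = W1 \<or> locus \<delta> k w = W2" using min[OF *(1)] min[OF *(2)] *(3) by blast
  qed
qed

text \<open>The specialization puts \<open>W\<close> into the locus of \<open>w\<close>. The
  equations of the variety have order at most \<open>r \<le> d\<close>, where \<open>c\<close> and
  \<open>b\<close> agree, so the locus lies in the variety. Equality then makes vanishing at
  \<open>c\<close> and at \<open>b\<close> equivalent, hence both have the same leaders, and those
  of \<open>c\<close> are generated in order at most \<open>d\<close> by construction.\<close>

lemma (in diff_point) component_leaders:
  fixes S :: "('n, 'm, 'a) dpol set"
  assumes dc: "differentially_closed \<delta>" and sat: "saturated \<delta>" and k: "infinite k" "k \<prec> (UNIV :: 'a set)"
    and S: "\<And>p. p \<in> S \<Longrightarrow> mp_over k p \<and> dp_order p \<le> r"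
    and W: "irreducible_component \<delta> k (zero_set \<delta> S) W" "generic_point \<delta> k W b"
    and d: "r \<le> d" "\<And>i u. Suc d \<le> mord u \<Longrightarrow> lconn (below d (lead i)) u"
  shows "lead i = below d (lead i)"
proof -
  obtain c D where cb: "\<And>l. jord l \<le> d \<Longrightarrow> c l = bj l"
    and lead: "\<And>l. leader k c l \<longleftrightarrow> gen_lead d l"
    and D: "\<And>j. is_der (D j)" "\<And>j a. a \<in> k \<Longrightarrow> D j a = \<delta> j a" "\<And>j l. D j (c l) = c (shift l j)"
    using generic_jet[of d, OF d(2)] by metis
  interpret formal_solution \<delta> k c D
    by unfold_locales (use der_\<delta> comm k_ring k_stable D in auto)
  obtain w :: "'n \<Rightarrow> 'a" where w: "\<forall>p. mp_over k p \<longrightarrow> (mp_eval (jets \<delta> w) p = 0 \<longleftrightarrow> mp_eval c p = 0)"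
    using realisation[OF dc sat k] by (rule exE)
  have speci: "mp_eval bj p = 0" if "mp_over k p" "mp_eval c p = 0" for p
    by (rule specialization[where c = c and d = d and D = D]) (use that cb lead D in \<open>auto simp: mp_ring_def\<close>)
  have bW: "b \<in> W" using W(2) by (simp add: generic_point_def)
  have gen: "dp_eval \<delta> b p = 0 \<longleftrightarrow> (\<forall>y\<in>W. dp_eval \<delta> y p = 0)" if "mp_over k p" for p :: "('n, 'm, 'a) dpol"
    using W(2) that by (simp add: generic_point_def)
  have "W \<subseteq> locus \<delta> k w"
    unfolding locus_def zero_set_def
    using gen w speci by (auto simp: dp_eval_jets)
  moreover have "locus \<delta> k w \<subseteq> zero_set \<delta> S"
  proof -
    have "mp_eval (jets \<delta> w) p = 0" if p: "p \<in> S" for p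
    proof -
      have "W \<subseteq> zero_set \<delta> S" using W(1) by (simp add: irreducible_component_def)
      then have "mp_eval bj p = 0" using bW p by (auto simp: zero_set_def dp_eval_jets)
      moreover have "mp_eval c p = mp_eval bj p"
      proof (rule mp_eval_cong)
        fix l assume "l \<in> mp_vars p"
        then have "jord l \<le> r" using dp_orderD[of p r l] S[OF p] by simp
        then show "c l = bj l" using d(1) by (intro cb) simp
      qed
      ultimately show ?thesis using w S[OF p] by simp
    qed
    then show ?thesis using S by (auto simp: locus_def zero_set_def dp_eval_jets)
  qed
  ultimately have eq: "locus \<delta> k w = W"
    using W(1) irreducible_locus[of \<delta> k w] unfolding irreducible_component_def by blast
  have "w \<in> W" unfolding eq[symmetric] by (simp add: locus_def zero_set_def)
  then have "mp_eval c p = 0" if "mp_over k p" "mp_eval bj p = 0" for p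
    using gen[OF that(1)] that(2) mp[OF spec[OF w] that(1)] by (auto simp: dp_eval_jets)
  then have bl: "leader k bj l \<longleftrightarrow> gen_lead d l" for l
    unfolding lead[symmetric] by (intro leader_vanishing[OF k_ring]) (use speci in blast)
  have "\<xi> \<in> lead i \<longleftrightarrow> leader k bj (i, \<xi>)" for \<xi> by (simp add: lead_def)
  then show ?thesis unfolding bl gen_lead_def fst_conv snd_conv by blast
qed

section \<open>Counting: from generators of bounded order to the Kolchin polynomial\<close>

section \<open>Transcendence degrees of jet fields\<close>

lemma generate_field_dcl:
  fixes A :: "'a::field_char_0 set"
  shows "generate_field ring_of_type_algebra A \<subseteq> dcl A"
proof
  fix x assume "x \<in> generate_field (ring_of_type_algebra :: 'a ring) A"
  then show "x \<in> dcl A"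
    by induction (use dcl_superset[of A] in
      \<open>auto simp: rta_simps rta_a_inv rta_m_inv dcl_def der_1 der_minus der_inverse der_add der_mult\<close>)
qed

text \<open>Since the ranking is orderly, a leader of order at most \<open>s\<close> depends only on
  jets of order at most \<open>s\<close>; so the non-leaders of order at most \<open>s\<close> form
  a transcendence basis.\<close>

lemma (in diff_point) trdeg_jet_field:
  "trdeg k (jet_field \<delta> k b s) = card {l. \<not> leader k bj l \<and> jord l \<le> s}"
proof -
  let ?N = "{l. \<not> leader k bj l \<and> jord l \<le> s}"
  have fin: "finite ?N" by (rule finite_subset[OF _ finite_jord[of s]]) blast
  have gens: "k \<union> {dpow \<delta> \<xi> (b i) | \<xi> i. mord \<xi> \<le> s} = k \<union> bj ` {l. jord l \<le> s}"
    by (force simp: jets_def jord_def image_iff)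
  have "trdeg k (jet_field \<delta> k b s) = card (bj ` ?N)"
  proof (rule trdeg_eq[OF k_ring])
    show "finite (bj ` ?N)" using fin by simp
    show "dindep k (bj ` ?N)" by (rule nonleader_dindep[OF fin]) blast
    show "bj ` ?N \<subseteq> jet_field \<delta> k b s"
      unfolding jet_field_def gens by (blast intro: generate_field.incl)
    have "k \<union> bj ` {l. jord l \<le> s} \<subseteq> dcl (k \<union> bj ` ?N)"
      using nonleader_span[of _ s bj k] dcl_superset[of "k \<union> bj ` ?N"] by blast
    then show "jet_field \<delta> k b s \<subseteq> dcl (k \<union> bj ` ?N)"
      unfolding jet_field_def gens using generate_field_dcl dcl_minimal by blast
  qed
  also have "\<dots> = card ?N"
    by (rule card_image) (rule inj_on_subset[OF nonleader_inj], blast)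
  finally show ?thesis .
qed

section \<open>Counting complements of monomial ideals\<close>

lemma sum_mnum: "(\<Sum>e\<le>d. mnum p e) = (d + p) choose p"
proof -
  have "(\<Sum>e\<le>d. mnum p e) = mnum (Suc p) d" for p by (induction d) auto
  moreover have "mnum (Suc p) d = (d + p) choose p"
  proof (induction p arbitrary: d)
    case 0
    show ?case by (induction d) auto
  next
    case (Suc p)
    note IH = Suc
    show ?case
    proof (induction d)
      case (Suc d)
      show ?case unfolding mnum.simps(3)[of "Suc p" d] Suc IH by simp
    qed simp
  qed
  ultimately show ?thesis by simp
qed

definition binpoly :: "int \<Rightarrow> nat \<Rightarrow> rat poly" where
  "binpoly a p = smult (1 / fact p) (\<Prod>i<p. [:of_int a - of_nat i, 1:])"

lemma poly_binpoly: "poly (binpoly a p) x = (x + of_int a) gchoose p"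
  by (simp add: binpoly_def poly_prod gbinomial_prod_rev atLeast0LessThan algebra_simps)

lemma gbinomial_of_int_Ints: "(of_int z gchoose p :: rat) \<in> \<int>"
proof (cases "z \<ge> 0")
  case True
  then have "(of_int z :: rat) = of_nat (nat z)" by simp
  then show ?thesis by (simp only: binomial_gbinomial[symmetric] Ints_of_nat)
next
  case False
  then have "of_nat p - of_int z - 1 = (of_nat (nat (int p - z - 1)) :: rat)" by simp
  then have "(of_int z gchoose p :: rat) = (-1) ^ p * of_nat (nat (int p - z - 1) choose p)"
    by (simp only: gbinomial_negated_upper[of "of_int z"] binomial_gbinomial)
  then show ?thesis by simp
qed

lemma numerical_binpoly: "numerical_polynomial (binpoly a p)"
  unfolding numerical_polynomial_def poly_binpoly of_int_add[symmetric]
  by (intro allI gbinomial_of_int_Ints)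

lemma numerical_sum: "(\<And>i. i \<in> I \<Longrightarrow> numerical_polynomial (f i)) \<Longrightarrow> numerical_polynomial (sum f I)"
  by (auto simp: numerical_polynomial_def poly_sum intro: Ints_sum)

text \<open>Membership in an ideal generated in order at most \<open>C\<close> does not change if
  all exponents are cut off at \<open>C\<close>. The complement is therefore a finite union of
  fibers of this map, each a translate of the monomials in the variables of
  \<open>tops\<close>.\<close>

definition capped :: "nat \<Rightarrow> ('m \<Rightarrow> nat) \<Rightarrow> 'm \<Rightarrow> nat" where
  "capped C \<xi> = (\<lambda>j. min (\<xi> j) C)"

definition tops :: "nat \<Rightarrow> ('m \<Rightarrow> nat) \<Rightarrow> 'm set" where
  "tops C \<tau> = {j. \<tau> j = C}"

lemma capped_mem:
  fixes E :: "('m::finite \<Rightarrow> nat) set"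
  assumes "E = below C E"
  shows "capped C \<xi> \<in> E \<longleftrightarrow> \<xi> \<in> E"
proof -
  have "e \<le> capped C \<xi> \<longleftrightarrow> e \<le> \<xi>" if "mord e \<le> C" for e :: "'m \<Rightarrow> nat"
  proof -
    have "e j \<le> C" for j using le_mord[of e j] that by simp
    then show ?thesis by (auto simp: le_fun_def capped_def)
  qed
  then have "capped C \<xi> \<in> below C E \<longleftrightarrow> \<xi> \<in> below C E" by (auto simp: below_def above_def)
  then show ?thesis using assms by simp
qed

lemma finite_mord_le: "finite {\<xi> :: 'm::finite \<Rightarrow> nat. mord \<xi> \<le> s}"
proof (rule finite_subset)
  show "{\<xi> :: 'm \<Rightarrow> nat. mord \<xi> \<le> s} \<subseteq> (\<Union>d\<le>s. mons UNIV d)" by (auto simp: mons_def)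
qed (simp add: finite_mons)

lemma finite_box: "finite {\<tau> :: 'm::finite \<Rightarrow> nat. \<forall>j. \<tau> j \<le> C}"
proof (rule finite_subset[OF _ finite_mord_le[of "CARD('m) * C"]])
  have "mord \<tau> \<le> CARD('m) * C" if "\<forall>j. \<tau> j \<le> C" for \<tau> :: "'m \<Rightarrow> nat"
    unfolding mord_def using sum_bounded_above[of UNIV \<tau> C] that by simp
  then show "{\<tau> :: 'm \<Rightarrow> nat. \<forall>j. \<tau> j \<le> C} \<subseteq> {\<tau>. mord \<tau> \<le> CARD('m) * C}" by blast
qed

lemma capped_fiber:
  fixes \<tau> :: "'m::finite \<Rightarrow> nat"
  assumes \<tau>: "\<forall>j. \<tau> j \<le> C" and s: "mord \<tau> \<le> s"
  shows "{\<xi>. capped C \<xi> = \<tau> \<and> mord \<xi> \<le> s} = madd \<tau> ` (\<Union>e\<le>s - mord \<tau>. mons (tops C \<tau>) e)"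
proof (intro equalityI subsetI)
  fix \<xi> assume "\<xi> \<in> {\<xi>. capped C \<xi> = \<tau> \<and> mord \<xi> \<le> s}"
  then have \<xi>: "\<tau> = capped C \<xi>" "mord \<xi> \<le> s" by auto
  define \<eta> where "\<eta> = (\<lambda>j. \<xi> j - \<tau> j)"
  have 1: "madd \<tau> \<eta> = \<xi>" by (auto simp: madd_def \<eta>_def \<xi>(1) capped_def)
  have "\<eta> j = 0" if "j \<notin> tops C \<tau>" for j using that by (auto simp: \<eta>_def tops_def \<xi>(1) capped_def min_def split: if_splits)
  moreover have "mord \<eta> \<le> s - mord \<tau>" using \<xi>(2) mord_madd[of \<tau> \<eta>] 1 by simp
  ultimately show "\<xi> \<in> madd \<tau> ` (\<Union>e\<le>s - mord \<tau>. mons (tops C \<tau>) e)"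
    using 1 by (intro image_eqI[of _ _ \<eta>]) (auto simp: mons_def)
next
  fix \<xi> assume "\<xi> \<in> madd \<tau> ` (\<Union>e\<le>s - mord \<tau>. mons (tops C \<tau>) e)"
  then obtain \<eta> where \<eta>: "\<xi> = madd \<tau> \<eta>" "\<And>j. j \<notin> tops C \<tau> \<Longrightarrow> \<eta> j = 0" "mord \<eta> \<le> s - mord \<tau>"
    by (auto simp: mons_def)
  have "capped C \<xi> j = \<tau> j" for j
    using \<tau> \<eta>(2)[of j] by (cases "j \<in> tops C \<tau>") (auto simp: capped_def \<eta>(1) madd_def tops_def)
  moreover have "mord \<xi> \<le> s" using \<eta>(3) s by (simp add: \<eta>(1) mord_madd)
  ultimately show "\<xi> \<in> {\<xi>. capped C \<xi> = \<tau> \<and> mord \<xi> \<le> s}" by auto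
qed

text \<open>The hypothesis on \<open>s\<close> makes the upper argument of the binomial coefficient nonnegative even
  when the fiber is empty, in which case both sides vanish.\<close>

lemma card_capped_fiber:
  fixes \<tau> :: "'m::finite \<Rightarrow> nat"
  assumes \<tau>: "\<forall>j. \<tau> j \<le> C" and s: "CARD('m) * C \<le> s + CARD('m)"
  shows "of_nat (card {\<xi>. capped C \<xi> = \<tau> \<and> mord \<xi> \<le> s}) =
    poly (binpoly (int (card (tops C \<tau>)) - int (mord \<tau>)) (card (tops C \<tau>))) (of_nat s)"
proof -
  let ?J = "tops C \<tau>" and ?p = "card (tops C \<tau>)"
  \<comment> \<open>This is the origin of m C - m. An exponent outside \<open>tops\<close> is at
    most C - 1, so the order of \<open>\<tau>\<close> is at most m C - m plus the number of
    \<open>tops\<close>, and the hypothesis on \<open>s\<close> gives \<open>le\<close>.\<close>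
  have sum: "(\<Sum>j\<in>UNIV. \<tau> j + (if j \<in> ?J then 0 else 1)) \<le> (\<Sum>j\<in>(UNIV :: 'm set). C)"
  proof (rule sum_mono)
    show "\<tau> j + (if j \<in> ?J then 0 else 1) \<le> C" for j
      using spec[OF \<tau>, of j] by (cases "\<tau> j = C") (auto simp: tops_def)
  qed
  have "(\<Sum>j\<in>UNIV. if j \<in> ?J then 0 else 1) + ?p = (\<Sum>j\<in>UNIV. (if j \<in> ?J then 0 else 1) + (if j \<in> ?J then 1 else 0 :: nat))"
    by (subst sum.distrib) (simp add: sum.If_cases)
  also have "\<dots> = (\<Sum>j\<in>(UNIV :: 'm set). 1)" by (rule sum.cong) auto
  finally have "(\<Sum>j\<in>UNIV. if j \<in> ?J then 0 else 1) + ?p = CARD('m)" by simp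
  then have le: "mord \<tau> \<le> s + ?p" using sum s by (simp add: sum.distrib mord_def)
  have val: "poly (binpoly (int ?p - int (mord \<tau>)) ?p) (of_nat s) = of_nat ((s + ?p - mord \<tau>) choose ?p)"
  proof -
    have "of_nat s + of_int (int ?p - int (mord \<tau>)) = (of_nat (s + ?p - mord \<tau>) :: rat)"
      using le by (simp add: of_nat_diff)
    then show ?thesis by (simp add: poly_binpoly binomial_gbinomial del: of_int_diff)
  qed
  show ?thesis
  proof (cases "mord \<tau> \<le> s")
    case True
    have "card {\<xi>. capped C \<xi> = \<tau> \<and> mord \<xi> \<le> s} = card (\<Union>e\<le>s - mord \<tau>. mons ?J e)"
      unfolding capped_fiber[OF \<tau> True]
      by (rule card_image) (auto simp: inj_on_def madd_def fun_eq_iff)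
    also have "\<dots> = (\<Sum>e\<le>s - mord \<tau>. card (mons ?J e))"
      by (rule card_UN_disjoint) (simp_all add: finite_mons, auto simp: mons_def)
    also have "\<dots> = (s - mord \<tau> + ?p) choose ?p" by (simp add: card_mons sum_mnum)
    also have "s - mord \<tau> + ?p = s + ?p - mord \<tau>" using True by simp
    finally show ?thesis unfolding val by simp
  next
    case False
    have "mord \<tau> \<le> mord \<xi>" if "capped C \<xi> = \<tau>" for \<xi>
      using that by (intro mord_mono) (auto simp: le_fun_def capped_def)
    then have "{\<xi>. capped C \<xi> = \<tau> \<and> mord \<xi> \<le> s} = {}" using False by fastforce
    moreover have "(s + ?p - mord \<tau>) choose ?p = 0" using False le by (intro binomial_eq_0) simp
    ultimately show ?thesis unfolding val by (simp only: card.empty)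
  qed
qed

definition box :: "nat \<Rightarrow> ('m::finite \<Rightarrow> nat) set \<Rightarrow> ('m \<Rightarrow> nat) set" where
  "box C E = {\<tau>. \<forall>j. \<tau> j \<le> C} - E"

definition complement_poly :: "nat \<Rightarrow> ('m::finite \<Rightarrow> nat) set \<Rightarrow> rat poly" where
  "complement_poly C E =
     (\<Sum>\<tau>\<in>box C E. binpoly (int (card (tops C \<tau>)) - int (mord \<tau>)) (card (tops C \<tau>)))"

lemma numerical_complement_poly: "numerical_polynomial (complement_poly C E)"
  unfolding complement_poly_def by (rule numerical_sum) (rule numerical_binpoly)

lemma card_complement:
  fixes E :: "('m::finite \<Rightarrow> nat) set"
  assumes E: "E = below C E" and s: "CARD('m) * C \<le> s + CARD('m)"
  shows "of_nat (card {\<xi>. \<xi> \<notin> E \<and> mord \<xi> \<le> s}) = poly (complement_poly C E) (of_nat s)"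
proof -
  let ?F = "\<lambda>\<tau>. {\<xi>. capped C \<xi> = \<tau> \<and> mord \<xi> \<le> s}"
  have "{\<xi>. \<xi> \<notin> E \<and> mord \<xi> \<le> s} = (\<Union>\<tau>\<in>box C E. ?F \<tau>)"
    by (auto simp: box_def capped_mem[OF E]) (auto simp: capped_def)
  moreover have "finite (?F \<tau>)" for \<tau> :: "'m \<Rightarrow> nat"
    by (rule finite_subset[OF _ finite_mord_le[of s]]) blast
  moreover have "finite (box C E)" unfolding box_def using finite_box by blast
  ultimately have "card {\<xi>. \<xi> \<notin> E \<and> mord \<xi> \<le> s} = (\<Sum>\<tau>\<in>box C E. card (?F \<tau>))"
    by (simp only:) (rule card_UN_disjoint, auto)
  then show ?thesis
    unfolding complement_poly_def poly_sum
    by (simp only: of_nat_sum) (rule sum.cong[OF refl], rule card_capped_fiber[OF _ s], simp add: box_def)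
qed

section \<open>The Kolchin polynomial\<close>

lemma poly_eqI_eventually:
  fixes p q :: "rat poly"
  assumes "\<forall>\<^sub>F s in sequentially. poly p (of_nat s) = poly q (of_nat s)"
  shows "p = q"
proof (rule ccontr)
  assume "p \<noteq> q"
  then have fin: "finite {x. poly (p - q) x = 0}" using poly_roots_finite[of "p - q"] by simp
  obtain N where "\<And>s. s \<ge> N \<Longrightarrow> poly p (of_nat s) = poly q (of_nat s)"
    using assms by (auto simp: eventually_sequentially)
  then have "of_nat ` {N..} \<subseteq> {x. poly (p - q) x = 0}" by auto
  then have "finite ((of_nat :: nat \<Rightarrow> rat) ` {N..})" using fin finite_subset by blast
  then show False by (simp add: finite_image_iff inj_on_def infinite_Ici)
qed

lemma kolchin_poly_eqI:
  assumes "numerical_polynomial p"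
    and "\<And>s. s \<ge> N \<Longrightarrow> poly p (of_nat s) = of_nat (trdeg k (jet_field \<delta> k b s))"
  shows "kolchin_poly \<delta> k b = p"
  unfolding kolchin_poly_def
proof (rule the_equality)
  have p: "\<forall>\<^sub>F s in sequentially. poly p (of_nat s) = of_nat (trdeg k (jet_field \<delta> k b s))"
    using assms(2) by (auto simp: eventually_sequentially)
  then show "numerical_polynomial p \<and>
      (\<forall>\<^sub>F s in sequentially. poly p (of_nat s) = of_nat (trdeg k (jet_field \<delta> k b s)))"
    using assms(1) by simp
  fix q assume "numerical_polynomial q \<and>
      (\<forall>\<^sub>F s in sequentially. poly q (of_nat s) = of_nat (trdeg k (jet_field \<delta> k b s)))"
  then have "\<forall>\<^sub>F s in sequentially. poly q (of_nat s) = poly p (of_nat s)"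
    using p by (auto elim: eventually_elim2)
  then show "q = p" by (rule poly_eqI_eventually)
qed

lemma (in diff_point) trdeg_complements:
  assumes C: "\<And>i. lead i = below C (lead i)" and s: "CARD('m) * C \<le> s + CARD('m)"
  shows "of_nat (trdeg k (jet_field \<delta> k b s)) = poly (\<Sum>i\<in>UNIV. complement_poly C (lead i)) (of_nat s)"
proof -
  have "{l. \<not> leader k bj l \<and> jord l \<le> s} = (SIGMA i:UNIV. {\<xi>. \<xi> \<notin> lead i \<and> mord \<xi> \<le> s})"
    by (auto simp: lead_def jord_def)
  moreover have "finite {\<xi>. \<xi> \<notin> lead i \<and> mord \<xi> \<le> s}" for i
    by (rule finite_subset[OF _ finite_mord_le[of s]]) blast
  ultimately have "trdeg k (jet_field \<delta> k b s) = (\<Sum>i\<in>UNIV. card {\<xi>. \<xi> \<notin> lead i \<and> mord \<xi> \<le> s})"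
    by (simp add: trdeg_jet_field card_SigmaI)
  then show ?thesis by (simp add: poly_sum card_complement[OF C s])
qed

text \<open>The binomial coefficient is at least 1, so the bound dominates m C - m; moving m to the
  other side avoids a truncated subtraction when C is 0.\<close>

lemma CARD_mult_le_s_bound:
  assumes "int s \<ge> s_bound m n r" "m > 0"
  shows "m * Cnum m n r \<le> s + m"
proof -
  let ?C = "Cnum m n r"
  have "1 \<le> (?C + m - 1) choose ?C" using assms(2) by (simp add: Suc_leI zero_less_binomial)
  then have "m * ?C * 1 \<le> m * ?C * ((?C + m - 1) choose ?C)" by (intro mult_le_mono2)
  moreover have "int (m * ?C * ((?C + m - 1) choose ?C)) \<le> int (s + m)"
    using assms(1) by (simp add: s_bound_def)
  ultimately show ?thesis by linarith
qed

lemma diff_pointI: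
  fixes \<delta> :: "'m::finite \<Rightarrow> 'a::field_char_0 \<Rightarrow> 'a" and b :: "'n::finite \<Rightarrow> 'a"
  assumes dc: "differentially_closed \<delta>" and k: "differential_subfield \<delta> k" "k \<prec> (UNIV :: 'a set)"
  shows "diff_point \<delta> k" and "infinite k"
proof -
  have f: "subfield k (ring_of_type_algebra :: 'a ring)" using k(1) by (simp add: differential_subfield_def)
  note sf = subfield_rtaD[OF f]
  have "0 \<in> k" using sf(2)[OF sf(1) sf(4)[OF sf(1)]] by simp
  then have ring: "sring k" using sf by (simp add: sring_def)
  have "range (of_nat :: nat \<Rightarrow> 'a) \<subseteq> k" using sring_of_nat[OF ring] by blast
  moreover have "infinite (range (of_nat :: nat \<Rightarrow> 'a))" by (simp add: finite_image_iff inj_of_nat)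
  ultimately show inf: "infinite k" using finite_subset by blast
  have df: "differential_field (ring_of_type_algebra :: 'a ring) \<delta>"
    using dc by (simp add: differentially_closed_def)
  show "diff_point \<delta> k"
  proof
    show "is_der (\<delta> j)" for j
      using df by (simp add: differential_field_def derivation_def is_der_def rta_simps)
    show "\<delta> i (\<delta> j x) = \<delta> j (\<delta> i x)" for i j x
      using df by (simp add: differential_field_def rta_simps)
    show "sring k" by (rule ring)
    show "\<delta> j a \<in> k" if "a \<in> k" for a j using k(1) that by (simp add: differential_subfield_def)
    show "\<exists>v. v \<notin> dcl (k \<union> Y)" if "finite Y" for Y using exists_transcendental[OF inf k(2) that] .
  qed
qed

theorem theorem1:
  fixes \<delta> :: "'m::finite \<Rightarrow> 'a::field_char_0 \<Rightarrow> 'a"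
    and k :: "'a set"
    and S :: "('n::finite, 'm, 'a) dpol set"
    and V W :: "('n \<Rightarrow> 'a) set"
    and b :: "'n \<Rightarrow> 'a"
    and r s :: nat
  assumes "differentially_closed \<delta>"
    and "saturated \<delta>"
    and "differential_subfield \<delta> k"
    and "k \<prec> (UNIV :: 'a set)"
    and "\<forall>p\<in>S. mp_over k p \<and> dp_order p \<le> r"
    and "V = zero_set \<delta> S"
    and "irreducible_component \<delta> k V W"
    and "generic_point \<delta> k W b"
    and "int s \<ge> s_bound CARD('m) CARD('n) r"
  shows "poly (kolchin_poly_variety \<delta> k W) (of_nat s) = of_nat (trdeg k (jet_field \<delta> k b s))"
proof -
  let ?C = "Cnum CARD('m) CARD('n) r"
  interpret dp: diff_point \<delta> k b' for b' :: "'n \<Rightarrow> 'a" by (rule diff_pointI(1)[OF assms(1,3,4)])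
  \<comment> \<open>The polynomial of \<open>W\<close> refers to a chosen generic point. The
    argument is carried out there and transferred to \<open>b\<close> at the end, since leaders, and
    with them the transcendence degrees, depend only on the vanishing polynomials.\<close>
  define b' where "b' = (SOME b. generic_point \<delta> k W b)"
  have gen: "generic_point \<delta> k W b'" unfolding b'_def by (rule someI[of _ b]) (rule assms(8))
  have s: "CARD('m) * ?C \<le> s + CARD('m)" by (rule CARD_mult_le_s_bound[OF assms(9)]) simp
  have C: "dp.lead b' i = below ?C (dp.lead b' i)" for i
  proof (rule generators_bound)
    show "inc u j \<in> dp.lead b' i" if "u \<in> dp.lead b' i" for i u j by (rule dp.lead_inc[OF that])
    fix d assume d: "r \<le> d" "\<forall>i u. Suc d \<le> mord u \<longrightarrow> lconn (below d (dp.lead b' i)) u"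
    have "dp.lead b' i = below d (dp.lead b' i)" for i
    proof (rule dp.component_leaders[OF assms(1,2) diff_pointI(2)[OF assms(1,3,4)] assms(4)])
      show "mp_over k p \<and> dp_order p \<le> r" if "p \<in> S" for p using assms(5) that by blast
      show "irreducible_component \<delta> k (zero_set \<delta> S) W" using assms(6,7) by simp
      show "lconn (below d (dp.lead b' i)) u" if "Suc d \<le> mord u" for i u using d(2) that by blast
    qed (rule gen, rule d(1))
    then show "\<forall>i. dp.lead b' i = below d (dp.lead b' i)" by blast
  qed
  let ?P = "\<Sum>i\<in>UNIV. complement_poly ?C (dp.lead b' i)"
  have "kolchin_poly_variety \<delta> k W = ?P"
    unfolding kolchin_poly_variety_def b'_def[symmetric]
  proof (rule kolchin_poly_eqI)
    show "numerical_polynomial ?P" by (intro numerical_sum numerical_complement_poly)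
    show "poly ?P (of_nat s') = of_nat (trdeg k (jet_field \<delta> k b' s'))" if "s' \<ge> s" for s'
      by (rule dp.trdeg_complements[OF C, symmetric]) (use s that in simp)
  qed
  then have "poly (kolchin_poly_variety \<delta> k W) (of_nat s) = of_nat (trdeg k (jet_field \<delta> k b' s))"
    using dp.trdeg_complements[OF C s] by simp
  moreover have "leader k (jets \<delta> b') l \<longleftrightarrow> leader k (jets \<delta> b) l" for l
    by (rule leader_vanishing[OF dp.k_ring])
      (use gen assms(8) in \<open>simp add: generic_point_def dp_eval_jets[symmetric]\<close>)
  ultimately show ?thesis by (simp add: dp.trdeg_jet_field)
qed

end
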